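(* For integers $m\ge n\ge1$ put $$p(m,n):=n+\frac{n(n+1)}{2}\binom{m}{n},\qquad \nu(n,m):=2+m-n+\binom{\frac{(m+1)(m+2)}{2}+p(m,n)}{p(m,n)} .$$ Then: (i) for all integers $m\ge n\ge1$ and every $k\ge\nu(n,m)$, a Zariski generic real-algebraic hypersurface $M\subset\mathbb{C}^{n+1}$ of degree $k$ is not contained in $\tilde{\mathcal{M}}_m$; (ii) for all integers $N>n\ge1$, with $\mu(n,N):=\nu(n,N)$, for every $k\ge\mu(n,N)$ a Zariski generic real-algebraic hypersurface $M\subset\mathbb{C}^{n+1}$ of degree $k$ is not transversally holomorphically embeddable into a hyperquadric $\mathcal{Q}^{2N+1}\subset\mathbb{C}^{N+1}$.
   Context: $\mathcal{Q}^{2m+1}\subset\mathbb{C}^{m+1}$ denotes any nondegenerate hyperquadric $\operatorname{Im}W=-\sum_{j=1}^{l}|Z_j|^2+\sum_{j=l+1}^{m}|Z_j|^2$, $0\le l\le m$. A real hypersurface $M\subset\mathbb{C}^{n+1}$ is transversally holomorphically embeddable into $\mathcal{Q}^{2m+1}$ if for some $p\in M$ there is a holomorphic embedding $F:U\to\mathbb{C}^{m+1}$ of an open (connected) neighborhood $U$ of $p$ in $\mathbb{C}^{n+1}$ with $F(M\cap U)\subset\mathcal{Q}^{2m+1}$ and $T_{F(p)}\mathcal{Q}^{2m+1}+dF(T_p\mathbb{C}^{n+1})=T_{F(p)}\mathbb{C}^{m+1}$ (real tangent spaces). $\tilde{\mathcal{M}}_m$ is the set of real-analytic Levi-nondegenerate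 hypersurfaces $M\subset\mathbb{C}^{n+1}$ for which there exist $p\in M$ and such an embedding $F:U\to\mathbb{C}^{m+1}$ for which, in addition, $F(U)$ is not contained in any (proper) affine linear subspace of $\mathbb{C}^{m+1}$. Zariski generic: let $R_k$ be the finite-dimensional real vector space of real polynomials of degree $\le k$ on $\mathbb{C}^{n+1}=\mathbb{R}^{2n+2}$, and for $P\in R_k$ let $M_P$ be the real hypersurface $\{P=0,\ dP\ne0\}$. A statement holds for a Zariski generic real-algebraic hypersurface of degree $k$ if it holds for $M_P$ for all $P\in R_k$ outside some proper Zariski-closed subset of $R_k$; "not contained in $\tilde{\mathcal{M}}_m$" means that no Levi-nondegenerate (relatively) open piece of $M_P$ belongs to $\tilde{\mathcal{M}}_m$. *)

theory Defs
  imports "HOL-Analysis.Analysis" "HOL-Library.Poly_Mapping"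
begin

text \<open>
  The space of dimension \<open>n + 1\<close> over the complex numbers, where \<open>n = CARD('n)\<close>
  (so \<open>n \<ge> 1\<close>, types being nonempty).
  In the target space, coordinate \<open>Some j\<close> is \<open>Z\<^sub>j\<close> and coordinate \<open>None\<close> is \<open>W\<close>.
\<close>

type_synonym 'n cspace = "complex ^ 'n option"

definition monomial_eval :: "('v \<Rightarrow>\<^sub>0 nat) \<Rightarrow> ('v \<Rightarrow> real) \<Rightarrow> real" where
  "monomial_eval \<alpha> x = (\<Prod>v\<in>Poly_Mapping.keys \<alpha>. x v ^ Poly_Mapping.lookup \<alpha> v)"

definition mpoly_eval :: "(('v \<Rightarrow>\<^sub>0 nat) \<Rightarrow>\<^sub>0 real) \<Rightarrow> ('v \<Rightarrow> real) \<Rightarrow> real" where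
  "mpoly_eval P x = (\<Sum>\<alpha>\<in>Poly_Mapping.keys P. Poly_Mapping.lookup P \<alpha> * monomial_eval \<alpha> x)"

definition monomial_degree :: "('v \<Rightarrow>\<^sub>0 nat) \<Rightarrow> nat" where
  "monomial_degree \<alpha> = (\<Sum>v\<in>Poly_Mapping.keys \<alpha>. Poly_Mapping.lookup \<alpha> v)"

text \<open>
  Real polynomials on a Euclidean space have the elements of \<^const>\<open>Basis\<close> as variables; the
  variable \<open>b\<close> stands for the coordinate \<open>x \<bullet> b\<close>. On a complex coordinate space these
  coordinates are the real and imaginary parts of the components.
\<close>

definition real_polys :: "nat \<Rightarrow> (('a::euclidean_space \<Rightarrow>\<^sub>0 nat) \<Rightarrow>\<^sub>0 real) set" where
  "real_polys k =
     {P. \<forall>\<alpha>\<in>Poly_Mapping.keys P. Poly_Mapping.keys \<alpha> \<subseteq> Basis \<and> monomial_degree \<alpha> \<le> k}"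

definition poly_fun :: "(('a::euclidean_space \<Rightarrow>\<^sub>0 nat) \<Rightarrow>\<^sub>0 real) \<Rightarrow> 'a \<Rightarrow> real" where
  "poly_fun P x = mpoly_eval P (\<lambda>b. x \<bullet> b)"

definition poly_hypersurface :: "(('a::euclidean_space \<Rightarrow>\<^sub>0 nat) \<Rightarrow>\<^sub>0 real) \<Rightarrow> 'a set" where
  "poly_hypersurface P =
     {x. poly_fun P x = 0 \<and> frechet_derivative (poly_fun P) (at x) \<noteq> (\<lambda>_. 0)}"

text \<open>
  Polynomial functions on the space \<^const>\<open>real_polys\<close> are the polynomials in the coefficients,
  i.e. their variables are the exponents \<open>\<alpha>\<close>, evaluated at the coefficient of \<open>\<alpha>\<close>.
\<close>

definition zariski_closed_in_polys ::
    "nat \<Rightarrow> (('a::euclidean_space \<Rightarrow>\<^sub>0 nat) \<Rightarrow>\<^sub>0 real) set \<Rightarrow> bool" where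
  "zariski_closed_in_polys k Z \<longleftrightarrow>
     (\<exists>S. Z = {P \<in> real_polys k. \<forall>Q\<in>S. mpoly_eval Q (Poly_Mapping.lookup P) = 0})"

definition zariski_generic_hypersurface :: "nat \<Rightarrow> ('a::euclidean_space set \<Rightarrow> bool) \<Rightarrow> bool" where
  "zariski_generic_hypersurface k \<Phi> \<longleftrightarrow>
     (\<exists>Z. zariski_closed_in_polys k Z \<and> Z \<noteq> real_polys k \<and>
          (\<forall>P \<in> real_polys k - Z. \<Phi> (poly_hypersurface P)))"

definition real_analytic_fun_on :: "('a::euclidean_space \<Rightarrow> real) \<Rightarrow> 'a set \<Rightarrow> bool" where
  "real_analytic_fun_on f U \<longleftrightarrow> open U \<and>
     (\<forall>p\<in>U. \<exists>r>0. \<exists>c. \<forall>x\<in>ball p r.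
        ((\<lambda>\<alpha>. c \<alpha> * monomial_eval \<alpha> (\<lambda>b. (x - p) \<bullet> b)) has_sum f x)
          {\<alpha>. Poly_Mapping.keys \<alpha> \<subseteq> Basis})"

definition local_defining_function ::
    "'a::euclidean_space set \<Rightarrow> 'a set \<Rightarrow> ('a \<Rightarrow> real) \<Rightarrow> bool" where
  "local_defining_function M U \<rho> \<longleftrightarrow>
     real_analytic_fun_on \<rho> U \<and>
     (\<forall>z\<in>U. frechet_derivative \<rho> (at z) \<noteq> (\<lambda>_. 0)) \<and>
     M \<inter> U = {z\<in>U. \<rho> z = 0}"

definition real_analytic_hypersurface :: "'a::euclidean_space set \<Rightarrow> bool" where
  "real_analytic_hypersurface M \<longleftrightarrow>
     (\<forall>p\<in>M. \<exists>U \<rho>. p \<in> U \<and> local_defining_function M U \<rho>)"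

definition dz :: "'k::finite \<Rightarrow> (complex ^ 'k \<Rightarrow> complex) \<Rightarrow> complex ^ 'k \<Rightarrow> complex" where
  "dz j f p = (frechet_derivative f (at p) (axis j 1)
                - \<i> * frechet_derivative f (at p) (axis j \<i>)) / 2"

definition dzbar :: "'k::finite \<Rightarrow> (complex ^ 'k \<Rightarrow> complex) \<Rightarrow> complex ^ 'k \<Rightarrow> complex" where
  "dzbar j f p = (frechet_derivative f (at p) (axis j 1)
                   + \<i> * frechet_derivative f (at p) (axis j \<i>)) / 2"

definition levi_form ::
    "(complex ^ 'k::finite \<Rightarrow> real) \<Rightarrow> complex ^ 'k \<Rightarrow> complex ^ 'k \<Rightarrow> complex ^ 'k \<Rightarrow> complex" where
  "levi_form \<rho> p v w =
     (\<Sum>i\<in>UNIV. \<Sum>j\<in>UNIV. dz i (dzbar j (\<lambda>z. of_real (\<rho> z))) p * v $ i * cnj (w $ j))"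

definition complex_tangent_space ::
    "(complex ^ 'k::finite \<Rightarrow> real) \<Rightarrow> complex ^ 'k \<Rightarrow> (complex ^ 'k) set" where
  "complex_tangent_space \<rho> p = {v. (\<Sum>j\<in>UNIV. dz j (\<lambda>z. of_real (\<rho> z)) p * v $ j) = 0}"

text \<open>
  Nondegeneracy of the Levi form does not depend on the choice of the local defining function,
  so it does not matter whether one or all of them are required to satisfy it.
\<close>

definition levi_nondegenerate :: "(complex ^ 'k::finite) set \<Rightarrow> bool" where
  "levi_nondegenerate M \<longleftrightarrow>
     (\<forall>p\<in>M. \<exists>U \<rho>. p \<in> U \<and> local_defining_function M U \<rho> \<and>
        (\<forall>v\<in>complex_tangent_space \<rho> p.
           (\<forall>w\<in>complex_tangent_space \<rho> p. levi_form \<rho> p v w = 0) \<longrightarrow> v = 0))"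

text \<open>
  \<open>S\<close> is the set of indices carrying a negative sign in the equation
  \<open>Im W = - (\<Sum>j\<in>S. |Z\<^sub>j|\<^sup>2) + (\<Sum>j\<notin>S. |Z\<^sub>j|\<^sup>2)\<close>, so the number of negative signs is
  \<open>card S\<close>. The index type is not ordered, so they are not required to come first.
\<close>

definition hyperquadric_fun :: "'m::finite set \<Rightarrow> 'm cspace \<Rightarrow> real" where
  "hyperquadric_fun S q =
     Im (q $ None) - (- (\<Sum>j\<in>S. (cmod (q $ Some j))\<^sup>2) + (\<Sum>j\<in>-S. (cmod (q $ Some j))\<^sup>2))"

definition hyperquadric :: "'m::finite set \<Rightarrow> 'm cspace set" where
  "hyperquadric S = {q. hyperquadric_fun S q = 0}"

definition hyperquadric_tangent_space :: "'m::finite set \<Rightarrow> 'm cspace \<Rightarrow> 'm cspace set" where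
  "hyperquadric_tangent_space S q = {v. frechet_derivative (hyperquadric_fun S) (at q) v = 0}"

definition holomorphic_map_on ::
    "(complex ^ 'a::finite \<Rightarrow> complex ^ 'b::finite) \<Rightarrow> (complex ^ 'a) set \<Rightarrow> bool" where
  "holomorphic_map_on F U \<longleftrightarrow> open U \<and>
     (\<forall>z\<in>U. \<exists>D. (F has_derivative D) (at z) \<and> Vector_Spaces.linear (*s) (*s) D)"

definition holomorphic_embedding_on ::
    "(complex ^ 'a::finite \<Rightarrow> complex ^ 'b::finite) \<Rightarrow> (complex ^ 'a) set \<Rightarrow> bool" where
  "holomorphic_embedding_on F U \<longleftrightarrow>
     holomorphic_map_on F U \<and>
     (\<forall>z\<in>U. inj (frechet_derivative F (at z))) \<and>
     embedding_map (top_of_set U) euclidean F"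

definition transversal_embedding ::
    "'m::finite set \<Rightarrow> 'n::finite cspace set \<Rightarrow> 'n cspace \<Rightarrow> 'n cspace set \<Rightarrow>
     ('n cspace \<Rightarrow> 'm cspace) \<Rightarrow> bool" where
  "transversal_embedding S M p U F \<longleftrightarrow>
     p \<in> M \<and> p \<in> U \<and> open U \<and> connected U \<and>
     holomorphic_embedding_on F U \<and>
     F ` (M \<inter> U) \<subseteq> hyperquadric S \<and>
     {a + b | a b. a \<in> hyperquadric_tangent_space S (F p) \<and>
                   b \<in> range (frechet_derivative F (at p))} = UNIV"

text \<open>
  The first argument fixes the dimension \<open>m = CARD('m)\<close>; the signature of the hyperquadric is
  arbitrary.
\<close>

definition transversally_embeddable :: "'m::finite itself \<Rightarrow> 'n::finite cspace set \<Rightarrow> bool" where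
  "transversally_embeddable _ M \<longleftrightarrow>
     (\<exists>(S :: 'm set) p U F. transversal_embedding S M p U F)"

definition in_proper_affine_subspace :: "(complex ^ 'k::finite) set \<Rightarrow> bool" where
  "in_proper_affine_subspace X \<longleftrightarrow>
     (\<exists>a V. vec.subspace V \<and> V \<noteq> UNIV \<and> X \<subseteq> (\<lambda>v. a + v) ` V)"

definition M_tilde :: "'m::finite itself \<Rightarrow> 'n::finite cspace set set" where
  "M_tilde _ =
     {M. real_analytic_hypersurface M \<and> levi_nondegenerate M \<and>
         (\<exists>(S :: 'm set) p U F. transversal_embedding S M p U F \<and>
                                \<not> in_proper_affine_subspace (F ` U))}"

definition not_contained_in ::
    "(complex ^ 'k::finite) set \<Rightarrow> (complex ^ 'k) set set \<Rightarrow> bool" where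
  "not_contained_in M \<C> \<longleftrightarrow>
     \<not> (\<exists>M'. openin (top_of_set M) M' \<and> levi_nondegenerate M' \<and> M' \<in> \<C>)"

definition p_bound :: "nat \<Rightarrow> nat \<Rightarrow> nat" where
  "p_bound m n = n + (n * (n + 1) div 2) * (m choose n)"

definition \<nu> :: "nat \<Rightarrow> nat \<Rightarrow> nat" where
  "\<nu> n m = 2 + (m - n) + (((m + 1) * (m + 2) div 2 + p_bound m n) choose p_bound m n)"

definition \<mu> :: "nat \<Rightarrow> nat \<Rightarrow> nat" where
  "\<mu> n N = \<nu> n N"

end

theory Submission
  imports Defs "HOL-Complex_Analysis.Cauchy_Integral_Formula"
begin

text \<open>
  The proof is a dimension count on \<open>k\<close>-jets. If \<open>F\<close> maps \<open>{P = 0}\<close> near \<open>p\<close> transversally into the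
  hyperquadric with defining function \<open>Q\<close>, then \<open>Q \<circ> F\<close> vanishes on \<open>{P = 0}\<close> and has nonzero
  differential at \<open>p\<close>, so \<open>P\<close> is a multiple of \<open>Q \<circ> F\<close> near \<open>p\<close>. As \<open>Q (F p) = 0\<close> and \<open>P\<close> has degree at
  most \<open>k\<close>, the polynomial \<open>P\<close> is determined by \<open>p\<close>, by the \<open>(k - 1)\<close>-jet of the factor and by the
  holomorphic \<open>k\<close>-jet of \<open>F\<close> at \<open>p\<close>, and its coefficients are polynomials in these data. With
  \<open>r = 2n + 2\<close> real variables, the factor has \<open>(r + k - 1) choose (k - 1)\<close> coefficients, while \<open>P\<close> has
  \<open>(r + k) choose k\<close>. The difference \<open>(r + k - 1) choose k\<close> exceeds
  \<open>2 (m + 1) ((n + 1 + k) choose k) + r + m\<close>, which accounts for the jet of \<open>F\<close>, the point and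
  the signs of the hyperquadric, because its degree in \<open>k\<close> is \<open>2n + 1 > n + 1\<close>; the bound
  \<open>\<nu> n m\<close> is large enough. So the coefficients of the polynomials \<open>P\<close> in question satisfy a nontrivial
  polynomial relation.
\<close>

section \<open>Polynomial maps from a space of smaller dimension\<close>

text \<open>That \<open>P\<close> is a multiple of \<open>Q\<close> composed with \<open>F\<close>
  is needed only modulo order \<open>k + 1\<close>, and there it is obtained without an analytic
  division theorem. \<open>Q\<close> composed with the Taylor polynomials of \<open>F\<close> is a
  polynomial \<rho>. Eliminating one variable by means of \<rho>, monomial by monomial, splits
  \<open>P\<close> into a multiple of \<rho> and a remainder free of that variable. The remainder is
  small on the zeros of \<open>P\<close>, and these lie over all small points of a hyperplane, so it
  is negligible everywhere. Dropping the top degree of the factor is the decisive saving: by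
  Pascal's rule it frees enough coefficients of \<open>P\<close> to outweigh the jet of
  \<open>F\<close>, which is cheap because \<open>F\<close> is holomorphic in \<open>n + 1\<close>
  complex variables, against \<open>2n + 2\<close> real ones for \<open>P\<close>. Dimension theory
  is replaced by a pigeonhole argument: for large degree there are more monomials in the
  coefficients of \<open>P\<close> than in the jet coordinates on which these depend.\<close>

lemma monomial_eval_superset:
  assumes "finite V" "Poly_Mapping.keys \<alpha> \<subseteq> V"
  shows "monomial_eval \<alpha> x = (\<Prod>v\<in>V. x v ^ Poly_Mapping.lookup \<alpha> v)"
  unfolding monomial_eval_def
  by (rule prod.mono_neutral_left) (use assms in \<open>auto simp: in_keys_iff\<close>)

lemma monomial_degree_superset:
  assumes "finite V" "Poly_Mapping.keys \<alpha> \<subseteq> V"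
  shows "monomial_degree \<alpha> = (\<Sum>v\<in>V. Poly_Mapping.lookup \<alpha> v)"
  unfolding monomial_degree_def
  by (rule sum.mono_neutral_left) (use assms in \<open>auto simp: in_keys_iff\<close>)

lemma mpoly_eval_superset:
  assumes "finite T" "Poly_Mapping.keys P \<subseteq> T"
  shows "mpoly_eval P x = (\<Sum>\<alpha>\<in>T. Poly_Mapping.lookup P \<alpha> * monomial_eval \<alpha> x)"
  unfolding mpoly_eval_def
  by (rule sum.mono_neutral_left) (use assms in \<open>auto simp: in_keys_iff\<close>)

lemma lookup_Abs_finite:
  fixes c :: "'v \<Rightarrow> 'c::zero"
  assumes "finite A"
  shows "Poly_Mapping.lookup (Abs_poly_mapping (\<lambda>v. if v \<in> A then c v else 0)) = (\<lambda>v. if v \<in> A then c v else 0)"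
proof -
  have "finite {v. (if v \<in> A then c v else 0) \<noteq> 0}"
    by (rule finite_subset[OF _ assms]) auto
  then show ?thesis by (rule lookup_Abs_poly_mapping)
qed

text \<open>Gaussian elimination: an unknown with a nonzero entry in equation \<open>j\<close> is
  solved for and substituted into the other equations.\<close>

lemma exists_nontrivial_solution:
  fixes a :: "'i \<Rightarrow> 'j \<Rightarrow> real"
  assumes "finite J" "finite I" "card J < card I"
  shows "\<exists>c. (\<exists>i\<in>I. c i \<noteq> 0) \<and> (\<forall>j\<in>J. (\<Sum>i\<in>I. c i * a i j) = 0)"
  using assms
proof (induction J arbitrary: I a rule: finite_induct)
  case empty
  then have "I \<noteq> {}" by auto
  then show ?case by (intro exI[of _ "\<lambda>_. 1"]) auto
next
  case (insert j J)
  have lt: "card J < card I" using insert by auto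
  show ?case
  proof (cases "\<forall>i\<in>I. a i j = 0")
    case True
    obtain c where "\<exists>i\<in>I. c i \<noteq> 0" "\<forall>j\<in>J. (\<Sum>i\<in>I. c i * a i j) = 0"
      using insert.IH[OF insert.prems(1) lt] by blast
    with True show ?thesis by (intro exI[of _ c]) auto
  next
    case False
    then obtain i0 where i0: "i0 \<in> I" "a i0 j \<noteq> 0" by auto
    let ?I = "I - {i0}" and ?b = "\<lambda>i k. a i k - a i j / a i0 j * a i0 k"
    have "card J < card ?I" using insert i0 by auto
    then obtain c where c: "\<exists>i\<in>?I. c i \<noteq> 0" "\<forall>k\<in>J. (\<Sum>i\<in>?I. c i * ?b i k) = 0"
      using insert.IH[of ?I ?b] insert.prems by auto
    \<comment> \<open>Equation \<open>j\<close> forces the value \<open>- s\<close> on the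
      eliminated unknown \<open>i0\<close>.\<close>
    define s where "s = (\<Sum>i\<in>?I. c i * a i j / a i0 j)"
    define c' where "c' = c(i0 := - s)"
    have split: "(\<Sum>i\<in>I. c' i * a i k) = - s * a i0 k + (\<Sum>i\<in>?I. c i * a i k)" for k
      by (subst sum.remove[OF insert.prems(1) i0(1)])
        (auto simp: c'_def intro!: sum.cong)
    have "(\<Sum>i\<in>I. c' i * a i k) = 0" if "k \<in> insert j J" for k
    proof (cases "k = j")
      case True
      then show ?thesis using i0 unfolding split s_def
        by (simp add: sum_distrib_right sum_negf[symmetric] sum.distrib[symmetric])
    next
      case False
      then have "(\<Sum>i\<in>?I. c i * ?b i k) = 0" using c that by auto
      moreover have "(\<Sum>i\<in>?I. c i * ?b i k) = (\<Sum>i\<in>?I. c i * a i k) - s * a i0 k"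
        unfolding s_def sum_distrib_right sum_subtractf[symmetric]
        by (rule sum.cong) (auto simp: algebra_simps)
      ultimately show ?thesis unfolding split by simp
    qed
    moreover have "\<exists>i\<in>I. c' i \<noteq> 0" using c unfolding c'_def by auto
    ultimately show ?thesis by blast
  qed
qed

section \<open>Polynomials of bounded degree in each variable\<close>

abbreviation box_exps :: "'v set \<Rightarrow> nat \<Rightarrow> ('v \<Rightarrow> nat) set" where
  "box_exps V d \<equiv> PiE V (\<lambda>_. {..d})"

text \<open>In the variable \<open>v\<close> that is added last, the sum is a polynomial whose
  coefficients are polynomials in the other variables. A real polynomial in one variable that
  vanishes everywhere has zero coefficients, so the induction hypothesis applies to each of
  them.\<close>

lemma box_monomials_independent:
  fixes c :: "('v \<Rightarrow> nat) \<Rightarrow> real"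
  assumes "finite V" "\<And>x. (\<Sum>f\<in>box_exps V d. c f * (\<Prod>v\<in>V. x v ^ f v)) = 0"
    and "f \<in> box_exps V d"
  shows "c f = 0"
  using assms
proof (induction V arbitrary: c f rule: finite_induct)
  case empty
  then show ?case by auto
next
  case (insert v V)
  have key: "(\<Sum>g\<in>box_exps V d. c (g(v := y)) * (\<Prod>u\<in>V. x u ^ g u)) = 0" if "y \<le> d" for x y
  proof -
    have "(\<Sum>y\<le>d. (\<Sum>g\<in>box_exps V d. c (g(v := y)) * (\<Prod>u\<in>V. x u ^ g u)) * s ^ y) = 0" for s
    proof -
      have "0 = (\<Sum>f\<in>box_exps (insert v V) d. c f * (\<Prod>u\<in>insert v V. (x(v:=s)) u ^ f u))"
        using insert.prems(1)[of "x(v:=s)"] by simp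
      also have "\<dots> = (\<Sum>(y,g)\<in>{..d} \<times> box_exps V d. c (g(v:=y)) * (\<Prod>u\<in>insert v V. (x(v:=s)) u ^ (g(v:=y)) u))"
        unfolding PiE_insert_eq
        by (subst sum.reindex[OF inj_combinator[OF insert.hyps(2)]]) (simp add: case_prod_unfold)
      also have "\<dots> = (\<Sum>y\<le>d. \<Sum>g\<in>box_exps V d. c (g(v:=y)) * (\<Prod>u\<in>insert v V. (x(v:=s)) u ^ (g(v:=y)) u))"
        by (simp add: sum.cartesian_product)
      also have "\<dots> = (\<Sum>y\<le>d. (\<Sum>g\<in>box_exps V d. c (g(v := y)) * (\<Prod>u\<in>V. x u ^ g u)) * s ^ y)"
      proof -
        have "(\<Prod>u\<in>V. (x(v:=s)) u ^ (g(v:=y)) u) = (\<Prod>u\<in>V. x u ^ g u)" for y g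
          by (rule prod.cong) (use insert.hyps in auto)
        then have "(\<Prod>u\<in>insert v V. (x(v:=s)) u ^ (g(v:=y)) u) = s ^ y * (\<Prod>u\<in>V. x u ^ g u)" for y g
          by (subst prod.insert) (use insert.hyps in auto)
        then show ?thesis by (simp only: sum_distrib_right) (simp only: mult_ac)
      qed
      finally show ?thesis by simp
    qed
    then show ?thesis using that polyfun_eq_0[of "\<lambda>y. \<Sum>g\<in>box_exps V d. c (g(v := y)) * (\<Prod>u\<in>V. x u ^ g u)" d]
      by blast
  qed
  obtain y g where yg: "y \<le> d" "g \<in> box_exps V d" "f = g(v := y)"
    using insert.prems(2) unfolding PiE_insert_eq by auto
  show ?case unfolding yg(3)
    by (rule insert.IH[of "\<lambda>g. c (g(v:=y))", OF key[OF yg(1)] yg(2)])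
qed

text \<open>Closure under the ring operations is built in, which makes membership of explicit
  expressions routine; monomials are extracted only afterwards, through
  \<open>boxed\<close>.\<close>

inductive polyfn :: "'b set \<Rightarrow> (('b \<Rightarrow> real) \<Rightarrow> real) \<Rightarrow> bool" for B where
  const: "polyfn B (\<lambda>_. c)"
| var: "b \<in> B \<Longrightarrow> polyfn B (\<lambda>t. t b)"
| add: "polyfn B \<phi> \<Longrightarrow> polyfn B \<psi> \<Longrightarrow> polyfn B (\<lambda>t. \<phi> t + \<psi> t)"
| mult: "polyfn B \<phi> \<Longrightarrow> polyfn B \<psi> \<Longrightarrow> polyfn B (\<lambda>t. \<phi> t * \<psi> t)"

lemma polyfn_sum: "(\<And>i. i \<in> I \<Longrightarrow> polyfn B (\<phi> i)) \<Longrightarrow> polyfn B (\<lambda>t. \<Sum>i\<in>I. \<phi> i t)"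
  by (induction I rule: infinite_finite_induct) (auto intro: polyfn.intros)

text \<open>
  Bounding the degree in each variable separately makes the number of monomials a plain power.
\<close>

definition boxed :: "'b set \<Rightarrow> nat \<Rightarrow> (('b \<Rightarrow> real) \<Rightarrow> real) \<Rightarrow> bool" where
  "boxed B d \<phi> \<longleftrightarrow> (\<exists>c. \<forall>t. \<phi> t = (\<Sum>f\<in>box_exps B d. c f * (\<Prod>b\<in>B. t b ^ f b)))"

text \<open>Like terms are collected. The exponents \<open>h i\<close> may repeat and are arbitrary
  outside \<open>B\<close>, whereas \<open>box_exps\<close> contains extensional functions only;
  hence \<open>restrict\<close>.\<close>

lemma boxedI:
  assumes "finite B" "finite I" "\<And>i b. i \<in> I \<Longrightarrow> b \<in> B \<Longrightarrow> h i b \<le> d"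
    and "\<And>t. \<phi> t = (\<Sum>i\<in>I. a i * (\<Prod>b\<in>B. t b ^ h i b))"
  shows "boxed B d \<phi>"
proof -
  let ?h = "\<lambda>i. restrict (h i) B"
  have "\<phi> t = (\<Sum>f\<in>box_exps B d. (\<Sum>i\<in>{i\<in>I. ?h i = f}. a i) * (\<Prod>b\<in>B. t b ^ f b))" for t
  proof -
    have "\<phi> t = (\<Sum>i\<in>I. a i * (\<Prod>b\<in>B. t b ^ ?h i b))" by (simp add: assms(4))
    also have "\<dots> = (\<Sum>f\<in>box_exps B d. \<Sum>i\<in>{i\<in>I. ?h i = f}. a i * (\<Prod>b\<in>B. t b ^ ?h i b))"
      by (rule sum.group[symmetric]) (use assms in \<open>auto intro!: finite_PiE\<close>)
    also have "\<dots> = (\<Sum>f\<in>box_exps B d. (\<Sum>i\<in>{i\<in>I. ?h i = f}. a i) * (\<Prod>b\<in>B. t b ^ f b))"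
      by (auto simp: sum_distrib_right intro!: sum.cong)
    finally show ?thesis .
  qed
  then show ?thesis unfolding boxed_def
    by (intro exI[of _ "\<lambda>f. \<Sum>i\<in>{i\<in>I. ?h i = f}. a i"]) simp
qed

lemma boxed_mono:
  assumes "finite B" "boxed B d \<phi>" "d \<le> e" shows "boxed B e \<phi>"
proof -
  obtain c where c: "\<And>t. \<phi> t = (\<Sum>f\<in>box_exps B d. c f * (\<Prod>b\<in>B. t b ^ f b))"
    using assms(2) unfolding boxed_def by blast
  show ?thesis
    by (rule boxedI[OF assms(1) _ _ c]) (use assms in \<open>auto intro!: finite_PiE dest: PiE_mem\<close>)
qed

lemma boxed_add:
  assumes "boxed B d \<phi>" "boxed B d \<psi>" shows "boxed B d (\<lambda>t. \<phi> t + \<psi> t)"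
proof -
  obtain c c' where "\<And>t. \<phi> t = (\<Sum>f\<in>box_exps B d. c f * (\<Prod>b\<in>B. t b ^ f b))"
    "\<And>t. \<psi> t = (\<Sum>f\<in>box_exps B d. c' f * (\<Prod>b\<in>B. t b ^ f b))"
    using assms unfolding boxed_def by blast
  then show ?thesis unfolding boxed_def
    by (intro exI[of _ "\<lambda>f. c f + c' f"]) (simp add: distrib_right sum.distrib)
qed

lemma boxed_mult:
  assumes "finite B" "boxed B d \<phi>" "boxed B e \<psi>" shows "boxed B (d + e) (\<lambda>t. \<phi> t * \<psi> t)"
proof -
  obtain c c' where c: "\<And>t. \<phi> t = (\<Sum>f\<in>box_exps B d. c f * (\<Prod>b\<in>B. t b ^ f b))"
    "\<And>t. \<psi> t = (\<Sum>f\<in>box_exps B e. c' f * (\<Prod>b\<in>B. t b ^ f b))"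
    using assms unfolding boxed_def by blast
  show ?thesis
  proof (rule boxedI[where I = "box_exps B d \<times> box_exps B e" and a = "\<lambda>(f,g). c f * c' g"
        and h = "\<lambda>(f,g) b. f b + g b"])
    show "finite (box_exps B d \<times> box_exps B e)" using assms by (auto intro!: finite_PiE)
    show "(case i of (f, g) \<Rightarrow> \<lambda>b. f b + g b) b \<le> d + e"
      if "i \<in> box_exps B d \<times> box_exps B e" "b \<in> B" for i b
      using that by (auto intro!: add_mono dest: PiE_mem)
    show "\<phi> t * \<psi> t = (\<Sum>i\<in>box_exps B d \<times> box_exps B e. (case i of (f, g) \<Rightarrow> c f * c' g) *
         (\<Prod>b\<in>B. t b ^ (case i of (f, g) \<Rightarrow> \<lambda>b. f b + g b) b))" for t
      unfolding c sum_product sum.cartesian_product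
      by (auto intro!: sum.cong simp: power_add prod.distrib mult_ac)
  qed (rule assms)
qed

lemma boxed_const: "finite B \<Longrightarrow> boxed B d (\<lambda>_. c)"
  by (rule boxedI[where I = "{()}" and h = "\<lambda>_ _. 0" and a = "\<lambda>_. c"]) auto

lemma boxed_power:
  assumes "finite B" "boxed B d \<phi>" shows "boxed B (n * d) (\<lambda>t. \<phi> t ^ n)"
  by (induction n) (use assms boxed_mult boxed_const in force)+

lemma boxed_prod:
  assumes "finite B" "finite I" "\<And>i. i \<in> I \<Longrightarrow> boxed B (d i) (\<phi> i)"
  shows "boxed B (\<Sum>i\<in>I. d i) (\<lambda>t. \<Prod>i\<in>I. \<phi> i t)"
  using assms(2,3) by (induction I rule: finite_induct) (use assms(1) boxed_mult boxed_const in force)+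

lemma polyfn_boxed:
  assumes "finite B" "polyfn B \<phi>" shows "\<exists>d. boxed B d \<phi>"
  using assms(2)
proof induction
  case (const c)
  then show ?case using boxed_const assms by blast
next
  case (var b)
  have "boxed B 1 (\<lambda>t. t b)"
  proof (rule boxedI[where I = "{()}" and h = "\<lambda>_ v. if v = b then 1 else 0" and a = "\<lambda>_. 1"])
    show "t b = (\<Sum>i\<in>{()}. 1 * (\<Prod>v\<in>B. t v ^ (if v = b then 1 else 0)))" for t :: "'a \<Rightarrow> real"
    proof -
      have "(\<Prod>v\<in>B. t v ^ (if v = b then 1 else 0)) = (\<Prod>v\<in>B. if v = b then t v else 1)"
        by (rule prod.cong) auto
      then show ?thesis using var assms by (simp add: prod.delta)
    qed
  qed (use assms in auto)
  then show ?case by blast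
next
  case (add \<phi> \<psi>)
  then obtain d e where "boxed B d \<phi>" "boxed B e \<psi>" by blast
  then have "boxed B (max d e) \<phi>" "boxed B (max d e) \<psi>" by (auto intro: boxed_mono assms(1))
  then show ?case using boxed_add by blast
next
  case (mult \<phi> \<psi>)
  then show ?case using boxed_mult assms by blast
qed

text \<open>Pigeonhole: substituting \<open>\<Phi>\<close> sends \<open>(d + 1) ^ card A\<close>
  monomials into a space spanned by \<open>(D + 1) ^ card B\<close> monomials, where
  \<open>D\<close> grows only linearly in \<open>d\<close>. For large \<open>d\<close> their images
  cannot all be independent.\<close>

lemma algebraically_dependent:
  fixes \<Phi> :: "'a \<Rightarrow> ('b \<Rightarrow> real) \<Rightarrow> real"
  assumes fin: "finite A" "finite B" and card: "card B < card A"
    and \<Phi>: "\<And>\<alpha>. \<alpha> \<in> A \<Longrightarrow> polyfn B (\<Phi> \<alpha>)"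
  shows "\<exists>d c. (\<exists>f\<in>box_exps A d. c f \<noteq> (0::real)) \<and>
    (\<forall>t. (\<Sum>f\<in>box_exps A d. c f * (\<Prod>\<alpha>\<in>A. \<Phi> \<alpha> t ^ f \<alpha>)) = 0)"
proof -
  have "\<forall>\<alpha>\<in>A. \<exists>d. boxed B d (\<Phi> \<alpha>)" using \<Phi> polyfn_boxed[OF fin(2)] by blast
  then obtain e' where e': "\<And>\<alpha>. \<alpha> \<in> A \<Longrightarrow> boxed B (e' \<alpha>) (\<Phi> \<alpha>)" by metis
  define e where "e = (\<Sum>\<alpha>\<in>A. e' \<alpha>)"
  have e: "boxed B e (\<Phi> \<alpha>)" if "\<alpha> \<in> A" for \<alpha>
    by (rule boxed_mono[OF fin(2) e'[OF that]]) (simp add: e_def fin member_le_sum that)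
  define K where "K = card A * e + 1"
  \<comment> \<open>\<open>D + 1\<close> is at most \<open>K * (d + 1)\<close>, so the target has
    dimension at most \<open>K ^ card B * (d + 1) ^ card B\<close>. Making the first factor equal to
    \<open>d\<close> keeps it below the extra factor \<open>d + 1\<close> available on the other
    side.\<close>
  define d where "d = K ^ card B"
  define D where "D = card A * (d * e)"
  have "boxed B D (\<lambda>t. \<Prod>\<alpha>\<in>A. \<Phi> \<alpha> t ^ f \<alpha>)" if "f \<in> box_exps A d" for f
  proof -
    have "boxed B (\<Sum>\<alpha>\<in>A. f \<alpha> * e) (\<lambda>t. \<Prod>\<alpha>\<in>A. \<Phi> \<alpha> t ^ f \<alpha>)"
      by (intro boxed_prod boxed_power fin e)
    moreover have "(\<Sum>\<alpha>\<in>A. f \<alpha> * e) \<le> D"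
      using sum_mono[of A "\<lambda>\<alpha>. f \<alpha> * e" "\<lambda>_. d * e"] PiE_mem[OF that] by (simp add: D_def)
    ultimately show ?thesis using boxed_mono fin by blast
  qed
  then have "\<forall>f\<in>box_exps A d. \<exists>a. \<forall>t.
      (\<Prod>\<alpha>\<in>A. \<Phi> \<alpha> t ^ f \<alpha>) = (\<Sum>g\<in>box_exps B D. a g * (\<Prod>b\<in>B. t b ^ g b))"
    unfolding boxed_def by blast
  from bchoice[OF this] obtain a where a: "\<And>f t. f \<in> box_exps A d \<Longrightarrow>
      (\<Prod>\<alpha>\<in>A. \<Phi> \<alpha> t ^ f \<alpha>) = (\<Sum>g\<in>box_exps B D. a f g * (\<Prod>b\<in>B. t b ^ g b))"
    by blast
  have "card (box_exps B D) = (D + 1) ^ card B" using fin by (simp add: card_PiE)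
  also have "\<dots> \<le> (K * (d + 1)) ^ card B"
    by (rule power_mono) (auto simp: D_def K_def algebra_simps)
  also have "\<dots> = d * (d + 1) ^ card B" by (simp only: power_mult_distrib d_def[symmetric])
  also have "\<dots> < (d + 1) ^ Suc (card B)" by simp
  also have "\<dots> \<le> (d + 1) ^ card A" by (rule power_increasing) (use card in auto)
  also have "\<dots> = card (box_exps A d)" using fin by (simp add: card_PiE)
  finally obtain c where c: "\<exists>f\<in>box_exps A d. c f \<noteq> 0"
    "\<forall>g\<in>box_exps B D. (\<Sum>f\<in>box_exps A d. c f * a f g) = 0"
    using exists_nontrivial_solution[of "box_exps B D" "box_exps A d" a] fin
    by (auto simp: finite_PiE)
  have "(\<Sum>f\<in>box_exps A d. c f * (\<Prod>\<alpha>\<in>A. \<Phi> \<alpha> t ^ f \<alpha>)) = 0" for t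
  proof -
    have "(\<Sum>f\<in>box_exps A d. c f * (\<Prod>\<alpha>\<in>A. \<Phi> \<alpha> t ^ f \<alpha>))
        = (\<Sum>f\<in>box_exps A d. \<Sum>g\<in>box_exps B D. c f * a f g * (\<Prod>b\<in>B. t b ^ g b))"
      by (simp add: a sum_distrib_left mult_ac)
    also have "\<dots> = (\<Sum>g\<in>box_exps B D. (\<Sum>f\<in>box_exps A d. c f * a f g) * (\<Prod>b\<in>B. t b ^ g b))"
      by (subst sum.swap) (simp add: sum_distrib_right)
    also have "\<dots> = 0" using c by simp
    finally show ?thesis .
  qed
  with c(1) show ?thesis by blast
qed

text \<open>The relation becomes a polynomial \<open>Q\<close> with variables in \<open>A\<close>,
  in the shape that \<open>zariski_closed_in_polys\<close> asks for, so only the values of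
  \<open>x\<close> on \<open>A\<close> matter. The point \<open>y\<close>, where \<open>Q\<close> is
  nonzero, later supplies a polynomial outside the exceptional set.\<close>

lemma polynomial_map_not_dominant:
  fixes \<Phi> :: "'a \<Rightarrow> ('b \<Rightarrow> real) \<Rightarrow> real"
  assumes fin: "finite A" "finite B" and card: "card B < card A"
    and \<Phi>: "\<And>\<alpha>. \<alpha> \<in> A \<Longrightarrow> polyfn B (\<Phi> \<alpha>)"
  obtains Q y where "\<And>t x. (\<And>\<alpha>. \<alpha> \<in> A \<Longrightarrow> x \<alpha> = \<Phi> \<alpha> t) \<Longrightarrow> mpoly_eval Q x = 0"
    "\<And>x. (\<And>\<alpha>. \<alpha> \<in> A \<Longrightarrow> x \<alpha> = y \<alpha>) \<Longrightarrow> mpoly_eval Q x \<noteq> 0"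
proof -
  obtain d c where c: "\<exists>f\<in>box_exps A d. c f \<noteq> (0::real)"
    "\<And>t. (\<Sum>f\<in>box_exps A d. c f * (\<Prod>\<alpha>\<in>A. \<Phi> \<alpha> t ^ f \<alpha>)) = 0"
    using algebraically_dependent[where \<Phi> = \<Phi>, OF fin card \<Phi>] by blast
  define pm where "pm f = Abs_poly_mapping (\<lambda>v. if v \<in> A then f v else 0)" for f :: "'a \<Rightarrow> nat"
  have lpm: "Poly_Mapping.lookup (pm f) = (\<lambda>v. if v \<in> A then f v else 0)" for f
    unfolding pm_def by (rule lookup_Abs_finite[OF fin(1)])
  let ?E = "box_exps A d"
  have finE: "finite ?E" by (rule finite_PiE) (use fin in auto)
  have res: "restrict (Poly_Mapping.lookup (pm f)) A = f" if "f \<in> ?E" for f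
    using that by (auto simp: lpm fun_eq_iff restrict_def PiE_def extensional_def)
  have inj: "inj_on pm ?E" by (rule inj_on_inverseI[of _ "\<lambda>m. restrict (Poly_Mapping.lookup m) A"]) (rule res)
  define Q where "Q = Abs_poly_mapping (\<lambda>m. if m \<in> pm ` ?E then c (restrict (Poly_Mapping.lookup m) A) else 0)"
  have lQ: "Poly_Mapping.lookup Q = (\<lambda>m. if m \<in> pm ` ?E then c (restrict (Poly_Mapping.lookup m) A) else 0)"
    unfolding Q_def by (rule lookup_Abs_finite) (use finE in auto)
  have kQ: "Poly_Mapping.keys Q \<subseteq> pm ` ?E" by (auto simp: in_keys_iff lQ split: if_splits)
  have ev: "mpoly_eval Q x = (\<Sum>f\<in>?E. c f * (\<Prod>\<alpha>\<in>A. x \<alpha> ^ f \<alpha>))" for x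
  proof -
    have "mpoly_eval Q x = (\<Sum>m\<in>pm ` ?E. Poly_Mapping.lookup Q m * monomial_eval m x)"
      by (rule mpoly_eval_superset) (use kQ finE in auto)
    also have "\<dots> = (\<Sum>f\<in>?E. Poly_Mapping.lookup Q (pm f) * monomial_eval (pm f) x)"
      by (simp add: sum.reindex[OF inj])
    also have "\<dots> = (\<Sum>f\<in>?E. c f * (\<Prod>\<alpha>\<in>A. x \<alpha> ^ f \<alpha>))"
    proof (rule sum.cong)
      fix f assume f: "f \<in> ?E"
      have "monomial_eval (pm f) x = (\<Prod>v\<in>A. x v ^ Poly_Mapping.lookup (pm f) v)"
        by (rule monomial_eval_superset) (use fin in \<open>auto simp: in_keys_iff lpm split: if_splits\<close>)
      also have "\<dots> = (\<Prod>\<alpha>\<in>A. x \<alpha> ^ f \<alpha>)" by (rule prod.cong) (auto simp: lpm)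
      finally show "Poly_Mapping.lookup Q (pm f) * monomial_eval (pm f) x = c f * (\<Prod>\<alpha>\<in>A. x \<alpha> ^ f \<alpha>)"
        using f res[OF f] unfolding lQ by auto
    qed simp
    finally show ?thesis .
  qed
  have "\<exists>y. (\<Sum>f\<in>?E. c f * (\<Prod>\<alpha>\<in>A. y \<alpha> ^ f \<alpha>)) \<noteq> 0"
    using box_monomials_independent[where c = c and d = d, OF fin(1)] c(1) by blast
  then obtain y where y: "(\<Sum>f\<in>?E. c f * (\<Prod>\<alpha>\<in>A. y \<alpha> ^ f \<alpha>)) \<noteq> 0" by blast
  show ?thesis
  proof (rule that)
    fix x t assume "\<And>\<alpha>. \<alpha> \<in> A \<Longrightarrow> x \<alpha> = \<Phi> \<alpha> t"
    then have "mpoly_eval Q x = (\<Sum>f\<in>?E. c f * (\<Prod>\<alpha>\<in>A. \<Phi> \<alpha> t ^ f \<alpha>))"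
      unfolding ev by (simp cong: prod.cong)
    then show "mpoly_eval Q x = 0" using c(2) by simp
  next
    fix x assume "\<And>\<alpha>. \<alpha> \<in> A \<Longrightarrow> x \<alpha> = y \<alpha>"
    then have "mpoly_eval Q x = (\<Sum>f\<in>?E. c f * (\<Prod>\<alpha>\<in>A. y \<alpha> ^ f \<alpha>))"
      unfolding ev by (simp cong: prod.cong)
    then show "mpoly_eval Q x \<noteq> 0" using y by simp
  qed
qed

section \<open>Exponents and orders of vanishing\<close>

text \<open>Total degree instead of a box: the dimension count needs the exact number of exponents,
  and this number is a binomial coefficient.\<close>

definition expo :: "'v set \<Rightarrow> nat \<Rightarrow> ('v \<Rightarrow>\<^sub>0 nat) set" where
  "expo V D = {\<alpha>. Poly_Mapping.keys \<alpha> \<subseteq> V \<and> monomial_degree \<alpha> \<le> D}"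

lemma real_polys_iff: "P \<in> real_polys k \<longleftrightarrow> Poly_Mapping.keys P \<subseteq> expo Basis k"
  by (auto simp: real_polys_def expo_def)

lemma keys_add_nat:
  "Poly_Mapping.keys (\<alpha> + \<beta> :: 'v \<Rightarrow>\<^sub>0 nat) = Poly_Mapping.keys \<alpha> \<union> Poly_Mapping.keys \<beta>"
  by (auto simp: in_keys_iff lookup_add)

lemma monomial_degree_add: "monomial_degree (\<alpha> + \<beta>) = monomial_degree \<alpha> + monomial_degree \<beta>"
proof -
  let ?V = "Poly_Mapping.keys \<alpha> \<union> Poly_Mapping.keys \<beta>"
  have "monomial_degree (\<alpha> + \<beta>) = (\<Sum>v\<in>?V. Poly_Mapping.lookup (\<alpha> + \<beta>) v)"
    by (rule monomial_degree_superset) (auto simp: keys_add_nat)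
  also have "\<dots> = (\<Sum>v\<in>?V. Poly_Mapping.lookup \<alpha> v) + (\<Sum>v\<in>?V. Poly_Mapping.lookup \<beta> v)"
    by (simp add: lookup_add sum.distrib)
  also have "\<dots> = monomial_degree \<alpha> + monomial_degree \<beta>"
    by (subst (1 2) monomial_degree_superset[of ?V]) auto
  finally show ?thesis .
qed

lemma monomial_eval_add: "monomial_eval (\<alpha> + \<beta>) x = monomial_eval \<alpha> x * monomial_eval \<beta> x"
proof -
  let ?V = "Poly_Mapping.keys \<alpha> \<union> Poly_Mapping.keys \<beta>"
  have "monomial_eval (\<alpha> + \<beta>) x = (\<Prod>v\<in>?V. x v ^ Poly_Mapping.lookup (\<alpha> + \<beta>) v)"
    by (rule monomial_eval_superset) (auto simp: keys_add_nat)
  also have "\<dots> = (\<Prod>v\<in>?V. x v ^ Poly_Mapping.lookup \<alpha> v) * (\<Prod>v\<in>?V. x v ^ Poly_Mapping.lookup \<beta> v)"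
    by (simp add: lookup_add power_add prod.distrib)
  also have "\<dots> = monomial_eval \<alpha> x * monomial_eval \<beta> x"
    by (subst (1 2) monomial_eval_superset[of ?V]) auto
  finally show ?thesis .
qed

lemma monomial_degree_single [simp]: "monomial_degree (Poly_Mapping.single v j) = j"
  by (simp add: monomial_degree_def)

lemma monomial_eval_single [simp]: "monomial_eval (Poly_Mapping.single v j) x = x v ^ j"
  by (simp add: monomial_eval_def)

lemma monomial_degree_0 [simp]: "monomial_degree 0 = 0"
  by (simp add: monomial_degree_def)

lemma monomial_eval_0 [simp]: "monomial_eval 0 x = 1"
  by (simp add: monomial_eval_def)

lemma add_in_expo: "\<alpha> \<in> expo V D \<Longrightarrow> \<beta> \<in> expo V E \<Longrightarrow> \<alpha> + \<beta> \<in> expo V (D + E)"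
  by (auto simp: expo_def keys_add_nat monomial_degree_add)

lemma zero_in_expo: "0 \<in> expo V D"
  by (simp add: expo_def)

lemma single_in_expo: "v \<in> V \<Longrightarrow> j \<le> D \<Longrightarrow> Poly_Mapping.single v j \<in> expo V D"
  by (auto simp: expo_def)

lemma expo_mono: "D \<le> E \<Longrightarrow> expo V D \<subseteq> expo V E"
  by (auto simp: expo_def)

lemma keys_minus_single:
  "Poly_Mapping.keys (\<alpha> - Poly_Mapping.single v (Poly_Mapping.lookup \<alpha> v) :: 'v \<Rightarrow>\<^sub>0 nat) = Poly_Mapping.keys \<alpha> - {v}"
  by (auto simp: in_keys_iff lookup_minus lookup_single when_def split: if_splits)

lemma minus_single_add:
  assumes "j \<le> Poly_Mapping.lookup \<alpha> v"
  shows "\<alpha> = (\<alpha> - Poly_Mapping.single v j) + Poly_Mapping.single v (j::nat)"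
  by (rule poly_mapping_eqI) (use assms in \<open>auto simp: lookup_add lookup_minus lookup_single when_def\<close>)

text \<open>Sorting by the exponent \<open>j\<close> of the new variable leaves exponents of degree
  at most \<open>D - j\<close> in the others; the binomial coefficients add up by the hockey-stick
  identity.\<close>

lemma finite_card_expo:
  assumes "finite V"
  shows "finite (expo V D) \<and> card (expo V D) = (card V + D) choose D"
  using assms
proof (induction V arbitrary: D rule: finite_induct)
  case empty
  have "expo {} D = {0 :: 'a \<Rightarrow>\<^sub>0 nat}" by (auto simp: expo_def)
  then show ?case by simp
next
  case (insert v V)
  let ?S = "\<lambda>j. (\<lambda>\<beta>. \<beta> + Poly_Mapping.single v j) ` expo V (D - j)"
  have *: "Poly_Mapping.lookup \<beta> v = 0" if "\<beta> \<in> expo V E" for \<beta> :: "'a \<Rightarrow>\<^sub>0 nat" and E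
    using that insert.hyps by (auto simp: expo_def in_keys_iff)
  have "expo (insert v V) D = (\<Union>j\<le>D. ?S j)"
  proof (intro equalityI subsetI)
    fix \<alpha> assume a: "\<alpha> \<in> expo (insert v V) D"
    let ?j = "Poly_Mapping.lookup \<alpha> v" and ?\<beta> = "\<alpha> - Poly_Mapping.single v (Poly_Mapping.lookup \<alpha> v)"
    have eq: "\<alpha> = ?\<beta> + Poly_Mapping.single v ?j" by (rule minus_single_add) simp
    have "monomial_degree \<alpha> = monomial_degree ?\<beta> + ?j"
      using monomial_degree_add[of ?\<beta> "Poly_Mapping.single v ?j"] eq by simp
    then have "?j \<le> D" "?\<beta> \<in> expo V (D - ?j)"
      using a by (auto simp: expo_def keys_minus_single)
    with eq show "\<alpha> \<in> (\<Union>j\<le>D. ?S j)" by blast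
  next
    fix \<alpha> assume "\<alpha> \<in> (\<Union>j\<le>D. ?S j)"
    then show "\<alpha> \<in> expo (insert v V) D"
      by (auto simp: expo_def keys_add_nat monomial_degree_add split: if_splits)
  qed
  moreover have "finite (?S j) \<and> card (?S j) = (card V + (D - j)) choose (D - j)" for j
    using insert.IH[of "D - j"] by (subst card_image) (auto intro!: inj_onI)
  moreover have "card (\<Union>j\<le>D. ?S j) = (\<Sum>j\<le>D. card (?S j))"
  proof (rule card_UN_disjoint)
    show "\<forall>i\<in>{..D}. \<forall>j\<in>{..D}. i \<noteq> j \<longrightarrow> ?S i \<inter> ?S j = {}"
    proof (intro ballI impI)
      fix i j :: nat assume "i \<noteq> j"
      have L: "Poly_Mapping.lookup \<alpha> v = i" if "\<alpha> \<in> ?S i" for \<alpha> i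
        using that * by (auto simp: lookup_add)
      show "?S i \<inter> ?S j = {}"
      proof (rule equals0I)
        fix \<alpha> assume "\<alpha> \<in> ?S i \<inter> ?S j"
        then show False using L[OF IntD1] L[OF IntD2] \<open>i \<noteq> j\<close> by metis
      qed
    qed
  qed (use insert.IH in auto)
  moreover have "(\<Sum>j\<le>D. (card V + (D - j)) choose (D - j)) = (\<Sum>j\<le>D. (card V + j) choose j)"
    by (rule sum.reindex_bij_witness[of _ "\<lambda>j. D - j" "\<lambda>j. D - j"]) auto
  moreover have "(\<Sum>j\<le>D. (card V + j) choose j) = (card (insert v V) + D) choose D"
    using insert.hyps by (simp add: sum_choose_lower)
  ultimately show ?case by simp
qed

lemma finite_expo: "finite V \<Longrightarrow> finite (expo V D)"
  and card_expo: "finite V \<Longrightarrow> card (expo V D) = (card V + D) choose D"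
  using finite_card_expo by blast+

section \<open>Real monomials on a Euclidean space\<close>

definition mon :: "('a::euclidean_space \<Rightarrow>\<^sub>0 nat) \<Rightarrow> 'a \<Rightarrow> real" where
  "mon \<alpha> x = monomial_eval \<alpha> (\<lambda>b. x \<bullet> b)"

lemma mon_add: "mon (\<alpha> + \<beta>) x = mon \<alpha> x * mon \<beta> x"
  by (simp add: mon_def monomial_eval_add)

lemma mon_single: "mon (Poly_Mapping.single b j) x = (x \<bullet> b) ^ j"
  by (simp add: mon_def)

lemma mon_0 [simp]: "mon 0 x = 1"
  by (simp add: mon_def)

lemma mon_scaleR: "mon \<alpha> (s *\<^sub>R x) = s ^ monomial_degree \<alpha> * mon \<alpha> x"
  by (simp add: mon_def monomial_eval_def monomial_degree_def power_mult_distrib prod.distrib power_sum)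

lemma mon_Basis:
  assumes "\<alpha> \<in> expo Basis D"
  shows "mon \<alpha> x = (\<Prod>b\<in>Basis. (x \<bullet> b) ^ Poly_Mapping.lookup \<alpha> b)"
  unfolding mon_def by (rule monomial_eval_superset) (use assms in \<open>auto simp: expo_def\<close>)

lemma poly_fun_expo:
  assumes "P \<in> real_polys k"
  shows "poly_fun P x = (\<Sum>\<alpha>\<in>expo Basis k. Poly_Mapping.lookup P \<alpha> * mon \<alpha> x)"
  unfolding poly_fun_def mon_def
  by (rule mpoly_eval_superset) (use assms in \<open>auto simp: real_polys_iff finite_expo\<close>)

text \<open>Restricted to \<open>Basis\<close>, the exponents of total degree at most
  \<open>D\<close> embed into the box of size \<open>D\<close>; extending the coefficients by zero
  reduces the claim to \<open>box_monomials_independent\<close>.\<close>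

lemma expo_monomials_independent:
  fixes c :: "('a::euclidean_space \<Rightarrow>\<^sub>0 nat) \<Rightarrow> real"
  assumes "\<And>x. (\<Sum>\<alpha>\<in>expo Basis D. c \<alpha> * mon \<alpha> x) = 0" "\<alpha> \<in> expo Basis D"
  shows "c \<alpha> = 0"
proof -
  let ?E = "expo Basis D :: ('a \<Rightarrow>\<^sub>0 nat) set" and ?B = "Basis :: 'a set"
  let ?r = "\<lambda>\<alpha>. restrict (Poly_Mapping.lookup \<alpha>) ?B"
  have r: "?r ` ?E \<subseteq> box_exps Basis D"
  proof (clarsimp simp: PiE_iff)
    fix \<alpha> b assume "\<alpha> \<in> ?E" "b \<in> ?B"
    then show "Poly_Mapping.lookup \<alpha> b \<le> D"
      using monomial_degree_superset[of ?B \<alpha>] member_le_sum[of b ?B "Poly_Mapping.lookup \<alpha>"]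
      by (auto simp: expo_def)
  qed
  have inj: "inj_on ?r ?E"
  proof (rule inj_onI, rule poly_mapping_eqI)
    fix \<alpha> \<beta> v assume a: "\<alpha> \<in> ?E" "\<beta> \<in> ?E" "?r \<alpha> = ?r \<beta>"
    show "Poly_Mapping.lookup \<alpha> v = Poly_Mapping.lookup \<beta> v"
    proof (cases "v \<in> ?B")
      case True
      then show ?thesis using fun_cong[OF a(3), of v] by simp
    next
      case False
      then have "v \<notin> Poly_Mapping.keys \<alpha>" "v \<notin> Poly_Mapping.keys \<beta>" using a by (auto simp: expo_def)
      then show ?thesis by (simp add: in_keys_iff)
    qed
  qed
  define c' where "c' f = (if f \<in> ?r ` ?E then c (inv_into ?E ?r f) else 0)" for f
  have c': "c' (?r \<alpha>) = c \<alpha>" if "\<alpha> \<in> ?E" for \<alpha>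
    using that inv_into_f_f[OF inj that] by (auto simp: c'_def)
  have "(\<Sum>f\<in>box_exps ?B D. c' f * (\<Prod>b\<in>?B. y b ^ f b)) = 0" for y
  proof -
    let ?x = "\<Sum>b\<in>?B. y b *\<^sub>R b"
    have x: "?x \<bullet> b = y b" if "b \<in> ?B" for b
      using that by simp
    have "(\<Sum>f\<in>box_exps ?B D. c' f * (\<Prod>b\<in>?B. y b ^ f b)) = (\<Sum>f\<in>?r ` ?E. c' f * (\<Prod>b\<in>?B. y b ^ f b))"
      by (rule sum.mono_neutral_right) (use r in \<open>auto intro!: finite_PiE simp: c'_def\<close>)
    also have "\<dots> = (\<Sum>\<alpha>\<in>?E. c \<alpha> * mon \<alpha> ?x)"
      by (subst sum.reindex[OF inj]) (auto intro!: sum.cong prod.cong simp: c' mon_Basis x simp del: inner_sum_left_Basis)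
    finally show ?thesis using assms(1) by simp
  qed
  moreover have "?r \<alpha> \<in> box_exps ?B D" using r assms(2) by blast
  ultimately have "c' (?r \<alpha>) = 0"
    by (rule box_monomials_independent[OF finite_Basis])
  then show ?thesis using c' assms(2) by simp
qed

text \<open>This is \<open>f = O(|x|^k)\<close> at the origin. The origin itself is included, so for
  positive \<open>k\<close> it forces \<open>f 0 = 0\<close>.\<close>

definition vanishes :: "nat \<Rightarrow> ('a::real_normed_vector \<Rightarrow> 'b::real_normed_vector) \<Rightarrow> bool" where
  "vanishes k f \<longleftrightarrow> (\<exists>C. \<exists>d>0. \<forall>x. norm x < d \<longrightarrow> norm (f x) \<le> C * norm x ^ k)"

lemma vanishesI: "d > 0 \<Longrightarrow> (\<And>x. norm x < d \<Longrightarrow> norm (f x) \<le> C * norm x ^ k) \<Longrightarrow> vanishes k f"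
  unfolding vanishes_def by blast

lemma vanishesE:
  assumes "vanishes k f"
  obtains C d where "C \<ge> 0" "d > 0" "\<And>x. norm x < d \<Longrightarrow> norm (f x) \<le> C * norm x ^ k"
proof -
  obtain C d where C: "d > 0" "\<And>x. norm x < d \<Longrightarrow> norm (f x) \<le> C * norm x ^ k"
    using assms unfolding vanishes_def by blast
  have "norm (f x) \<le> max C 0 * norm x ^ k" if "norm x < d" for x
  proof -
    have "C * norm x ^ k \<le> max C 0 * norm x ^ k" by (intro mult_right_mono) auto
    then show ?thesis using C(2)[OF that] by linarith
  qed
  with C(1) show ?thesis by (intro that[of "max C 0" d]) auto
qed

lemma vanishes_mono:
  assumes "vanishes k f" "l \<le> k" shows "vanishes l f"
proof -
  obtain C d where C: "C \<ge> 0" "d > 0" "\<And>x. norm x < d \<Longrightarrow> norm (f x) \<le> C * norm x ^ k"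
    by (rule vanishesE[OF assms(1)]) blast
  show ?thesis
  proof (rule vanishesI[of "min d 1" _ C])
    fix x :: 'a assume x: "norm x < min d 1"
    have "C * norm x ^ k \<le> C * norm x ^ l"
      by (intro mult_left_mono power_decreasing) (use C x assms in auto)
    then show "norm (f x) \<le> C * norm x ^ l" using C(3)[of x] x by simp
  qed (use C in auto)
qed

lemma vanishes_add:
  assumes "vanishes k f" "vanishes k g" shows "vanishes k (\<lambda>x. f x + g x)"
proof -
  obtain C d where C: "C \<ge> 0" "d > 0" "\<And>x. norm x < d \<Longrightarrow> norm (f x) \<le> C * norm x ^ k"
    by (rule vanishesE[OF assms(1)]) blast
  obtain C' d' where C': "C' \<ge> 0" "d' > 0" "\<And>x. norm x < d' \<Longrightarrow> norm (g x) \<le> C' * norm x ^ k"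
    by (rule vanishesE[OF assms(2)]) blast
  show ?thesis
  proof (rule vanishesI[of "min d d'" _ "C + C'"])
    fix x :: 'a assume "norm x < min d d'"
    then show "norm (f x + g x) \<le> (C + C') * norm x ^ k"
      using norm_triangle_ineq[of "f x" "g x"] C(3)[of x] C'(3)[of x] by (simp add: distrib_right)
  qed (use C C' in auto)
qed

lemma vanishes_0 [simp]: "vanishes k (\<lambda>_. 0)"
  by (rule vanishesI[of 1 _ 0]) auto

lemma vanishes_uminus: "vanishes k f \<Longrightarrow> vanishes k (\<lambda>x. - f x)"
  unfolding vanishes_def by simp

lemma vanishes_diff:
  "vanishes k f \<Longrightarrow> vanishes k g \<Longrightarrow> vanishes k (\<lambda>x. f x - g x)"
  using vanishes_add[OF _ vanishes_uminus] by fastforce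

lemma vanishes_sum:
  "(\<And>i. i \<in> I \<Longrightarrow> vanishes k (f i)) \<Longrightarrow> vanishes k (\<lambda>x. \<Sum>i\<in>I. f i x)"
  by (induction I rule: infinite_finite_induct) (auto intro: vanishes_add)

lemma vanishes_mult:
  fixes f g :: "'a::real_normed_vector \<Rightarrow> 'b::real_normed_algebra"
  assumes "vanishes k f" "vanishes l g" shows "vanishes (k + l) (\<lambda>x. f x * g x)"
proof -
  obtain C d where C: "C \<ge> 0" "d > 0" "\<And>x. norm x < d \<Longrightarrow> norm (f x) \<le> C * norm x ^ k"
    by (rule vanishesE[OF assms(1)]) blast
  obtain C' d' where C': "C' \<ge> 0" "d' > 0" "\<And>x. norm x < d' \<Longrightarrow> norm (g x) \<le> C' * norm x ^ l"
    by (rule vanishesE[OF assms(2)]) blast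
  show ?thesis
  proof (rule vanishesI[of "min d d'" _ "C * C'"])
    fix x :: 'a assume x: "norm x < min d d'"
    have "norm (f x * g x) \<le> norm (f x) * norm (g x)" by (rule norm_mult_ineq)
    also have "\<dots> \<le> (C * norm x ^ k) * (C' * norm x ^ l)"
      by (rule mult_mono) (use C(1,2) C(3)[of x] C'(3)[of x] x in auto)
    finally show "norm (f x * g x) \<le> C * C' * norm x ^ (k + l)" by (simp add: power_add mult_ac)
  qed (use C C' in auto)
qed

lemma vanishes_const: "vanishes 0 (\<lambda>_. c)"
  by (rule vanishesI[of 1 _ "norm c"]) auto

lemma vanishes_cmult:
  fixes f :: "'a::real_normed_vector \<Rightarrow> 'b::real_normed_algebra"
  shows "vanishes k f \<Longrightarrow> vanishes k (\<lambda>x. c * f x)"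
  using vanishes_mult[OF vanishes_const] by fastforce

lemma vanishes_mon:
  assumes "\<alpha> \<in> expo Basis D" shows "vanishes (monomial_degree \<alpha>) (mon \<alpha>)"
proof (rule vanishesI[of 1 _ 1])
  fix x :: 'a
  have "norm (mon \<alpha> x) = (\<Prod>b\<in>Basis. \<bar>x \<bullet> b\<bar> ^ Poly_Mapping.lookup \<alpha> b)"
    by (simp add: mon_Basis[OF assms] abs_prod power_abs)
  also have "\<dots> \<le> (\<Prod>b\<in>Basis. norm x ^ Poly_Mapping.lookup \<alpha> b)"
    by (intro prod_mono conjI power_mono Basis_le_norm) auto
  also have "\<dots> = norm x ^ monomial_degree \<alpha>"
    using assms by (subst monomial_degree_superset[of Basis]) (auto simp: power_sum expo_def)
  finally show "norm (mon \<alpha> x) \<le> 1 * norm x ^ monomial_degree \<alpha>" by simp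
qed simp

text \<open>Once the lower coefficients are known to vanish, dividing by \<open>s ^ j\<close> leaves
  a polynomial that tends to \<open>a j\<close> and is at the same time of order
  \<open>s\<close>.\<close>

lemma one_variable_low_coefficients_zero:
  fixes a :: "nat \<Rightarrow> real"
  assumes "d > 0" "\<And>s. 0 < s \<Longrightarrow> s < d \<Longrightarrow> \<bar>\<Sum>i\<le>D. a i * s ^ i\<bar> \<le> C * s ^ Suc k"
  shows "j \<le> k \<Longrightarrow> j \<le> D \<Longrightarrow> a j = 0"
proof (induction j rule: less_induct)
  case (less j)
  let ?h = "\<lambda>s. \<Sum>i=j..D. a i * s ^ (i - j)"
  have "(?h \<longlongrightarrow> ?h 0) (at_right 0)"
    by (intro tendsto_intros)
  moreover have "?h 0 = a j"
  proof -
    have "?h 0 = (\<Sum>i=j..D. if i = j then a i else 0)" by (rule sum.cong) (auto simp: power_0_left)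
    then show ?thesis using less.prems by (simp add: sum.delta)
  qed
  moreover have "(?h \<longlongrightarrow> 0) (at_right 0)"
  proof (rule Lim_null_comparison)
    have "norm (?h s) \<le> \<bar>C\<bar> * s" if s: "0 < s" "s < min d 1" for s
    proof -
      have "(\<Sum>i\<le>D. a i * s ^ i) = (\<Sum>i=j..D. a i * s ^ i)"
        by (rule sum.mono_neutral_right) (use less in auto)
      also have "\<dots> = s ^ j * ?h s"
        by (auto simp: sum_distrib_left power_add[symmetric] intro!: sum.cong)
      finally have "s ^ j * \<bar>?h s\<bar> \<le> C * s ^ Suc k"
        using assms(2)[of s] s by (simp add: abs_mult)
      also have "\<dots> \<le> \<bar>C\<bar> * s ^ Suc j"
        by (intro mult_mono power_decreasing) (use s less in auto)
      also have "\<dots> = s ^ j * (\<bar>C\<bar> * s)" by simp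
      finally show ?thesis using s by (simp only: mult_le_cancel_left_pos zero_less_power real_norm_def)
    qed
    then show "\<forall>\<^sub>F s in at_right 0. norm (?h s) \<le> \<bar>C\<bar> * s"
      unfolding eventually_at_right_field using assms(1) by (intro exI[of _ "min d 1"]) auto
    show "((\<lambda>s. \<bar>C\<bar> * s) \<longlongrightarrow> 0) (at_right 0)" by (auto intro!: tendsto_eq_intros)
  qed
  ultimately show ?case using tendsto_unique[of "at_right (0::real)"] by fastforce
qed

text \<open>On the ray through \<open>x\<close> the sum is a polynomial in \<open>s\<close> whose
  coefficient of \<open>s ^ j\<close> is the homogeneous part of degree \<open>j\<close> at
  \<open>x\<close>. The one-variable case makes this part vanish for every \<open>x\<close>, so its
  coefficients are zero by independence.\<close>

lemma low_coefficients_zero: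
  fixes c :: "('a::euclidean_space \<Rightarrow>\<^sub>0 nat) \<Rightarrow> real"
  assumes "vanishes (Suc k) (\<lambda>x. \<Sum>\<alpha>\<in>expo Basis D. c \<alpha> * mon \<alpha> x)"
    and "\<alpha> \<in> expo Basis D" "monomial_degree \<alpha> \<le> k"
  shows "c \<alpha> = 0"
proof -
  let ?E = "expo Basis D :: ('a \<Rightarrow>\<^sub>0 nat) set"
  obtain C d where C: "C \<ge> 0" "d > 0" "\<And>x. norm x < d \<Longrightarrow> norm (\<Sum>\<alpha>\<in>?E. c \<alpha> * mon \<alpha> x) \<le> C * norm x ^ Suc k"
    by (rule vanishesE[OF assms(1)]) blast
  define a where "a x j = (\<Sum>\<alpha>\<in>{\<alpha>\<in>?E. monomial_degree \<alpha> = j}. c \<alpha> * mon \<alpha> x)" for x j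
  have scale: "(\<Sum>\<alpha>\<in>?E. c \<alpha> * mon \<alpha> (s *\<^sub>R x)) = (\<Sum>j\<le>D. a x j * s ^ j)" for s x
  proof -
    have "(\<Sum>\<alpha>\<in>?E. c \<alpha> * mon \<alpha> (s *\<^sub>R x)) =
        (\<Sum>j\<le>D. \<Sum>\<alpha>\<in>{\<alpha>\<in>?E. monomial_degree \<alpha> = j}. c \<alpha> * mon \<alpha> (s *\<^sub>R x))"
      by (rule sum.group[symmetric]) (auto simp: finite_expo, auto simp: expo_def)
    also have "\<dots> = (\<Sum>j\<le>D. a x j * s ^ j)"
      unfolding a_def sum_distrib_right by (intro sum.cong refl) (auto simp: mon_scaleR)
    finally show ?thesis .
  qed
  have deg: "monomial_degree \<alpha> \<le> D" using assms(2) by (auto simp: expo_def)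
  have a0: "a x (monomial_degree \<alpha>) = 0" for x
  proof (rule one_variable_low_coefficients_zero[where D = D and k = k and a = "a x"])
    show "d / (norm x + 1) > 0" using C(2) by (simp add: add_nonneg_pos)
    fix s :: real assume s: "0 < s" "s < d / (norm x + 1)"
    have "norm (s *\<^sub>R x) \<le> s * (norm x + 1)" using s by simp
    also have "\<dots> < d" using s by (simp add: pos_less_divide_eq add_nonneg_pos)
    finally have "\<bar>\<Sum>j\<le>D. a x j * s ^ j\<bar> \<le> C * norm (s *\<^sub>R x) ^ Suc k"
      using C(3)[of "s *\<^sub>R x"] by (simp only: scale real_norm_def)
    also have "\<dots> = (C * norm x ^ Suc k) * s ^ Suc k" using s by (simp add: power_mult_distrib)
    finally show "\<bar>\<Sum>j\<le>D. a x j * s ^ j\<bar> \<le> (C * norm x ^ Suc k) * s ^ Suc k" .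
  qed (use assms(3) deg in auto)
  define c' where "c' \<beta> = (if monomial_degree \<beta> = monomial_degree \<alpha> then c \<beta> else 0)" for \<beta> :: "'a \<Rightarrow>\<^sub>0 nat"
  have "(\<Sum>\<beta>\<in>?E. c' \<beta> * mon \<beta> x) = a x (monomial_degree \<alpha>)" for x
    unfolding a_def c'_def
    by (rule sum.mono_neutral_cong_right) (auto simp: finite_expo)
  then have "c' \<alpha> = 0"
    using expo_monomials_independent[where c = c' and D = D, OF _ assms(2)] a0 by simp
  then show ?thesis by (simp add: c'_def)
qed

section \<open>Polynomials depending polynomially on jets\<close>

text \<open>Coefficients that are polynomial in a parameter \<open>t\<close>: with the jet as
  parameter, this is the bookkeeping that makes the coefficients of \<open>P\<close> polynomial
  functions of the jet.\<close>

definition param_poly ::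
    "'b set \<Rightarrow> nat \<Rightarrow> (('b \<Rightarrow> real) \<Rightarrow> 'a::euclidean_space \<Rightarrow> real) \<Rightarrow> bool" where
  "param_poly B D f \<longleftrightarrow>
     (\<exists>c. (\<forall>\<alpha>. polyfn B (c \<alpha>)) \<and> (\<forall>t x. f t x = (\<Sum>\<alpha>\<in>expo Basis D. c \<alpha> t * mon \<alpha> x)))"

lemma param_polyI:
  assumes "finite I" "\<And>i. i \<in> I \<Longrightarrow> polyfn B (a i)" "\<And>i. i \<in> I \<Longrightarrow> h i \<in> expo Basis D"
    and "\<And>t x. f t x = (\<Sum>i\<in>I. a i t * mon (h i) x)"
  shows "param_poly B D f"
proof -
  let ?c = "\<lambda>\<alpha> t. \<Sum>i\<in>{i\<in>I. h i = \<alpha>}. a i t"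
  have "f t x = (\<Sum>\<alpha>\<in>expo Basis D. ?c \<alpha> t * mon \<alpha> x)" for t x
  proof -
    have "f t x = (\<Sum>\<alpha>\<in>expo Basis D. \<Sum>i\<in>{i\<in>I. h i = \<alpha>}. a i t * mon (h i) x)"
      unfolding assms(4) by (rule sum.group[symmetric]) (use assms in \<open>auto simp: finite_expo\<close>)
    also have "\<dots> = (\<Sum>\<alpha>\<in>expo Basis D. ?c \<alpha> t * mon \<alpha> x)"
      by (auto simp: sum_distrib_right intro!: sum.cong)
    finally show ?thesis .
  qed
  moreover have "polyfn B (?c \<alpha>)" for \<alpha> by (rule polyfn_sum) (use assms in auto)
  ultimately show ?thesis unfolding param_poly_def by (intro exI[of _ ?c]) auto
qed

lemma param_polyE:
  assumes "param_poly B D f"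
  obtains c where "\<And>\<alpha>. polyfn B (c \<alpha>)" "\<And>t x. f t x = (\<Sum>\<alpha>\<in>expo Basis D. c \<alpha> t * mon \<alpha> x)"
  using assms unfolding param_poly_def by blast

lemma param_poly_mono:
  assumes "param_poly B D f" "D \<le> E" shows "param_poly B E f"
proof -
  obtain c where "\<And>\<alpha>. polyfn B (c \<alpha>)" "\<And>t x. f t x = (\<Sum>\<alpha>\<in>expo Basis D. c \<alpha> t * mon \<alpha> x)"
    by (rule param_polyE[OF assms(1)]) blast
  then show ?thesis
    by (intro param_polyI[where I = "expo Basis D" and a = c and h = id])
      (auto simp: finite_expo intro: subsetD[OF expo_mono[OF assms(2)]])
qed

lemma param_poly_add:
  assumes "param_poly B D f" "param_poly B D g" shows "param_poly B D (\<lambda>t x. f t x + g t x)"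
proof -
  obtain c where c: "\<And>\<alpha>. polyfn B (c \<alpha>)" "\<And>t x. f t x = (\<Sum>\<alpha>\<in>expo Basis D. c \<alpha> t * mon \<alpha> x)"
    by (rule param_polyE[OF assms(1)]) blast
  obtain c' where c': "\<And>\<alpha>. polyfn B (c' \<alpha>)" "\<And>t x. g t x = (\<Sum>\<alpha>\<in>expo Basis D. c' \<alpha> t * mon \<alpha> x)"
    by (rule param_polyE[OF assms(2)]) blast
  show ?thesis
    by (rule param_polyI[where I = "expo Basis D" and a = "\<lambda>\<alpha> t. c \<alpha> t + c' \<alpha> t" and h = id])
      (use c c' in \<open>auto simp: finite_expo distrib_right sum.distrib intro: polyfn.add\<close>)
qed

lemma param_poly_mult:
  assumes "param_poly B D f" "param_poly B E g" shows "param_poly B (D + E) (\<lambda>t x. f t x * g t x)"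
proof -
  obtain c where c: "\<And>\<alpha>. polyfn B (c \<alpha>)" "\<And>t x. f t x = (\<Sum>\<alpha>\<in>expo Basis D. c \<alpha> t * mon \<alpha> x)"
    by (rule param_polyE[OF assms(1)]) blast
  obtain c' where c': "\<And>\<alpha>. polyfn B (c' \<alpha>)" "\<And>t x. g t x = (\<Sum>\<alpha>\<in>expo Basis E. c' \<alpha> t * mon \<alpha> x)"
    by (rule param_polyE[OF assms(2)]) blast
  show ?thesis
  proof (rule param_polyI[where I = "expo Basis D \<times> expo Basis E" and a = "\<lambda>i t. c (fst i) t * c' (snd i) t"
        and h = "\<lambda>i. fst i + snd i"])
    show "f t x * g t x = (\<Sum>i\<in>expo Basis D \<times> expo Basis E. c (fst i) t * c' (snd i) t * mon (fst i + snd i) x)" for t x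
      unfolding c c' sum_product sum.cartesian_product
      by (auto intro!: sum.cong simp: mon_add)
  qed (use c c' in \<open>auto simp: finite_expo intro: polyfn.mult add_in_expo\<close>)
qed

lemma param_poly_coeff: "polyfn B \<phi> \<Longrightarrow> param_poly B D (\<lambda>t _. \<phi> t)"
  by (rule param_polyI[where I = "{()}" and a = "\<lambda>_. \<phi>" and h = "\<lambda>_. 0"]) (auto simp: expo_def)

lemma param_poly_mon: "\<alpha> \<in> expo Basis D \<Longrightarrow> param_poly B D (\<lambda>_. mon \<alpha>)"
  by (rule param_polyI[where I = "{()}" and a = "\<lambda>_ _. 1" and h = "\<lambda>_. \<alpha>"]) (auto intro: polyfn.const)

lemma param_poly_coord: "b \<in> Basis \<Longrightarrow> param_poly B (Suc 0) (\<lambda>_ x. x \<bullet> b)"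
  using param_poly_mon[of "Poly_Mapping.single b 1" "Suc 0" B]
  by (simp add: expo_def mon_single[abs_def])

lemma param_poly_sum:
  "(\<And>i. i \<in> I \<Longrightarrow> param_poly B D (f i)) \<Longrightarrow> param_poly B D (\<lambda>t x. \<Sum>i\<in>I. f i t x)"
  by (induction I rule: infinite_finite_induct) (auto intro: param_poly_add param_poly_coeff polyfn.const)

lemma param_poly_cmult:
  "polyfn B \<phi> \<Longrightarrow> param_poly B D f \<Longrightarrow> param_poly B D (\<lambda>t x. \<phi> t * f t x)"
  using param_poly_mult[OF param_poly_coeff[of B \<phi> 0]] by simp

lemma param_poly_diff:
  assumes "param_poly B D f" "param_poly B D g" shows "param_poly B D (\<lambda>t x. f t x - g t x)"
  using param_poly_add[OF assms(1) param_poly_cmult[OF polyfn.const[of B "- 1"] assms(2)]] by simp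

lemma param_poly_power:
  assumes "param_poly B D f" shows "param_poly B (n * D) (\<lambda>t x. f t x ^ n)"
  by (induction n) (use param_poly_mult[OF assms] in \<open>auto intro: param_poly_coeff polyfn.const\<close>)

lemma param_poly_prod:
  assumes "finite I" "\<And>i. i \<in> I \<Longrightarrow> param_poly B (d i) (f i)"
  shows "param_poly B (\<Sum>i\<in>I. d i) (\<lambda>t x. \<Prod>i\<in>I. f i t x)"
  using assms
  by (induction I rule: finite_induct) (auto intro!: param_poly_mult param_poly_coeff polyfn.const)

text \<open>Expanding around a moving centre does not raise the total degree and produces
  coefficients polynomial in the coordinates of the centre. This is how the unknown point enters the
  parametrization.\<close>

lemma param_poly_mon_translate:
  assumes "\<beta> \<in> expo Basis k" "\<And>b. b \<in> Basis \<Longrightarrow> polyfn B (\<lambda>t. p t \<bullet> b)"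
  shows "param_poly B k (\<lambda>t x. mon \<beta> (x - p t))"
proof -
  have "param_poly B (\<Sum>b\<in>Basis. Poly_Mapping.lookup \<beta> b * Suc 0)
      (\<lambda>t x. \<Prod>b\<in>Basis. (x \<bullet> b - p t \<bullet> b) ^ Poly_Mapping.lookup \<beta> b)"
    by (intro param_poly_prod param_poly_power param_poly_diff param_poly_coord param_poly_coeff assms finite_Basis)
  moreover have "(\<Sum>b\<in>Basis. Poly_Mapping.lookup \<beta> b * Suc 0) \<le> k"
    using assms(1) monomial_degree_superset[of Basis \<beta>] by (auto simp: expo_def)
  ultimately show ?thesis
    using param_poly_mono by (auto simp: mon_Basis[OF assms(1)] inner_diff_left)
qed

section \<open>Complex-valued polynomials in the real coordinates\<close>

definition param_cpoly ::
    "'b set \<Rightarrow> nat \<Rightarrow> (('b \<Rightarrow> real) \<Rightarrow> 'a::euclidean_space \<Rightarrow> complex) \<Rightarrow> bool" where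
  "param_cpoly B D f \<longleftrightarrow>
     param_poly B D (\<lambda>t x. Re (f t x)) \<and> param_poly B D (\<lambda>t x. Im (f t x))"

lemma param_cpoly_mult:
  "param_cpoly B D f \<Longrightarrow> param_cpoly B E g \<Longrightarrow> param_cpoly B (D + E) (\<lambda>t x. f t x * g t x)"
  by (auto simp: param_cpoly_def intro!: param_poly_mult param_poly_add param_poly_diff)

lemma param_cpoly_coeff:
  "polyfn B (\<lambda>t. Re (\<phi> t)) \<Longrightarrow> polyfn B (\<lambda>t. Im (\<phi> t)) \<Longrightarrow> param_cpoly B D (\<lambda>t _. \<phi> t)"
  by (auto simp: param_cpoly_def intro!: param_poly_coeff)

lemma param_cpoly_sum:
  "(\<And>i. i \<in> I \<Longrightarrow> param_cpoly B D (f i)) \<Longrightarrow> param_cpoly B D (\<lambda>t x. \<Sum>i\<in>I. f i t x)"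
  by (auto simp: param_cpoly_def intro!: param_poly_sum)

lemma param_cpoly_power:
  assumes "param_cpoly B D f" shows "param_cpoly B (n * D) (\<lambda>t x. f t x ^ n)"
  by (induction n)
    (use param_cpoly_mult[OF assms] in \<open>auto intro!: param_cpoly_coeff intro: polyfn.const\<close>)

lemma param_cpoly_prod:
  assumes "finite I" "\<And>i. i \<in> I \<Longrightarrow> param_cpoly B (d i) (f i)"
  shows "param_cpoly B (\<Sum>i\<in>I. d i) (\<lambda>t x. \<Prod>i\<in>I. f i t x)"
  using assms
  by (induction I rule: finite_induct) (auto intro!: param_cpoly_mult param_cpoly_coeff intro: polyfn.const)

lemma param_cpoly_mono: "param_cpoly B D f \<Longrightarrow> D \<le> E \<Longrightarrow> param_cpoly B E f"
  by (auto simp: param_cpoly_def intro: param_poly_mono)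

lemma param_cpoly_component:
  "param_cpoly B (Suc 0) (\<lambda>_ z :: complex ^ 'k::finite. z $ i)"
proof -
  have "axis i 1 \<in> (Basis :: (complex ^ 'k) set)" "axis i \<i> \<in> (Basis :: (complex ^ 'k) set)"
    by (auto simp: axis_in_Basis_iff Basis_complex_def)
  from this[THEN param_poly_coord[of _ B]] show ?thesis
    by (simp add: param_cpoly_def inner_axis inner_complex_def)
qed

definition cmon :: "('k::finite \<Rightarrow>\<^sub>0 nat) \<Rightarrow> complex ^ 'k \<Rightarrow> complex" where
  "cmon \<gamma> z = (\<Prod>i\<in>UNIV. (z $ i) ^ Poly_Mapping.lookup \<gamma> i)"

lemma param_cpoly_cmon:
  assumes "\<gamma> \<in> expo UNIV k" shows "param_cpoly B k (\<lambda>_. cmon \<gamma>)"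
proof -
  have "param_cpoly B (\<Sum>i\<in>UNIV. Poly_Mapping.lookup \<gamma> i * Suc 0) (\<lambda>_. cmon \<gamma>)"
    unfolding cmon_def[abs_def] by (intro param_cpoly_prod param_cpoly_power param_cpoly_component finite)
  moreover have "(\<Sum>i\<in>UNIV. Poly_Mapping.lookup \<gamma> i * Suc 0) \<le> k"
    using assms monomial_degree_superset[of UNIV \<gamma>] by (auto simp: expo_def)
  ultimately show ?thesis by (rule param_cpoly_mono)
qed

text \<open>
  The coordinates on the space of jets. The signs of the hyperquadric are treated as real
  coordinates too, so that one polynomial relation serves all signatures.
\<close>

datatype ('a, 'n, 'm) jet_coord =
    Point 'a | Sign 'm | Factor "'a \<Rightarrow>\<^sub>0 nat"
  | MapRe "'m option" "'n option \<Rightarrow>\<^sub>0 nat" | MapIm "'m option" "'n option \<Rightarrow>\<^sub>0 nat"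

text \<open>Of the infinitely many coordinates, the finitely many that occur in jets of order
  \<open>k\<close>.\<close>

definition jet_coords :: "nat \<Rightarrow> ('n::finite cspace, 'n, 'm) jet_coord set" where
  "jet_coords k = Point ` Basis \<union> Sign ` UNIV \<union> Factor ` expo Basis (k - 1)
     \<union> (\<lambda>(j, \<gamma>). MapRe j \<gamma>) ` (UNIV \<times> expo UNIV k) \<union> (\<lambda>(j, \<gamma>). MapIm j \<gamma>) ` (UNIV \<times> expo UNIV k)"

definition jet_point :: "(('n::finite cspace, 'n, 'm) jet_coord \<Rightarrow> real) \<Rightarrow> 'n cspace" where
  "jet_point t = (\<Sum>b\<in>Basis. t (Point b) *\<^sub>R b)"

definition jet_factor :: "nat \<Rightarrow> (('n::finite cspace, 'n, 'm) jet_coord \<Rightarrow> real) \<Rightarrow> 'n cspace \<Rightarrow> real" where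
  "jet_factor k t x = (\<Sum>\<beta>\<in>expo Basis (k - 1). t (Factor \<beta>) * mon \<beta> x)"

definition jet_map ::
    "nat \<Rightarrow> (('n::finite cspace, 'n, 'm) jet_coord \<Rightarrow> real) \<Rightarrow> 'm option \<Rightarrow> 'n cspace \<Rightarrow> complex" where
  "jet_map k t j x = (\<Sum>\<gamma>\<in>expo UNIV k. Complex (t (MapRe j \<gamma>)) (t (MapIm j \<gamma>)) * cmon \<gamma> x)"

text \<open>\<open>hyperquadric_fun S\<close> of the Taylor polynomials, once \<open>Sign j\<close>
  is \<open>1\<close> on \<open>S\<close> and \<open>-1\<close> elsewhere, as in
  \<open>hyperquadric_fun_eq\<close>. It is not truncated, so its degree can reach
  \<open>2 * k\<close>.\<close>

definition jet_quadric ::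
    "nat \<Rightarrow> (('n::finite cspace, 'n, 'm::finite) jet_coord \<Rightarrow> real) \<Rightarrow> 'n cspace \<Rightarrow> real" where
  "jet_quadric k t x = Im (jet_map k t None x)
     + (\<Sum>j\<in>UNIV. t (Sign j) * (cmod (jet_map k t (Some j) x))\<^sup>2)"

lemma param_cpoly_jet_map: "param_cpoly (jet_coords k) k (\<lambda>t. jet_map k t j)"
proof -
  have "param_cpoly (jet_coords k) (0 + k)
      (\<lambda>t x. Complex (t (MapRe j \<gamma>)) (t (MapIm j \<gamma>)) * cmon \<gamma> x)" if "\<gamma> \<in> expo UNIV k" for \<gamma>
    by (intro param_cpoly_mult param_cpoly_coeff param_cpoly_cmon that)
      (auto intro!: polyfn.var simp: jet_coords_def that intro: rev_image_eqI)
  then show ?thesis unfolding jet_map_def[abs_def] by (intro param_cpoly_sum) auto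
qed

lemma param_poly_jet_quadric:
  "param_poly (jet_coords k) (k + k) (jet_quadric k :: (('n::finite cspace, 'n, 'm::finite) jet_coord \<Rightarrow> real) \<Rightarrow> _)"
proof -
  let ?B = "jet_coords k :: ('n cspace, 'n, 'm) jet_coord set"
  have "param_poly ?B (k + k) (\<lambda>t x. t (Sign j) * (cmod (jet_map k t (Some j) x))\<^sup>2)" for j
    unfolding cmod_power2 unfolding power2_eq_square
    by (intro param_poly_cmult polyfn.var param_poly_add param_poly_mult)
      (use param_cpoly_jet_map[of k "Some j"] in \<open>auto simp: jet_coords_def param_cpoly_def\<close>)
  moreover have "param_poly ?B (k + k) (\<lambda>t x. Im (jet_map k t None x))"
    by (rule param_poly_mono[of _ k]) (use param_cpoly_jet_map[of k None] in \<open>auto simp: param_cpoly_def\<close>)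
  ultimately show ?thesis
    unfolding jet_quadric_def[abs_def] by (intro param_poly_sum param_poly_add) auto
qed

text \<open>The degrees \<open>k - 1\<close> and \<open>k + k\<close> add up to at most
  \<open>3 * k\<close>. Terms above degree \<open>k\<close> may stay, as only the coefficients up to
  degree \<open>k\<close> are compared later.\<close>

lemma param_poly_jet_product:
  "param_poly (jet_coords k) (3 * k) (\<lambda>t (x :: 'n::finite cspace).
     jet_factor k t x * jet_quadric k (t :: (_, 'n, 'm::finite) jet_coord \<Rightarrow> real) x)"
proof -
  let ?B = "jet_coords k :: ('n cspace, 'n, 'm) jet_coord set"
  have "param_poly ?B (k - 1) (\<lambda>t. jet_factor k t)"
    unfolding jet_factor_def[abs_def]
    by (intro param_poly_sum param_poly_cmult param_poly_mon polyfn.var) (auto simp: jet_coords_def)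
  from param_poly_mono[OF param_poly_mult[OF this param_poly_jet_quadric]] show ?thesis by simp
qed

section \<open>Recovering P from a jet\<close>

lemma poly_fun_translate:
  fixes p :: "'a::euclidean_space"
  assumes "P \<in> real_polys k"
  obtains a where "\<And>x. poly_fun P (p + x) = (\<Sum>\<beta>\<in>expo Basis k. a \<beta> * mon \<beta> x)"
proof -
  have "param_poly ({} :: unit set) k (\<lambda>_ x. \<Sum>\<alpha>\<in>expo Basis k. Poly_Mapping.lookup P \<alpha> * mon \<alpha> (x - - p))"
    by (intro param_poly_sum param_poly_cmult polyfn.const param_poly_mon_translate)
  then obtain c :: "('a \<Rightarrow>\<^sub>0 nat) \<Rightarrow> (unit \<Rightarrow> real) \<Rightarrow> real"
    where "\<And>t x. (\<Sum>\<alpha>\<in>expo Basis k. Poly_Mapping.lookup P \<alpha> * mon \<alpha> (x - - p))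
      = (\<Sum>\<alpha>\<in>expo Basis k. c \<alpha> t * mon \<alpha> x)"
    by (rule param_polyE) blast
  then show ?thesis
    by (intro that[of "\<lambda>\<alpha>. c \<alpha> (\<lambda>_. 0)"]) (simp add: poly_fun_expo[OF assms] add.commute)
qed

text \<open>Around the point of the jet, the coefficients of \<open>P\<close> are those of the
  product up to degree \<open>k\<close>, and there are no others because \<open>P\<close> has degree
  at most \<open>k\<close>. Recentring at the origin keeps the dependence polynomial.\<close>

lemma coefficients_polynomial_in_jets:
  fixes k :: nat
  obtains \<Phi> :: "('n::finite cspace \<Rightarrow>\<^sub>0 nat) \<Rightarrow> (('n cspace, 'n, 'm::finite) jet_coord \<Rightarrow> real) \<Rightarrow> real"
  where "\<And>\<alpha>. polyfn (jet_coords k) (\<Phi> \<alpha>)"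
    "\<And>P t \<alpha>. P \<in> real_polys k \<Longrightarrow>
       vanishes (Suc k) (\<lambda>x. poly_fun P (jet_point t + x) - jet_factor k t x * jet_quadric k t x) \<Longrightarrow>
       \<alpha> \<in> expo Basis k \<Longrightarrow> Poly_Mapping.lookup P \<alpha> = \<Phi> \<alpha> t"
proof -
  let ?E = "expo Basis k :: ('n cspace \<Rightarrow>\<^sub>0 nat) set" and ?E3 = "expo Basis (3 * k) :: ('n cspace \<Rightarrow>\<^sub>0 nat) set"
  obtain q :: "('n cspace \<Rightarrow>\<^sub>0 nat) \<Rightarrow> (('n cspace, 'n, 'm) jet_coord \<Rightarrow> real) \<Rightarrow> real"
    where q: "\<And>\<beta>. polyfn (jet_coords k) (q \<beta>)"
      "\<And>t x. jet_factor k t x * jet_quadric k t x = (\<Sum>\<beta>\<in>?E3. q \<beta> t * mon \<beta> x)"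
    using param_poly_jet_product[where 'n = 'n and 'm = 'm, of k] by (rule param_polyE) blast
  have "polyfn (jet_coords k) (\<lambda>t :: ('n cspace, 'n, 'm) jet_coord \<Rightarrow> real. jet_point t \<bullet> b)" if "b \<in> Basis" for b
    using that by (auto simp: jet_point_def jet_coords_def intro: polyfn.var)
  then have "param_poly (jet_coords k) k (\<lambda>t x. \<Sum>\<beta>\<in>?E. q \<beta> t * mon \<beta> (x - jet_point t))"
    by (intro param_poly_sum param_poly_cmult q param_poly_mon_translate)
  then obtain \<Phi> where \<Phi>: "\<And>\<alpha>. polyfn (jet_coords k) (\<Phi> \<alpha>)"
    "\<And>t x. (\<Sum>\<beta>\<in>?E. q \<beta> t * mon \<beta> (x - jet_point t)) = (\<Sum>\<alpha>\<in>?E. \<Phi> \<alpha> t * mon \<alpha> x)"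
    by (rule param_polyE) blast
  show ?thesis
  proof (rule that[OF \<Phi>(1)])
    fix P :: "('n cspace \<Rightarrow>\<^sub>0 nat) \<Rightarrow>\<^sub>0 real"
      and t :: "('n cspace, 'n, 'm) jet_coord \<Rightarrow> real" and \<alpha>
    assume P: "P \<in> real_polys k" and \<alpha>: "\<alpha> \<in> ?E"
      and van: "vanishes (Suc k) (\<lambda>x. poly_fun P (jet_point t + x) - jet_factor k t x * jet_quadric k t x)"
    obtain a where a: "\<And>x. poly_fun P (jet_point t + x) = (\<Sum>\<beta>\<in>?E. a \<beta> * mon \<beta> x)"
      using poly_fun_translate[OF P] by blast
    \<comment> \<open>Extension by zero, so that \<open>P\<close> and the product are compared over
      the same exponents.\<close>
    define a' where "a' \<beta> = (if \<beta> \<in> ?E then a \<beta> else 0)" for \<beta>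
    have a': "poly_fun P (jet_point t + x) = (\<Sum>\<beta>\<in>?E3. a' \<beta> * mon \<beta> x)" for x
      unfolding a by (rule sum.mono_neutral_cong_left) (auto simp: finite_expo a'_def intro: subsetD[OF expo_mono[of k "3 * k"]])
    have "vanishes (Suc k) (\<lambda>x. \<Sum>\<beta>\<in>?E3. (a' \<beta> - q \<beta> t) * mon \<beta> x)"
      using van unfolding a' q by (simp add: sum_subtractf left_diff_distrib)
    then have "a' \<beta> - q \<beta> t = 0" if "\<beta> \<in> ?E" for \<beta>
      by (rule low_coefficients_zero) (use that in \<open>auto simp: expo_def\<close>)
    then have aq: "a \<beta> = q \<beta> t" if "\<beta> \<in> ?E" for \<beta> using that by (simp add: a'_def)
    have "(\<Sum>\<alpha>\<in>?E. (Poly_Mapping.lookup P \<alpha> - \<Phi> \<alpha> t) * mon \<alpha> y) = 0" for y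
    proof -
      have "poly_fun P y = (\<Sum>\<beta>\<in>?E. q \<beta> t * mon \<beta> (y - jet_point t))"
        using a[of "y - jet_point t"] aq by simp
      then show ?thesis
        unfolding \<Phi>(2) poly_fun_expo[OF P] by (simp add: left_diff_distrib sum_subtractf)
    qed
    from expo_monomials_independent[OF this \<alpha>] show "Poly_Mapping.lookup P \<alpha> = \<Phi> \<alpha> t" by simp
  qed
qed

section \<open>Division by a function with nonzero differential\<close>

text \<open>Over the empty set \<open>polyfn\<close> yields constants only, so this is the
  parameter-free case; \<open>unit\<close> is a dummy type.\<close>

abbreviation is_poly :: "nat \<Rightarrow> ('a::euclidean_space \<Rightarrow> real) \<Rightarrow> bool" where
  "is_poly D f \<equiv> param_poly ({} :: unit set) D (\<lambda>_. f)"

lemma is_polyE: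
  assumes "is_poly D f"
  obtains c where "\<And>x. f x = (\<Sum>\<alpha>\<in>expo Basis D. c \<alpha> * mon \<alpha> x)"
proof -
  obtain c :: "('a \<Rightarrow>\<^sub>0 nat) \<Rightarrow> (unit \<Rightarrow> real) \<Rightarrow> real"
    where "\<And>t x. f x = (\<Sum>\<alpha>\<in>expo Basis D. c \<alpha> t * mon \<alpha> x)"
    using assms by (rule param_polyE) blast
  then show ?thesis by (intro that[of "\<lambda>\<alpha>. c \<alpha> (\<lambda>_. 0)"]) simp
qed

lemma is_poly_vanishes_0:
  assumes "is_poly D f" shows "vanishes 0 f"
proof -
  obtain c where c: "\<And>x. f x = (\<Sum>\<alpha>\<in>expo Basis D. c \<alpha> * mon \<alpha> x)"
    using assms by (rule is_polyE) blast
  have "vanishes 0 (\<lambda>x. \<Sum>\<alpha>\<in>expo Basis D. c \<alpha> * mon \<alpha> x)"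
    by (intro vanishes_sum vanishes_cmult vanishes_mono[OF vanishes_mon]) auto
  then show ?thesis by (simp add: c[symmetric])
qed

lemma continuous_on_mon: "continuous_on S (mon \<alpha>)"
  unfolding mon_def[abs_def] monomial_eval_def by (intro continuous_intros)

lemma is_poly_continuous_on:
  assumes "is_poly D f" shows "continuous_on S f"
proof -
  obtain c where c: "\<And>x. f x = (\<Sum>\<alpha>\<in>expo Basis D. c \<alpha> * mon \<alpha> x)"
    using assms by (rule is_polyE) blast
  have "continuous_on S (\<lambda>x. \<Sum>\<alpha>\<in>expo Basis D. c \<alpha> * mon \<alpha> x)"
    by (intro continuous_intros continuous_on_mon)
  then show ?thesis by (simp add: c[symmetric])
qed

section \<open>Monomials and derivatives at the origin\<close>

lemma monomial_degree_eq_0: "monomial_degree \<gamma> = 0 \<longleftrightarrow> \<gamma> = 0"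
proof
  assume "monomial_degree \<gamma> = 0"
  then have "Poly_Mapping.lookup \<gamma> v = 0" for v
    by (cases "v \<in> Poly_Mapping.keys \<gamma>") (auto simp: monomial_degree_def in_keys_iff)
  then show "\<gamma> = 0" by (intro poly_mapping_eqI) simp
qed simp

lemma degree_1_eq_single:
  assumes "monomial_degree \<gamma> = 1" "v \<in> Poly_Mapping.keys \<gamma>"
  shows "\<gamma> = Poly_Mapping.single v 1"
proof -
  have eq: "\<gamma> = (\<gamma> - Poly_Mapping.single v 1) + Poly_Mapping.single v 1"
    by (rule minus_single_add) (use assms(2) in \<open>simp add: in_keys_iff\<close>)
  then have "monomial_degree \<gamma> = monomial_degree (\<gamma> - Poly_Mapping.single v 1) + 1"
    using monomial_degree_add[of "\<gamma> - Poly_Mapping.single v 1" "Poly_Mapping.single v 1"] by simp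
  then have "\<gamma> - Poly_Mapping.single v 1 = 0" using assms(1) by (simp add: monomial_degree_eq_0)
  with eq show ?thesis by simp
qed

lemma degree_1_single:
  assumes "monomial_degree \<gamma> = 1"
  obtains v where "v \<in> Poly_Mapping.keys \<gamma>" "\<gamma> = Poly_Mapping.single v 1"
proof -
  have "Poly_Mapping.keys \<gamma> \<noteq> {}" using assms by (auto simp: monomial_degree_def)
  then show ?thesis using degree_1_eq_single[OF assms] that by blast
qed

lemma vanishes_at_0: "vanishes (Suc k) f \<Longrightarrow> f 0 = 0"
  by (elim vanishesE) (metis mult_zero_right norm_le_zero_iff norm_zero power_0_Suc mult_zero_left)

lemma vanishes_2_has_derivative:
  assumes "vanishes (Suc (Suc 0)) f" shows "(f has_derivative (\<lambda>_. 0)) (at 0)"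
proof -
  obtain C d where C: "C \<ge> 0" "d > 0" "\<And>x. norm x < d \<Longrightarrow> norm (f x) \<le> C * norm x ^ Suc (Suc 0)"
    by (rule vanishesE[OF assms]) blast
  show ?thesis unfolding has_derivative_at_alt
  proof (intro conjI allI impI)
    fix e :: real assume e: "e > 0"
    let ?d = "min d (e / (C + 1))"
    have "norm (f y - f 0 - 0) \<le> e * norm (y - 0)" if y: "norm (y - 0) < ?d" for y
    proof -
      have "norm y * (C + 1) < e" using y C(1) by (simp add: pos_less_divide_eq add_nonneg_pos)
      then have "C * norm y \<le> e" using mult_left_mono[of C "C + 1" "norm y"] by (simp add: mult_ac)
      then have "(C * norm y) * norm y \<le> e * norm y" by (rule mult_right_mono) simp
      then show ?thesis using C(3)[of y] y vanishes_at_0[OF assms] by (simp add: mult_ac)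
    qed
    then show "\<exists>d>0. \<forall>y. norm (y - 0) < d \<longrightarrow> norm (f y - f 0 - 0) \<le> e * norm (y - 0)"
      using e C by (intro exI[of _ ?d]) auto
  qed simp
qed

lemma mon_has_derivative_at_0:
  assumes "\<gamma> \<in> expo Basis D"
  shows "(mon \<gamma> has_derivative (\<lambda>h. if monomial_degree \<gamma> = 1 then mon \<gamma> h else 0)) (at 0)"
proof -
  consider "monomial_degree \<gamma> = 0" | "monomial_degree \<gamma> = 1" | "monomial_degree \<gamma> \<ge> Suc (Suc 0)"
    by linarith
  then show ?thesis
  proof cases
    case 1
    then have [simp]: "\<gamma> = 0" by (simp add: monomial_degree_eq_0)
    have "mon (0 :: 'a \<Rightarrow>\<^sub>0 nat) = (\<lambda>_. 1)" by auto
    then show ?thesis by simp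
  next
    case 2
    then obtain v where v: "\<gamma> = Poly_Mapping.single v 1" by (rule degree_1_single)
    have "((\<lambda>x. x \<bullet> v) has_derivative (\<lambda>h. h \<bullet> v)) (at 0)" by (auto intro!: derivative_eq_intros)
    then show ?thesis using 2 by (simp add: v mon_single[abs_def])
  next
    case 3
    then show ?thesis using vanishes_2_has_derivative[OF vanishes_mono[OF vanishes_mon[OF assms] 3]] by simp
  qed
qed

text \<open>Only the monomials of degree 1 have a nonzero derivative at the origin. This identifies
  the coefficient by which the division algorithm has to divide.\<close>

lemma linear_coefficient_eq_derivative:
  assumes f: "\<And>x. f x = (\<Sum>\<alpha>\<in>expo Basis D. c \<alpha> * mon \<alpha> x)"
    and "(f has_derivative l) (at 0)" "b \<in> Basis" "Suc 0 \<le> D"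
  shows "l b = c (Poly_Mapping.single b 1)"
proof -
  let ?l = "\<lambda>h. \<Sum>\<alpha>\<in>expo Basis D. c \<alpha> * (if monomial_degree \<alpha> = 1 then mon \<alpha> h else 0)"
  have "((\<lambda>x. \<Sum>\<alpha>\<in>expo Basis D. c \<alpha> * mon \<alpha> x) has_derivative ?l) (at 0)"
    by (intro has_derivative_sum has_derivative_mult_right mon_has_derivative_at_0)
  then have "(f has_derivative ?l) (at 0)" by (simp add: f[symmetric])
  from has_derivative_unique[OF assms(2) this] have "l b = ?l b" by (rule fun_cong)
  also have "\<dots> = (\<Sum>\<alpha>\<in>expo Basis D. if \<alpha> = Poly_Mapping.single b 1 then c \<alpha> else 0)"
  proof (rule sum.cong[OF refl])
    fix \<alpha> assume \<alpha>: "\<alpha> \<in> expo (Basis :: 'a set) D"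
    show "c \<alpha> * (if monomial_degree \<alpha> = 1 then mon \<alpha> b else 0) = (if \<alpha> = Poly_Mapping.single b 1 then c \<alpha> else 0)"
    proof (cases "monomial_degree \<alpha> = 1")
      case True
      then obtain v where v: "v \<in> Poly_Mapping.keys \<alpha>" "\<alpha> = Poly_Mapping.single v 1" by (rule degree_1_single)
      then have "v \<in> Basis" using \<alpha> by (auto simp: expo_def)
      moreover have "Poly_Mapping.single v (1::nat) = Poly_Mapping.single b 1 \<longleftrightarrow> v = b"
        by (metis lookup_single_eq lookup_single_not_eq zero_neq_one)
      ultimately show ?thesis using True assms(3) by (auto simp: v mon_single inner_Basis)
    qed auto
  qed
  also have "\<dots> = c (Poly_Mapping.single b 1)"
    using assms(3,4) by (subst sum.delta) (auto simp: finite_expo single_in_expo)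
  finally show ?thesis .
qed

text \<open>
  The remainder \<open>s\<close> does not depend on the coordinate in the direction \<open>b\<close>, as in the Weierstrass
  division theorem.
\<close>

definition divisible_mod ::
    "nat \<Rightarrow> 'a::euclidean_space \<Rightarrow> ('a \<Rightarrow> real) \<Rightarrow> ('a \<Rightarrow> real) \<Rightarrow> bool" where
  "divisible_mod k b \<rho> f \<longleftrightarrow> (\<exists>g s. is_poly (k - 1) g \<and>
     (\<forall>x t. s (x + t *\<^sub>R b) = s x) \<and> vanishes (Suc k) (\<lambda>x. f x - g x * \<rho> x - s x))"

lemma divisible_mod_add:
  assumes "divisible_mod k b \<rho> f" "divisible_mod k b \<rho> h"
  shows "divisible_mod k b \<rho> (\<lambda>x. f x + h x)"
proof -
  obtain g s where g: "is_poly (k - 1) g" "\<And>x t. s (x + t *\<^sub>R b) = s x"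
    "vanishes (Suc k) (\<lambda>x. f x - g x * \<rho> x - s x)"
    using assms(1) unfolding divisible_mod_def by blast
  obtain g' s' where g': "is_poly (k - 1) g'" "\<And>x t. s' (x + t *\<^sub>R b) = s' x"
    "vanishes (Suc k) (\<lambda>x. h x - g' x * \<rho> x - s' x)"
    using assms(2) unfolding divisible_mod_def by blast
  have "vanishes (Suc k) (\<lambda>x. f x + h x - (g x + g' x) * \<rho> x - (s x + s' x))"
    using vanishes_add[OF g(3) g'(3)] by (simp add: algebra_simps)
  with param_poly_add[OF g(1) g'(1)] g(2) g'(2) show ?thesis
    unfolding divisible_mod_def
    by (intro exI[of _ "\<lambda>x. g x + g' x"] exI[of _ "\<lambda>x. s x + s' x"]) auto
qed

lemma divisible_mod_cmult:
  assumes "divisible_mod k b \<rho> f"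
  shows "divisible_mod k b \<rho> (\<lambda>x. c * f x)"
proof -
  obtain g s where g: "is_poly (k - 1) g" "\<And>x t. s (x + t *\<^sub>R b) = s x"
    "vanishes (Suc k) (\<lambda>x. f x - g x * \<rho> x - s x)"
    using assms(1) unfolding divisible_mod_def by blast
  have "vanishes (Suc k) (\<lambda>x. c * f x - (c * g x) * \<rho> x - c * s x)"
    using vanishes_cmult[OF g(3), of c] by (simp add: algebra_simps)
  with param_poly_cmult[OF polyfn.const g(1)] g(2) show ?thesis
    unfolding divisible_mod_def
    by (intro exI[of _ "\<lambda>x. c * g x"] exI[of _ "\<lambda>x. c * s x"]) auto
qed

lemma divisible_mod_0: "divisible_mod k b \<rho> (\<lambda>_. 0)"
  unfolding divisible_mod_def
  by (intro exI[of _ "\<lambda>_. 0"]) (auto intro: param_poly_coeff polyfn.const)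

lemma divisible_mod_sum:
  "(\<And>i. i \<in> I \<Longrightarrow> divisible_mod k b \<rho> (f i)) \<Longrightarrow> divisible_mod k b \<rho> (\<lambda>x. \<Sum>i\<in>I. f i x)"
  by (induction I rule: infinite_finite_induct) (auto intro: divisible_mod_add divisible_mod_0)

text \<open>With \<open>\<alpha> = \<beta> + single b 1\<close>, the linear term of
  \<open>\<rho>\<close> in direction \<open>b\<close> expresses \<open>mon \<alpha>\<close> through
  \<open>mon \<beta> * \<rho>\<close> and monomials with exponents
  \<open>\<gamma> + \<beta>\<close>. If \<open>\<gamma>\<close> has degree at least 2, the total
  degree rises; if it has degree 1, it is another variable, and the exponent of \<open>b\<close>
  drops at equal total degree. So the lexicographic measure decreases, and monomials of degree above
  \<open>k\<close> count as zero.\<close>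

lemma divisible_mod_mon:
  fixes c :: "('a::euclidean_space \<Rightarrow>\<^sub>0 nat) \<Rightarrow> real"
  assumes \<rho>: "\<And>x. \<rho> x = (\<Sum>\<alpha>\<in>expo Basis D. c \<alpha> * mon \<alpha> x)" and b: "b \<in> Basis"
    and c: "c 0 = 0" "c (Poly_Mapping.single b 1) \<noteq> 0" and D: "1 \<le> D"
  shows "Poly_Mapping.keys \<alpha> \<subseteq> Basis \<Longrightarrow> divisible_mod k b \<rho> (mon \<alpha>)"
proof (induction \<alpha> rule: wf_induct[OF wf_measures[of "[\<lambda>\<alpha>. Suc k - monomial_degree \<alpha>, \<lambda>\<alpha>. Poly_Mapping.lookup \<alpha> b]"]])
  case (1 \<alpha>)
  have IH: "divisible_mod k b \<rho> (mon \<beta>)"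
    if "Suc k - monomial_degree \<beta> < Suc k - monomial_degree \<alpha> \<or>
        Suc k - monomial_degree \<beta> = Suc k - monomial_degree \<alpha> \<and> Poly_Mapping.lookup \<beta> b < Poly_Mapping.lookup \<alpha> b"
      "Poly_Mapping.keys \<beta> \<subseteq> Basis" for \<beta>
    using 1(1) that by auto
  have \<alpha>: "\<alpha> \<in> expo Basis (monomial_degree \<alpha>)" using 1(2) by (simp add: expo_def)
  consider "monomial_degree \<alpha> > k" | "Poly_Mapping.lookup \<alpha> b = 0"
    | "monomial_degree \<alpha> \<le> k" "Poly_Mapping.lookup \<alpha> b > 0" by linarith
  then show ?case
  proof cases
    case 1
    then show ?thesis unfolding divisible_mod_def
      by (intro exI[of _ "\<lambda>_. 0"])
        (auto intro: param_poly_coeff polyfn.const vanishes_mono[OF vanishes_mon[OF \<alpha>]])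
  next
    case 2
    have "mon \<alpha> (x + t *\<^sub>R b) = mon \<alpha> x" for x t
    proof -
      have "((x + t *\<^sub>R b) \<bullet> b') ^ Poly_Mapping.lookup \<alpha> b' = (x \<bullet> b') ^ Poly_Mapping.lookup \<alpha> b'"
        if "b' \<in> Basis" for b'
        using 2 that b by (cases "b' = b") (auto simp: inner_add_left inner_Basis)
      then show ?thesis unfolding mon_Basis[OF \<alpha>] by (intro prod.cong) auto
    qed
    then show ?thesis unfolding divisible_mod_def
      by (intro exI[of _ "\<lambda>_. 0"] exI[of _ "mon \<alpha>"])
        (auto intro: param_poly_coeff polyfn.const)
  next
    case 3
    let ?e = "Poly_Mapping.single b (1::nat)"
    define \<beta> where "\<beta> = \<alpha> - ?e"
    have eq: "\<alpha> = \<beta> + ?e" unfolding \<beta>_def by (rule minus_single_add) (use 3 in auto)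
    have deg: "monomial_degree \<alpha> = monomial_degree \<beta> + 1" by (simp add: eq monomial_degree_add)
    have keys\<beta>: "Poly_Mapping.keys \<beta> \<subseteq> Basis" using 1(2) unfolding eq keys_add_nat by blast
    \<comment> \<open>The degree bound of the quotient: one variable has been split off from a
      monomial of degree at most \<open>k\<close>.\<close>
    have \<beta>k: "\<beta> \<in> expo Basis (k - 1)" using keys\<beta> deg 3 by (auto simp: expo_def)
    let ?G = "expo Basis D - {?e} :: ('a \<Rightarrow>\<^sub>0 nat) set"
    have eE: "?e \<in> expo Basis D" using b D by (simp add: expo_def)
    have \<rho>': "\<rho> x = c ?e * (x \<bullet> b) + (\<Sum>\<gamma>\<in>?G. c \<gamma> * mon \<gamma> x)" for x
      unfolding \<rho> by (subst sum.remove[OF _ eE]) (auto simp: finite_expo mon_single)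
    have "divisible_mod k b \<rho> (\<lambda>x. mon \<beta> x * \<rho> x)"
      unfolding divisible_mod_def using param_poly_mon[OF \<beta>k]
      by (intro exI[of _ "mon \<beta>"] exI[of _ "\<lambda>_. 0"]) auto
    moreover have "divisible_mod k b \<rho> (\<lambda>x. c \<gamma> * mon (\<gamma> + \<beta>) x)" if \<gamma>: "\<gamma> \<in> ?G" for \<gamma>
    proof (cases "\<gamma> = 0")
      case True
      then show ?thesis using c(1) divisible_mod_0 by simp
    next
      case False
      then have "monomial_degree \<gamma> \<noteq> 0" by (simp add: monomial_degree_eq_0)
      then consider "monomial_degree \<gamma> = 1" | "monomial_degree \<gamma> \<ge> 2" by linarith
      then have "Suc k - monomial_degree (\<gamma> + \<beta>) < Suc k - monomial_degree \<alpha> \<or>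
          Suc k - monomial_degree (\<gamma> + \<beta>) = Suc k - monomial_degree \<alpha> \<and>
          Poly_Mapping.lookup (\<gamma> + \<beta>) b < Poly_Mapping.lookup \<alpha> b"
      proof cases
        case 1
        then have "b \<notin> Poly_Mapping.keys \<gamma>" using degree_1_eq_single \<gamma> by fastforce
        then have "Poly_Mapping.lookup \<gamma> b = 0" by (simp add: in_keys_iff)
        then show ?thesis using 1 by (simp add: monomial_degree_add deg lookup_add eq)
      next
        case 2
        then have "Suc k - monomial_degree (\<gamma> + \<beta>) < Suc k - monomial_degree \<alpha>"
          using 3(1) unfolding monomial_degree_add deg by linarith
        then show ?thesis ..
      qed
      moreover have "Poly_Mapping.keys (\<gamma> + \<beta>) \<subseteq> Basis"
        using \<gamma> keys\<beta> by (auto simp: keys_add_nat expo_def)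
      ultimately show ?thesis by (intro divisible_mod_cmult IH)
    qed
    ultimately have "divisible_mod k b \<rho> (\<lambda>x. 1 / c ?e * (mon \<beta> x * \<rho> x + - 1 * (\<Sum>\<gamma>\<in>?G. c \<gamma> * mon (\<gamma> + \<beta>) x)))"
      by - (rule divisible_mod_cmult, rule divisible_mod_add, assumption,
          rule divisible_mod_cmult, rule divisible_mod_sum)
    moreover have "1 / c ?e * (mon \<beta> x * \<rho> x + - 1 * (\<Sum>\<gamma>\<in>?G. c \<gamma> * mon (\<gamma> + \<beta>) x)) = mon \<alpha> x" for x
    proof -
      have "(\<Sum>\<gamma>\<in>?G. c \<gamma> * mon (\<gamma> + \<beta>) x) = mon \<beta> x * (\<Sum>\<gamma>\<in>?G. c \<gamma> * mon \<gamma> x)"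
        by (simp add: sum_distrib_left mon_add mult_ac)
      then show ?thesis using c(2) by (simp add: \<rho>' eq mon_add mon_single distrib_left)
    qed
    ultimately show ?thesis by simp
  qed
qed

text \<open>
  This replaces the implicit function theorem: the intermediate value theorem along lines parallel
  to \<open>b\<close> gives a zero over every small point of the hyperplane, at comparable distance from \<open>0\<close>.
\<close>

lemma zeros_over_hyperplane:
  fixes f :: "'a::euclidean_space \<Rightarrow> real"
  assumes f: "(f has_derivative L) (at 0)" "f 0 = 0" "continuous_on UNIV f" and b: "norm b = 1" "L b \<noteq> 0"
  obtains C d where "C \<ge> 0" "d > 0"
    "\<And>x. norm x < d \<Longrightarrow> \<exists>t. norm (x + t *\<^sub>R b) \<le> C * norm x \<and> f (x + t *\<^sub>R b) = 0"
proof -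
  interpret L: bounded_linear L using f(1) by (rule has_derivative_bounded_linear)
  obtain K where K: "K > 0" "\<And>x. norm (L x) \<le> norm x * K" using L.pos_bounded by blast
  \<comment> \<open>A step of length \<open>T * norm x\<close> along \<open>b\<close> changes
    \<open>L\<close> by \<open>(K + 1) * norm x\<close>, which exceeds \<open>L x\<close> by at
    least \<open>norm x\<close>: the linear part takes opposite signs at the two ends of the
    segment.\<close>
  define T where "T = (K + 1) / L b"
  define C where "C = 1 + \<bar>T\<bar>"
  have C: "C \<ge> 1" by (simp add: C_def)
  \<comment> \<open>On points of norm at most \<open>C * norm x\<close> this error is at most
    \<open>norm x / 2\<close>, too small to spoil the signs at the ends.\<close>
  obtain d where d: "d > 0" "\<And>y. norm y < d \<Longrightarrow> norm (f y - L y) \<le> 1 / (2 * C) * norm y"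
    using f(1) C unfolding has_derivative_at_alt f(2) by (auto dest!: spec[of _ "1 / (2 * C)"])
  have "\<exists>t. norm (x + t *\<^sub>R b) \<le> C * norm x \<and> f (x + t *\<^sub>R b) = 0" if x: "norm x < d / C" for x
  proof (cases "x = 0")
    case True
    then show ?thesis using f(2) by (intro exI[of _ 0]) simp
  next
    case False
    define n where "n = norm x"
    have n: "n > 0" using False by (simp add: n_def)
    define y where "y s = x + (s * (T * n)) *\<^sub>R b" for s
    have ny: "norm (y s) \<le> C * n" if "\<bar>s\<bar> \<le> 1" for s
    proof -
      have "norm (y s) \<le> n + \<bar>s\<bar> * (\<bar>T\<bar> * n)"
        unfolding y_def using norm_triangle_ineq[of x "(s * (T * n)) *\<^sub>R b"] n b
        by (simp add: n_def abs_mult)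
      also have "\<bar>s\<bar> * (\<bar>T\<bar> * n) \<le> 1 * (\<bar>T\<bar> * n)"
        by (rule mult_right_mono) (use that n in auto)
      finally show ?thesis by (simp add: C_def algebra_simps)
    qed
    have Ly: "L (y s) = L x + s * ((K + 1) * n)" for s
      using b by (simp add: y_def L.add L.scaleR T_def)
    have err: "\<bar>f (y s) - L (y s)\<bar> \<le> n / 2" if "\<bar>s\<bar> \<le> 1" for s
    proof -
      have "C * n < d" using x C by (simp add: n_def pos_less_divide_eq mult.commute)
      then have "norm (f (y s) - L (y s)) \<le> 1 / (2 * C) * norm (y s)"
        using d(2) ny[OF that] by simp
      also have "\<dots> \<le> 1 / (2 * C) * (C * n)"
        by (rule mult_left_mono[OF ny[OF that]]) (use C in auto)
      finally show ?thesis using C by simp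
    qed
    have Lx: "\<bar>L x\<bar> \<le> K * n" using K(2)[of x] by (simp add: n_def mult.commute)
    have "\<bar>f (y (- 1)) - (L x - (K * n + n))\<bar> \<le> n / 2" "\<bar>f (y 1) - (L x + (K * n + n))\<bar> \<le> n / 2"
      using err[of "-1"] err[of 1] unfolding Ly by (simp_all add: algebra_simps)
    then have "f (y (- 1)) \<le> 0" "0 \<le> f (y 1)" using Lx n by linarith+
    moreover have "continuous_on {-1..1} (\<lambda>s. f (y s))"
      unfolding y_def by (intro continuous_on_compose2[OF f(3)] continuous_intros) auto
    ultimately obtain s where "-1 \<le> s" "s \<le> 1" "f (y s) = 0"
      using IVT'[of "\<lambda>s. f (y s)" "-1" 0 1] by auto
    then show ?thesis using ny[of s]
      by (intro exI[of _ "s * (T * n)"]) (auto simp: y_def n_def)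
  qed
  then show ?thesis using that[of C "d / C"] C d(1) by simp
qed

text \<open>
  The remainder of \<open>f\<close> vanishes to order \<open>k + 1\<close> on the zeros of \<open>f\<close>, and these project onto a
  neighbourhood of \<open>0\<close> in the hyperplane on which the remainder lives.
\<close>

lemma exists_factor:
  fixes f r \<rho> :: "'a::euclidean_space \<Rightarrow> real"
  assumes k: "1 \<le> k" and f: "is_poly k f" "f 0 = 0" "(f has_derivative L) (at 0)" "L \<noteq> (\<lambda>_. 0)"
    and r: "(r has_derivative l) (at 0)" "l v \<noteq> 0"
    and zero: "\<delta> > 0" "\<And>x. norm x < \<delta> \<Longrightarrow> f x = 0 \<Longrightarrow> r x = 0"
    and \<rho>: "is_poly D \<rho>" "vanishes (Suc k) (\<lambda>x. r x - \<rho> x)"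
  obtains g where "is_poly (k - 1) g" "vanishes (Suc k) (\<lambda>x. f x - g x * \<rho> x)"
proof -
  interpret L: bounded_linear L using f(3) by (rule has_derivative_bounded_linear)
  interpret l: bounded_linear l using r(1) by (rule has_derivative_bounded_linear)
  have "\<exists>b\<in>Basis. L b \<noteq> 0"
  proof (rule ccontr)
    assume "\<not> ?thesis"
    then have "L x = 0" for x
      using euclidean_representation[of x] L.sum[of "\<lambda>b. (x \<bullet> b) *\<^sub>R b" Basis] by (simp add: L.scaleR)
    then show False using f(4) by auto
  qed
  then obtain b where b: "b \<in> Basis" "L b \<noteq> 0" by blast
  obtain C d where C: "C \<ge> 0" "d > 0"
    "\<And>x. norm x < d \<Longrightarrow> \<exists>t. norm (x + t *\<^sub>R b) \<le> C * norm x \<and> f (x + t *\<^sub>R b) = 0"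
    using zeros_over_hyperplane[OF f(3,2) is_poly_continuous_on[OF f(1)] _ b(2)] b(1) by auto
  have r0: "r 0 = 0" using zero f(2) by simp
  \<comment> \<open>The direction \<open>b\<close> chosen for \<open>L\<close> also works for
    \<open>l\<close>. Otherwise \<open>l\<close> is nonzero at some \<open>w\<close> orthogonal to
    \<open>b\<close>. Over \<open>s *\<^sub>R w\<close> there is a zero of \<open>f\<close>, hence
    of \<open>r\<close>, at distance comparable to \<open>s\<close>, where \<open>l\<close> has the
    value \<open>s * l w\<close>; but \<open>l\<close> approximates \<open>r\<close> to a smaller
    order.\<close>
  have lb: "l b \<noteq> 0"
  proof
    assume "l b = 0"
    define w where "w = v - (v \<bullet> b) *\<^sub>R b"
    have lw: "l w \<noteq> 0" using r(2) \<open>l b = 0\<close> by (simp add: w_def l.diff l.scaleR)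
    then have w: "norm w > 0" using l.zero by auto
    \<comment> \<open>Half the value at which the final estimate could hold: the zero over
      \<open>s *\<^sub>R w\<close> has norm at most \<open>(C + 1) * (s * norm w)\<close>.\<close>
    define e where "e = \<bar>l w\<bar> / (2 * (C + 1) * norm w)"
    have e: "e > 0" using lw w C(1) by (simp add: e_def)
    obtain d' where d': "d' > 0" "\<And>y. norm y < d' \<Longrightarrow> norm (r y - l y) \<le> e * norm y"
      using r(1) e unfolding has_derivative_at_alt r0 by auto
    define D where "D = min d (min d' \<delta> / (C + 1))"
    have D: "D > 0" using C d' zero by (simp add: D_def)
    define s where "s = D / (2 * norm w)"
    have s: "s > 0" "s * norm w < D" using D w by (auto simp: s_def)
    then obtain t where t: "norm (s *\<^sub>R w + t *\<^sub>R b) \<le> C * (s * norm w)" "f (s *\<^sub>R w + t *\<^sub>R b) = 0"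
      using C(3)[of "s *\<^sub>R w"] by (auto simp: D_def)
    let ?y = "s *\<^sub>R w + t *\<^sub>R b"
    have "norm ?y \<le> (C + 1) * (s * norm w)"
      using t(1) s w by (simp add: distrib_right add_increasing2)
    also have "\<dots> < min d' \<delta>"
    proof -
      have "s * norm w < min d' \<delta> / (C + 1)" using s(2) by (simp add: D_def)
      then show ?thesis using C(1) by (simp add: pos_less_divide_eq mult.commute add_nonneg_pos)
    qed
    finally have ny: "norm ?y < d'" "norm ?y < \<delta>" by auto
    then have "r ?y = 0" using zero t(2) by blast
    then have "\<bar>l ?y\<bar> \<le> e * norm ?y" using d'(2)[OF ny(1)] by simp
    moreover have "l ?y = s * l w" using \<open>l b = 0\<close> by (simp add: l.add l.scaleR)
    ultimately have "s * \<bar>l w\<bar> \<le> e * norm ?y" using s by (simp add: abs_mult)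
    also have "\<dots> \<le> e * ((C + 1) * (s * norm w))"
      by (rule mult_left_mono) (use e t(1) s w in \<open>auto simp: distrib_right add_increasing2\<close>)
    also have "\<dots> = s * (e * (2 * (C + 1) * norm w)) / 2" by simp
    also have "e * (2 * (C + 1) * norm w) = \<bar>l w\<bar>"
      unfolding e_def by (rule nonzero_eq_divide_eq[THEN iffD1, OF _ refl]) (use w C(1) in auto)
    finally show False using s lw by simp
  qed
  \<comment> \<open>The degree is raised by one so that the linear exponents are among those summed
    over even if \<open>D = 0\<close>.\<close>
  have \<rho>D: "is_poly (Suc D) \<rho>" using param_poly_mono[OF \<rho>(1)] by simp
  obtain c where c: "\<And>x. \<rho> x = (\<Sum>\<alpha>\<in>expo Basis (Suc D). c \<alpha> * mon \<alpha> x)"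
    using \<rho>D by (rule is_polyE) blast
  have \<rho>0: "\<rho> 0 = 0" using vanishes_at_0[OF \<rho>(2)] r0 by simp
  have "((\<lambda>x. r x - (r x - \<rho> x)) has_derivative (\<lambda>h. l h - 0)) (at 0)"
    by (intro has_derivative_diff r vanishes_2_has_derivative vanishes_mono[OF \<rho>(2)]) (use k in auto)
  then have "(\<rho> has_derivative l) (at 0)" by simp
  then have cb: "c (Poly_Mapping.single b 1) \<noteq> 0"
    using linear_coefficient_eq_derivative[OF c _ b(1)] lb by simp
  have c0: "c 0 = 0"
  proof -
    have "mon \<alpha> (0::'a) = (if \<alpha> = 0 then 1 else 0)" if "\<alpha> \<in> expo Basis (Suc D)" for \<alpha>
      using mon_scaleR[of \<alpha> 0 "0::'a"] by (auto simp: monomial_degree_eq_0 power_0_left)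
    then have "\<rho> 0 = (\<Sum>\<alpha>\<in>expo (Basis :: 'a set) (Suc D). if \<alpha> = 0 then c \<alpha> else 0)"
      unfolding c by (intro sum.cong) auto
    then show ?thesis using \<rho>0 by (simp add: sum.delta finite_expo zero_in_expo)
  qed
  obtain a where a: "\<And>x. f x = (\<Sum>\<alpha>\<in>expo Basis k. a \<alpha> * mon \<alpha> x)"
    using f(1) by (rule is_polyE) blast
  have "divisible_mod k b \<rho> (\<lambda>x. \<Sum>\<alpha>\<in>expo Basis k. a \<alpha> * mon \<alpha> x)"
    by (intro divisible_mod_sum divisible_mod_cmult divisible_mod_mon[OF c b(1) c0 cb])
      (auto simp: expo_def)
  then have "divisible_mod k b \<rho> f" by (simp add: a[symmetric])
  then obtain g s where g: "is_poly (k - 1) g" and s: "\<And>x t. s (x + t *\<^sub>R b) = s x"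
    and van: "vanishes (Suc k) (\<lambda>x. f x - g x * \<rho> x - s x)"
    unfolding divisible_mod_def by blast
  have "vanishes (0 + Suc k) (\<lambda>x. g x * (r x - \<rho> x))"
    by (rule vanishes_mult[OF is_poly_vanishes_0[OF g] \<rho>(2)])
  \<comment> \<open>This combination equals \<open>g x * r x - f x + s x\<close>, hence
    \<open>s x\<close> wherever \<open>f\<close> and \<open>r\<close> vanish.\<close>
  then have "vanishes (Suc k) (\<lambda>x. g x * (r x - \<rho> x) - (f x - g x * \<rho> x - s x))"
    using vanishes_diff[OF _ van] by simp
  then obtain C' d' where C': "C' \<ge> 0" "d' > 0"
    "\<And>x. norm x < d' \<Longrightarrow> norm (g x * (r x - \<rho> x) - (f x - g x * \<rho> x - s x)) \<le> C' * norm x ^ Suc k"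
    by (rule vanishesE) blast
  have "vanishes (Suc k) s"
  proof (rule vanishesI[of "min d (min d' \<delta> / (C + 1))" _ "C' * C ^ Suc k"])
    show "min d (min d' \<delta> / (C + 1)) > 0" using C C' zero by simp
    fix x :: 'a assume x: "norm x < min d (min d' \<delta> / (C + 1))"
    then obtain t where t: "norm (x + t *\<^sub>R b) \<le> C * norm x" "f (x + t *\<^sub>R b) = 0"
      using C(3)[of x] by auto
    let ?y = "x + t *\<^sub>R b"
    have "norm x * (C + 1) < min d' \<delta>" using x C(1) by (simp add: pos_less_divide_eq add_nonneg_pos)
    moreover have "C * norm x \<le> norm x * (C + 1)" by (simp add: algebra_simps)
    ultimately have "norm ?y < min d' \<delta>" using t(1) by linarith
    then have ny: "norm ?y < d'" "norm ?y < \<delta>" by simp_all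
    then have "r ?y = 0" using zero t(2) by blast
    then have "norm (s x) \<le> C' * norm ?y ^ Suc k"
      using C'(3)[OF ny(1)] t(2) s[of x t] by (simp add: algebra_simps)
    also have "\<dots> \<le> C' * (C * norm x) ^ Suc k"
      by (intro mult_left_mono power_mono t C') auto
    finally show "norm (s x) \<le> C' * C ^ Suc k * norm x ^ Suc k" by (simp add: power_mult_distrib mult_ac)
  qed
  then have "vanishes (Suc k) (\<lambda>x. (f x - g x * \<rho> x - s x) + s x)" by (rule vanishes_add[OF van])
  then show ?thesis using that[OF g] by simp
qed

section \<open>Taylor polynomials of holomorphic functions of several variables\<close>

definition pd :: "'k::finite \<Rightarrow> (complex ^ 'k \<Rightarrow> complex) \<Rightarrow> complex ^ 'k \<Rightarrow> complex" where
  "pd i f z = frechet_derivative f (at z) (axis i 1)"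

definition holo_on :: "(complex ^ 'k::finite \<Rightarrow> complex) \<Rightarrow> (complex ^ 'k) set \<Rightarrow> bool" where
  "holo_on f U \<longleftrightarrow> open U \<and> (\<forall>z\<in>U. (f has_derivative (\<lambda>h. \<Sum>i\<in>UNIV. pd i f z * h $ i)) (at z))"

lemma pd_eq:
  assumes "(f has_derivative (\<lambda>h. \<Sum>i\<in>UNIV. a i * h $ i)) (at z)"
  shows "pd i f z = a i"
proof -
  have "frechet_derivative f (at z) = (\<lambda>h. \<Sum>i\<in>UNIV. a i * h $ i)"
    using frechet_derivative_at[OF assms] by simp
  then have "pd i f z = (\<Sum>j\<in>UNIV. a j * axis i 1 $ j)" by (simp add: pd_def)
  also have "\<dots> = (\<Sum>j\<in>UNIV. if j = i then a j else 0)" by (rule sum.cong) (auto simp: axis_def)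
  finally show ?thesis by (simp add: sum.delta)
qed

lemma holo_onI:
  assumes "open U" "\<And>z. z \<in> U \<Longrightarrow> \<exists>a. (f has_derivative (\<lambda>h. \<Sum>i\<in>UNIV. a i * h $ i)) (at z)"
  shows "holo_on f U"
  unfolding holo_on_def
proof (intro conjI ballI)
  fix z assume "z \<in> U"
  then obtain a where a: "(f has_derivative (\<lambda>h. \<Sum>i\<in>UNIV. a i * h $ i)) (at z)" using assms(2) by blast
  then show "(f has_derivative (\<lambda>h. \<Sum>i\<in>UNIV. pd i f z * h $ i)) (at z)"
    by (simp add: pd_eq[OF a])
qed (rule assms)

lemma holo_on_has_derivative:
  "holo_on f U \<Longrightarrow> z \<in> U \<Longrightarrow> (f has_derivative (\<lambda>h. \<Sum>i\<in>UNIV. pd i f z * h $ i)) (at z)"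
  by (simp add: holo_on_def)

lemma holo_on_continuous_on:
  assumes "holo_on f U" shows "continuous_on U f"
  using holo_on_has_derivative[OF assms]
  by (meson continuous_at_imp_continuous_on has_derivative_continuous)

lemma bounded_linear_axis: "bounded_linear (axis i :: complex \<Rightarrow> complex ^ 'k::finite)"
  by (intro linear_conv_bounded_linear[THEN iffD1] linearI) (auto simp: vec_eq_iff axis_def)

lemma has_derivative_axis:
  "((\<lambda>\<zeta>. z + axis i \<zeta>) has_derivative (axis i :: complex \<Rightarrow> complex ^ 'k::finite)) (at w)"
  using has_derivative_add[OF has_derivative_const bounded_linear_imp_has_derivative[OF bounded_linear_axis]]
  by simp

text \<open>Freezing all variables but one gives access to the one-variable theory, in particular to
  Cauchy's formula.\<close>

lemma holo_on_slice:
  assumes "holo_on f U" "z + axis i \<zeta> \<in> U"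
  shows "((\<lambda>\<zeta>. f (z + axis i \<zeta>)) has_field_derivative pd i f (z + axis i \<zeta>)) (at \<zeta>)"
proof -
  have "((\<lambda>\<zeta>. f (z + axis i \<zeta>)) has_derivative
      (\<lambda>h. \<Sum>j\<in>UNIV. pd j f (z + axis i \<zeta>) * axis i h $ j)) (at \<zeta>)"
    by (rule has_derivative_compose[OF has_derivative_axis holo_on_has_derivative[OF assms]])
  moreover have "(\<Sum>j\<in>UNIV. pd j f (z + axis i \<zeta>) * axis i h $ j) = pd i f (z + axis i \<zeta>) * h" for h
  proof -
    have "(\<Sum>j\<in>UNIV. pd j f (z + axis i \<zeta>) * axis i h $ j)
        = (\<Sum>j\<in>UNIV. if j = i then pd j f (z + axis i \<zeta>) * h else 0)"
      by (rule sum.cong) (auto simp: axis_def)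
    then show ?thesis by (simp add: sum.delta)
  qed
  ultimately show ?thesis by (simp add: has_field_derivative_def)
qed

text \<open>The points of \<open>circlepath 0 r\<close> written out, so that contour integrals
  become ordinary integrals over the unit interval.\<close>

definition circ :: "real \<Rightarrow> real \<Rightarrow> complex" where
  "circ r x = of_real r * exp (2 * of_real pi * \<i> * of_real x)"

lemma norm_circ: "r > 0 \<Longrightarrow> norm (circ r x) = r"
  unfolding circ_def by (simp add: norm_mult)

lemma norm_axis: "norm (axis i \<zeta> :: complex ^ 'k::finite) = norm \<zeta>"
proof -
  have "(\<Sum>j\<in>UNIV. (norm ((axis i \<zeta> :: complex ^ 'k) $ j))\<^sup>2) = (\<Sum>j\<in>UNIV. if j = i then (norm \<zeta>)\<^sup>2 else 0)"
    by (rule sum.cong) (auto simp: axis_def)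
  then show ?thesis by (simp add: norm_vec_def L2_set_def)
qed

text \<open>Cauchy's formula for the first derivative on a circle in the \<open>i\<close>-th
  coordinate: for \<open>u = circ r x\<close>, the form \<open>du / u^2\<close> is
  \<open>dx / u\<close> up to the constant \<open>2 * pi * \<i>\<close>. The integrand contains no
  derivative of \<open>f\<close>, so regularity of \<open>f\<close> passes to
  \<open>pd i f\<close>.\<close>

lemma pd_integral:
  assumes f: "holo_on f U" and r: "r > 0" and sub: "cball z r \<subseteq> U"
  shows "((\<lambda>x. f (z + axis i (circ r x)) / circ r x) has_integral pd i f z) (cbox 0 1)"
proof -
  let ?\<phi> = "\<lambda>\<zeta>. f (z + axis i \<zeta>)"
  have inU: "z + axis i \<zeta> \<in> U" if "\<zeta> \<in> cball 0 r" for \<zeta>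
    using that subsetD[OF sub, of "z + axis i \<zeta>"] by (simp add: dist_norm norm_axis)
  have d: "(?\<phi> has_field_derivative pd i f (z + axis i \<zeta>)) (at \<zeta>)" if "\<zeta> \<in> cball 0 r" for \<zeta>
    by (rule holo_on_slice[OF f inU[OF that]])
  have cont: "continuous_on (cball 0 r) ?\<phi>"
    using d by (meson DERIV_isCont continuous_at_imp_continuous_on)
  have hol: "?\<phi> holomorphic_on ball 0 r"
    unfolding holomorphic_on_def field_differentiable_def
    using d has_field_derivative_at_within by (metis ball_subset_cball subsetD)
  have "deriv ?\<phi> 0 = pd i f z"
    using DERIV_imp_deriv[OF d[of 0]] r by (simp add: axis_def vec_eq_iff zero_vec_def[symmetric])
  moreover have "((\<lambda>u. ?\<phi> u / (u - 0) ^ Suc (Suc 0)) has_contour_integral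
      ((2 * pi * \<i>) / fact (Suc 0) * (deriv ^^ Suc 0) ?\<phi> 0)) (circlepath 0 r)"
    by (rule Cauchy_has_contour_integral_higher_derivative_circlepath[OF cont hol]) (use r in simp)
  ultimately have "((\<lambda>u. ?\<phi> u / u ^ Suc (Suc 0)) has_contour_integral (2 * pi * \<i>) * pd i f z) (circlepath 0 r)"
    by simp
  then have "((\<lambda>x. ?\<phi> (circ r x) / circ r x ^ Suc (Suc 0) * (2 * pi * \<i> * circ r x)) has_integral (2 * pi * \<i>) * pd i f z) {0..1}"
    unfolding has_contour_integral_def
  proof (rule has_integral_eq[rotated])
    fix x :: real assume "x \<in> {0..1}"
    then have "vector_derivative (circlepath 0 r) (at x within {0..1}) = 2 * pi * \<i> * circ r x"
      by (simp add: vector_derivative_circlepath01 circ_def)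
    moreover have "circlepath 0 r x = circ r x" by (simp add: circlepath circ_def)
    ultimately show "?\<phi> (circlepath 0 r x) / circlepath 0 r x ^ Suc (Suc 0) * vector_derivative (circlepath 0 r) (at x within {0..1})
        = ?\<phi> (circ r x) / circ r x ^ Suc (Suc 0) * (2 * pi * \<i> * circ r x)" by simp
  qed
  then have "((\<lambda>x. (1 / (2 * pi * \<i>)) * (?\<phi> (circ r x) / circ r x ^ Suc (Suc 0) * (2 * pi * \<i> * circ r x)))
      has_integral (1 / (2 * pi * \<i>)) * ((2 * pi * \<i>) * pd i f z)) {0..1}"
    by (rule has_integral_mult_right)
  moreover have "(1 / (2 * pi * \<i>)) * (?\<phi> (circ r x) / circ r x ^ Suc (Suc 0) * (2 * pi * \<i> * circ r x))
      = ?\<phi> (circ r x) / circ r x" for x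
    using norm_circ[OF r, of x] r by (auto simp: field_simps)
  ultimately show ?thesis by simp
qed

lemma continuous_on_circ: "continuous_on S (circ r)"
  unfolding circ_def[abs_def] by (intro continuous_intros)

lemma circ_nonzero: "r > 0 \<Longrightarrow> circ r x \<noteq> 0"
  using norm_circ[of r x] by auto

lemma continuous_on_axis:
  "continuous_on S g \<Longrightarrow> continuous_on S (\<lambda>x. axis i (g x :: complex) :: complex ^ 'k::finite)"
  by (rule bounded_linear.continuous_on[OF bounded_linear_axis])

lemma shifted_in_cball:
  assumes "z \<in> ball z0 r" "r > 0" "cball z0 (2 * r) \<subseteq> U"
  shows "cball z r \<subseteq> U" "z + axis i (circ r x) \<in> U"
proof -
  show *: "cball z r \<subseteq> U"
  proof
    fix w assume "w \<in> cball z r"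
    then have "dist z0 w \<le> 2 * r" using dist_triangle[of z0 w z] assms(1) by simp
    then show "w \<in> U" using assms(3) by auto
  qed
  have "z + axis i (circ r x) \<in> cball z r" using norm_circ[OF assms(2)] by (simp add: dist_norm norm_axis)
  then show "z + axis i (circ r x) \<in> U" using * by blast
qed

lemma continuous_on_shifted:
  assumes g: "continuous_on U g" and r: "r > 0" and sub: "cball z0 (2 * r) \<subseteq> U"
  shows "continuous_on (ball z0 r \<times> cbox 0 1) (\<lambda>(z, x). g (z + axis i (circ r x)) / circ r x :: complex)"
proof -
  have "continuous_on (ball z0 r \<times> cbox 0 1) (\<lambda>y. g (fst y + axis i (circ r (snd y))) / circ r (snd y))"
    by (intro continuous_intros continuous_on_compose2[OF g] continuous_on_axis
        continuous_on_compose2[OF continuous_on_circ[of UNIV]])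
      (use shifted_in_cball[OF _ r sub] circ_nonzero[OF r] in auto)
  then show ?thesis by (simp add: case_prod_unfold)
qed

text \<open>The Cauchy integral depends continuously on its centre because \<open>f\<close> is
  continuous. The Leibniz rule in \<open>holo_on_pd\<close> relies on this continuity.\<close>

lemma pd_continuous_on:
  assumes f: "holo_on f U" shows "continuous_on U (pd i f)"
proof (rule continuous_at_imp_continuous_on, rule ballI)
  fix z0 assume "z0 \<in> U"
  then obtain r0 where "r0 > 0" "cball z0 r0 \<subseteq> U" using f open_contains_cball unfolding holo_on_def by blast
  \<comment> \<open>With half the radius, the circles around all points of \<open>ball z0 r\<close>
    stay inside \<open>U\<close>.\<close>
  then obtain r where r: "r > 0" "cball z0 (2 * r) \<subseteq> U" by (intro that[of "r0 / 2"]) auto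
  have "continuous_on (ball z0 r) (\<lambda>z. integral (cbox 0 1) (\<lambda>x. f (z + axis i (circ r x)) / circ r x))"
    by (rule integral_continuous_on_param[OF continuous_on_shifted[OF holo_on_continuous_on[OF f] r]])
  moreover have "integral (cbox 0 1) (\<lambda>x. f (z + axis i (circ r x)) / circ r x) = pd i f z" if "z \<in> ball z0 r" for z
    by (rule integral_unique[OF pd_integral[OF f r(1) shifted_in_cball(1)[OF that r]]])
  ultimately have "continuous_on (ball z0 r) (pd i f)" by (rule continuous_on_eq)
  then show "isCont (pd i f) z0" using r(1) by (simp add: continuous_on_eq_continuous_at)
qed

lemma bounded_linear_cform: "bounded_linear (\<lambda>h :: complex ^ 'k::finite. \<Sum>j\<in>UNIV. a j * h $ j)"
  by (intro bounded_linear_sum bounded_linear_const_mult bounded_linear_vec_nth)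

text \<open>Differentiation under the integral sign in Cauchy's formula: the derivative is an
  integral of complex linear forms, hence complex linear. Iteration reaches partial derivatives of
  every order.\<close>

lemma holo_on_pd:
  assumes f: "holo_on f U" shows "holo_on (pd i f) U"
proof (rule holo_onI)
  show "open U" using f by (simp add: holo_on_def)
  fix z0 assume z0: "z0 \<in> U"
  then obtain r0 where "r0 > 0" "cball z0 r0 \<subseteq> U" using f open_contains_cball unfolding holo_on_def by blast
  then obtain r where r: "r > 0" "cball z0 (2 * r) \<subseteq> U" by (intro that[of "r0 / 2"]) auto
  note shift = shifted_in_cball[OF _ r]
  \<comment> \<open>The derivative of the integrand with respect to \<open>z\<close>, as a bounded
    linear map, which is how \<open>leibniz_rule\<close> takes it.\<close>
  define fx where "fx z x = Blinfun (\<lambda>h. \<Sum>j\<in>UNIV. (pd j f (z + axis i (circ r x)) / circ r x) * h $ j)" for z x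
  have fx: "blinfun_apply (fx z x) = (\<lambda>h. \<Sum>j\<in>UNIV. (pd j f (z + axis i (circ r x)) / circ r x) * h $ j)" for z x
    unfolding fx_def by (rule bounded_linear_Blinfun_apply[OF bounded_linear_cform])
  have cont: "continuous_on (ball z0 r \<times> cbox 0 1) (\<lambda>(z, x). fx z x)"
  proof (rule continuous_on_blinfun_componentwise)
    fix h :: "complex ^ 'a"
    have "continuous_on (ball z0 r \<times> cbox 0 1)
        (\<lambda>y. \<Sum>j\<in>UNIV. (case y of (z, x) \<Rightarrow> pd j f (z + axis i (circ r x)) / circ r x) * h $ j)"
      by (intro continuous_intros continuous_on_shifted[OF pd_continuous_on[OF f] r])
    then show "continuous_on (ball z0 r \<times> cbox 0 1) (\<lambda>y. blinfun_apply (case y of (z, x) \<Rightarrow> fx z x) h)"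
      by (simp add: case_prod_unfold fx)
  qed
  have "((\<lambda>z. integral (cbox 0 1) (\<lambda>x. f (z + axis i (circ r x)) / circ r x)) has_derivative
      blinfun_apply (integral (cbox 0 1) (fx z0))) (at z0 within ball z0 r)"
  proof (rule leibniz_rule[OF _ _ cont])
    fix z x assume z: "z \<in> ball z0 r"
    have "((\<lambda>z. z + axis i (circ r x)) has_derivative (\<lambda>h. h)) (at z)"
      by (auto intro!: derivative_eq_intros)
    from has_derivative_compose[OF this holo_on_has_derivative[OF f shift(2)[OF z]]]
    have "((\<lambda>z. f (z + axis i (circ r x)) * (1 / circ r x)) has_derivative
        (\<lambda>h. (\<Sum>j\<in>UNIV. pd j f (z + axis i (circ r x)) * h $ j) * (1 / circ r x))) (at z)"
      by (rule has_derivative_mult_left)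
    moreover have "blinfun_apply (fx z x) = (\<lambda>h. (\<Sum>j\<in>UNIV. pd j f (z + axis i (circ r x)) * h $ j) * (1 / circ r x))"
      unfolding fx sum_distrib_right by (intro ext sum.cong refl) (simp add: divide_inverse mult_ac)
    moreover have "(\<lambda>z. f (z + axis i (circ r x)) / circ r x) = (\<lambda>z. f (z + axis i (circ r x)) * (1 / circ r x))"
      by (simp add: divide_inverse)
    ultimately show "((\<lambda>z. f (z + axis i (circ r x)) / circ r x) has_derivative blinfun_apply (fx z x)) (at z within ball z0 r)"
      by (simp only: has_derivative_at_withinI)
  next
    fix z assume z: "z \<in> ball z0 r"
    show "(\<lambda>x. f (z + axis i (circ r x)) / circ r x) integrable_on cbox 0 1"
      using pd_integral[OF f r(1) shift(1)[OF z]] by (rule has_integral_integrable)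
  qed (use r in auto)
  moreover have "blinfun_apply (integral (cbox 0 1) (fx z0)) =
      (\<lambda>h. \<Sum>j\<in>UNIV. integral (cbox 0 1) (\<lambda>x. pd j f (z0 + axis i (circ r x)) / circ r x) * h $ j)"
  proof (rule ext)
    fix h
    have z0r: "z0 \<in> ball z0 r" using r by simp
    have "continuous_on (cbox 0 1) (\<lambda>x. (\<lambda>(z, x). fx z x) (z0, x))"
      by (rule continuous_on_compose2[OF cont]) (use z0r in \<open>auto intro!: continuous_intros\<close>)
    then have "fx z0 integrable_on cbox 0 1" by (intro integrable_continuous) simp
    then have "blinfun_apply (integral (cbox 0 1) (fx z0)) h = integral (cbox 0 1) (\<lambda>x. blinfun_apply (fx z0 x) h)"
      by (rule blinfun_apply_integral)
    also have "\<dots> = (\<Sum>j\<in>UNIV. integral (cbox 0 1) (\<lambda>x. pd j f (z0 + axis i (circ r x)) / circ r x * h $ j))"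
    proof -
      have "continuous_on (cbox 0 1) (\<lambda>x. (\<lambda>(z, x). pd j f (z + axis i (circ r x)) / circ r x) (z0, x))" for j
        by (rule continuous_on_compose2[OF continuous_on_shifted[OF pd_continuous_on[OF f] r]])
          (use z0r in \<open>auto intro!: continuous_intros\<close>)
      then have "(\<lambda>x. pd j f (z0 + axis i (circ r x)) / circ r x * h $ j) integrable_on cbox 0 1" for j
        by (intro integrable_on_mult_left integrable_continuous) simp
      then show ?thesis unfolding fx by (intro integral_sum) auto
    qed
    finally show "blinfun_apply (integral (cbox 0 1) (fx z0)) h =
      (\<Sum>j\<in>UNIV. integral (cbox 0 1) (\<lambda>x. pd j f (z0 + axis i (circ r x)) / circ r x) * h $ j)"
      by (simp only: integral_mult_left)
  qed
  ultimately have "((\<lambda>z. integral (cbox 0 1) (\<lambda>x. f (z + axis i (circ r x)) / circ r x)) has_derivative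
      (\<lambda>h. \<Sum>j\<in>UNIV. integral (cbox 0 1) (\<lambda>x. pd j f (z0 + axis i (circ r x)) / circ r x) * h $ j)) (at z0)"
    using r(1) by (simp add: at_within_open[of z0 "ball z0 r"])
  then have "(pd i f has_derivative
      (\<lambda>h. \<Sum>j\<in>UNIV. integral (cbox 0 1) (\<lambda>x. pd j f (z0 + axis i (circ r x)) / circ r x) * h $ j)) (at z0)"
    by (rule has_derivative_transform_within_open[of _ _ _ _ "ball z0 r"])
      (use r integral_unique[OF pd_integral[OF f r(1) shift(1)]] in auto)
  then show "\<exists>a. (pd i f has_derivative (\<lambda>h. \<Sum>j\<in>UNIV. a j * h $ j)) (at z0)"
    by (rule exI[where x = "\<lambda>j. integral (cbox 0 1) (\<lambda>x. pd j f (z0 + axis i (circ r x)) / circ r x)"])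
qed

section \<open>Holomorphic polynomials and Taylor expansion\<close>

definition cpoly :: "nat \<Rightarrow> (complex ^ 'k::finite \<Rightarrow> complex) \<Rightarrow> bool" where
  "cpoly k q \<longleftrightarrow> (\<exists>c. \<forall>x. q x = (\<Sum>\<gamma>\<in>expo UNIV k. c \<gamma> * cmon \<gamma> x))"

lemma cpoly_cmon:
  assumes "\<gamma> \<in> expo UNIV k" shows "cpoly k (\<lambda>x. a * cmon \<gamma> x)"
  unfolding cpoly_def
proof (intro exI allI)
  fix x
  have "(\<Sum>\<beta>\<in>expo UNIV k. (if \<beta> = \<gamma> then a else 0) * cmon \<beta> x)
      = (\<Sum>\<beta>\<in>expo UNIV k. if \<beta> = \<gamma> then a * cmon \<beta> x else 0)"
    by (rule sum.cong) auto
  then show "a * cmon \<gamma> x = (\<Sum>\<beta>\<in>expo UNIV k. (if \<beta> = \<gamma> then a else 0) * cmon \<beta> x)"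
    using assms by (simp add: sum.delta finite_expo)
qed

lemma cpoly_add:
  assumes "cpoly k p" "cpoly k q" shows "cpoly k (\<lambda>x. p x + q x)"
proof -
  obtain c c' where "\<And>x. p x = (\<Sum>\<gamma>\<in>expo UNIV k. c \<gamma> * cmon \<gamma> x)"
    "\<And>x. q x = (\<Sum>\<gamma>\<in>expo UNIV k. c' \<gamma> * cmon \<gamma> x)"
    using assms unfolding cpoly_def by blast
  then show ?thesis unfolding cpoly_def
    by (intro exI[of _ "\<lambda>\<gamma>. c \<gamma> + c' \<gamma>"]) (simp add: distrib_right sum.distrib)
qed

lemma cpoly_0: "cpoly k (\<lambda>_. 0)"
  unfolding cpoly_def by (intro exI[of _ "\<lambda>_. 0"]) simp

lemma cpoly_sum: "(\<And>i. i \<in> I \<Longrightarrow> cpoly k (f i)) \<Longrightarrow> cpoly k (\<lambda>x. \<Sum>i\<in>I. f i x)"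
  by (induction I rule: infinite_finite_induct) (auto intro: cpoly_add cpoly_0)

lemma cmon_0 [simp]: "cmon 0 x = 1"
  by (simp add: cmon_def)

lemma cmon_add_single: "cmon (\<gamma> + Poly_Mapping.single i 1) x = cmon \<gamma> x * x $ i"
proof -
  have "(\<Prod>j\<in>UNIV. x $ j ^ Poly_Mapping.lookup (Poly_Mapping.single i (1::nat)) j)
      = (\<Prod>j\<in>UNIV. if j = i then x $ j else 1)"
    by (rule prod.cong) (auto simp: lookup_single when_def)
  then show ?thesis by (simp add: cmon_def lookup_add power_add prod.distrib prod.delta)
qed

lemma cmon_scale: "cmon \<gamma> (t *s x) = t ^ monomial_degree \<gamma> * cmon \<gamma> x"
  by (subst monomial_degree_superset[of UNIV])
    (auto simp: cmon_def power_mult_distrib prod.distrib power_sum)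

lemma norm_scale_le: "norm t \<le> 1 \<Longrightarrow> norm ((t::complex) *s x) \<le> norm x"
  unfolding norm_vec_def
  by (rule L2_set_mono) (auto simp: norm_mult intro: mult_left_le_one_le)

lemma has_derivative_scale:
  "((\<lambda>t::complex. p + t *s x) has_derivative (\<lambda>h. h *s x)) (at t)"
proof -
  have "bounded_linear (\<lambda>t::complex. t *s x)"
    by (intro linear_conv_bounded_linear[THEN iffD1] linearI)
      (auto simp: vec_eq_iff distrib_right)
  from has_derivative_add[OF has_derivative_const bounded_linear_imp_has_derivative[OF this]]
  show ?thesis by simp
qed

text \<open>
  Taylor polynomials of the partial derivatives are integrated along the segments from \<open>p\<close>.
\<close>

lemma holomorphic_taylor:
  assumes "holo_on f U" "p \<in> U"
  shows "\<exists>q. cpoly k q \<and> vanishes (Suc k) (\<lambda>x. f (p + x) - q x)"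
  using assms
proof (induction k arbitrary: f)
  case 0
  have d: "(f has_derivative (\<lambda>h. \<Sum>i\<in>UNIV. pd i f p * h $ i)) (at p)"
    using holo_on_has_derivative 0 by blast
  interpret D: bounded_linear "\<lambda>h. \<Sum>i\<in>UNIV. pd i f p * h $ i"
    using d by (rule has_derivative_bounded_linear)
  obtain K where K: "\<And>h. norm (\<Sum>i\<in>UNIV. pd i f p * h $ i) \<le> norm h * K" using D.bounded by blast
  obtain d where d: "d > 0" "\<And>y. norm (y - p) < d \<Longrightarrow>
      norm (f y - f p - (\<Sum>i\<in>UNIV. pd i f p * (y - p) $ i)) \<le> 1 * norm (y - p)"
    using d unfolding has_derivative_at_alt using zero_less_one by blast
  \<comment> \<open>In the bound \<open>K + 1\<close>, the derivative contributes \<open>K\<close>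
    and the error of the linear approximation \<open>1\<close>.\<close>
  have "vanishes (Suc 0) (\<lambda>x. f (p + x) - f p * cmon 0 x)"
  proof (rule vanishesI[OF d(1), of _ "K + 1"])
    fix x :: "complex ^ 'a" assume "norm x < d"
    then have "norm (f (p + x) - f p - (\<Sum>i\<in>UNIV. pd i f p * x $ i)) \<le> norm x"
      using d(2)[of "p + x"] by simp
    then have "norm (f (p + x) - f p) \<le> norm x + norm x * K"
      using K[of x] norm_triangle_sub[of "f (p + x) - f p" "\<Sum>i\<in>UNIV. pd i f p * x $ i"] by linarith
    then show "norm (f (p + x) - f p * cmon 0 x) \<le> (K + 1) * norm x ^ Suc 0"
      by (simp add: algebra_simps)
  qed
  moreover have "cpoly 0 (\<lambda>x. f p * cmon 0 x)" by (intro cpoly_cmon zero_in_expo)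
  ultimately show ?case by blast
next
  case (Suc k)
  have "\<forall>i. \<exists>c. vanishes (Suc k) (\<lambda>x. pd i f (p + x) - (\<Sum>\<gamma>\<in>expo UNIV k. c \<gamma> * cmon \<gamma> x))"
  proof
    fix i
    obtain q where "cpoly k q" "vanishes (Suc k) (\<lambda>x. pd i f (p + x) - q x)"
      using Suc.IH[OF holo_on_pd[OF Suc.prems(1)] Suc.prems(2)] by blast
    then show "\<exists>c. vanishes (Suc k) (\<lambda>x. pd i f (p + x) - (\<Sum>\<gamma>\<in>expo UNIV k. c \<gamma> * cmon \<gamma> x))"
      unfolding cpoly_def by auto
  qed
  from choice[OF this] obtain c where
    "\<And>i. vanishes (Suc k) (\<lambda>x. pd i f (p + x) - (\<Sum>\<gamma>\<in>expo UNIV k. c i \<gamma> * cmon \<gamma> x))" by blast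
  moreover define q where "q i x = (\<Sum>\<gamma>\<in>expo UNIV k. c i \<gamma> * cmon \<gamma> x)" for i x
  ultimately have "\<forall>i. \<exists>C d. C \<ge> 0 \<and> d > 0 \<and> (\<forall>x. norm x < d \<longrightarrow> norm (pd i f (p + x) - q i x) \<le> C * norm x ^ Suc k)"
    by (metis (mono_tags, lifting) vanishesE)
  then obtain C d where Cd: "\<And>i. C i \<ge> 0" "\<And>i. d i > 0"
      "\<And>i x. norm x < d i \<Longrightarrow> norm (pd i f (p + x) - q i x) \<le> C i * norm x ^ Suc k" by metis
  obtain r where r: "r > 0" "ball p r \<subseteq> U"
    using Suc.prems open_contains_ball unfolding holo_on_def by blast
  define \<delta> where "\<delta> = Min (insert r (range d))"
  have "\<delta> > 0" using Cd(2) r(1) by (auto simp: \<delta>_def)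
  moreover have "\<delta> \<le> r" "\<And>i. \<delta> \<le> d i" unfolding \<delta>_def by (rule Min_le; simp)+
  ultimately have \<delta>: "\<delta> > 0" "\<delta> \<le> r" "\<And>i. \<delta> \<le> d i" .
  \<comment> \<open>Integrating \<open>t ^ d\<close> over the segment produces the denominators
    \<open>d + 1\<close>, and the extra variable \<open>i\<close> comes from the chain rule. So the
    derivative of \<open>P (t *s x)\<close> in \<open>t\<close> is the sum of the terms
    \<open>q i (t *s x) * x $ i\<close>.\<close>
  define P where "P x = f p * cmon 0 x + (\<Sum>i\<in>UNIV. \<Sum>\<gamma>\<in>expo UNIV k.
      c i \<gamma> / of_nat (Suc (monomial_degree \<gamma>)) * cmon (\<gamma> + Poly_Mapping.single i 1) x)" for x
  have "cpoly (Suc k) P"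
    unfolding P_def[abs_def]
  proof (intro cpoly_add cpoly_sum cpoly_cmon)
    show "\<gamma> + Poly_Mapping.single i 1 \<in> expo UNIV (Suc k)" if "\<gamma> \<in> expo UNIV k" for \<gamma> and i :: 'a
      using add_in_expo[OF that single_in_expo[of i UNIV 1 1]] by simp
  qed (rule zero_in_expo)
  moreover have "vanishes (Suc (Suc k)) (\<lambda>x. f (p + x) - P x)"
  proof (rule vanishesI[OF \<delta>(1), of _ "\<Sum>i\<in>UNIV. C i"])
    fix x :: "complex ^ 'a" assume x: "norm x < \<delta>"
    define \<psi> where "\<psi> t = f (p + t *s x) - P (t *s x)" for t
    have P: "P (t *s x) = f p + (\<Sum>i\<in>UNIV. \<Sum>\<gamma>\<in>expo UNIV k.
      c i \<gamma> / of_nat (Suc (monomial_degree \<gamma>)) * (t ^ Suc (monomial_degree \<gamma>) * (cmon \<gamma> x * x $ i)))" for t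
    proof -
      have "cmon (\<gamma> + Poly_Mapping.single i 1) (t *s x) = t ^ Suc (monomial_degree \<gamma>) * (cmon \<gamma> x * x $ i)" for i \<gamma>
        unfolding cmon_scale monomial_degree_add cmon_add_single by simp
      then show ?thesis unfolding P_def by (simp only: cmon_0 mult_1_right)
    qed
    have "((\<lambda>t. c i \<gamma> / of_nat (Suc (monomial_degree \<gamma>)) * (t ^ Suc (monomial_degree \<gamma>) * (cmon \<gamma> x * x $ i)))
        has_field_derivative c i \<gamma> * cmon \<gamma> (t *s x) * x $ i) (at t)" for i \<gamma> t
      by (rule derivative_eq_intros refl)+ (simp add: cmon_scale field_simps del: of_nat_Suc)
    then have "((\<lambda>t. P (t *s x)) has_field_derivative (0 + (\<Sum>i\<in>UNIV. \<Sum>\<gamma>\<in>expo UNIV k. c i \<gamma> * cmon \<gamma> (t *s x) * x $ i))) (at t)" for t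
      unfolding P by (intro DERIV_add DERIV_const DERIV_sum)
    then have dP: "((\<lambda>t. P (t *s x)) has_field_derivative (\<Sum>i\<in>UNIV. q i (t *s x) * x $ i)) (at t)" for t
      by (simp add: q_def sum_distrib_right)
    have df: "((\<lambda>t. f (p + t *s x)) has_field_derivative (\<Sum>i\<in>UNIV. pd i f (p + t *s x) * x $ i)) (at t)"
      if "norm t \<le> 1" for t
    proof -
      have "p + t *s x \<in> U" using norm_scale_le[OF that, of x] x \<delta>(2) r(2) by (auto simp: dist_norm)
      note D = has_derivative_compose[OF has_derivative_scale holo_on_has_derivative[OF Suc.prems(1) this]]
      have "(\<lambda>h. \<Sum>i\<in>UNIV. pd i f (p + t *s x) * (h *s x) $ i) = (*) (\<Sum>i\<in>UNIV. pd i f (p + t *s x) * x $ i)"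
        by (rule ext) (simp add: sum_distrib_right sum_distrib_left mult_ac)
      with D show ?thesis unfolding has_field_derivative_def by simp
    qed
    have d\<psi>: "(\<psi> has_field_derivative (\<Sum>i\<in>UNIV. (pd i f (p + t *s x) - q i (t *s x)) * x $ i)) (at t within cball 0 1)"
      if "t \<in> cball 0 1" for t
      unfolding \<psi>_def left_diff_distrib sum_subtractf
      by (rule has_field_derivative_at_within, rule DERIV_diff[OF df dP]) (use that in simp)
    \<comment> \<open>On the closed unit disc of the complex parameter the derivative of
      \<open>\<psi>\<close> is bounded by a multiple of \<open>norm x ^ Suc (Suc k)\<close>: one
      power of \<open>norm x\<close> comes from \<open>x $ i\<close>, the others from the remainders
      of the partial derivatives.\<close>
    have "norm (\<psi> 1 - \<psi> 0) \<le> ((\<Sum>i\<in>UNIV. C i) * norm x ^ Suc (Suc k)) * norm (1 - 0 :: complex)"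
    proof (rule field_differentiable_bound[OF _ d\<psi>])
      fix t :: complex assume "t \<in> cball 0 1"
      then have t: "norm (t *s x) \<le> norm x" by (intro norm_scale_le) simp
      have "norm ((pd i f (p + t *s x) - q i (t *s x)) * x $ i) \<le> C i * norm x ^ Suc (Suc k)" for i
      proof -
        have "norm (pd i f (p + t *s x) - q i (t *s x)) \<le> C i * norm (t *s x) ^ Suc k"
          using Cd(3)[of "t *s x" i] \<delta>(3)[of i] x t by simp
        also have "\<dots> \<le> C i * norm x ^ Suc k"
          by (intro mult_left_mono power_mono t Cd(1)) auto
        finally have "norm (pd i f (p + t *s x) - q i (t *s x)) * norm (x $ i) \<le> (C i * norm x ^ Suc k) * norm x"
          by (intro mult_mono Finite_Cartesian_Product.norm_nth_le) (use Cd(1) in auto)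
        then show ?thesis by (simp add: norm_mult mult_ac)
      qed
      then show "norm (\<Sum>i\<in>UNIV. (pd i f (p + t *s x) - q i (t *s x)) * x $ i) \<le> (\<Sum>i\<in>UNIV. C i) * norm x ^ Suc (Suc k)"
        unfolding sum_distrib_right by (intro sum_norm_le)
    qed auto
    moreover have "\<psi> 0 = 0" unfolding \<psi>_def P by simp
    ultimately show "norm (f (p + x) - P x) \<le> (\<Sum>i\<in>UNIV. C i) * norm x ^ Suc (Suc k)"
      by (simp add: \<psi>_def)
  qed
  ultimately show ?case by blast
qed

lemma holomorphic_map_component:
  assumes "holomorphic_map_on F U" shows "holo_on (\<lambda>z. F z $ j) U"
proof (rule holo_onI)
  show "open U" using assms by (simp add: holomorphic_map_on_def)
  fix z assume "z \<in> U"
  then obtain D where D: "(F has_derivative D) (at z)" "Vector_Spaces.linear (*s) (*s) D"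
    using assms unfolding holomorphic_map_on_def by blast
  interpret D: Vector_Spaces.linear "(*s)" "(*s)" D by (rule D(2))
  have d: "((\<lambda>z. F z $ j) has_derivative (\<lambda>h. D h $ j)) (at z)"
    using bounded_linear.has_derivative[OF bounded_linear_vec_nth D(1)] .
  have eq: "(\<lambda>h. D h $ j) = (\<lambda>h. \<Sum>i\<in>UNIV. D (axis i 1) $ j * h $ i)"
  proof (rule ext)
    fix h
    have "D h = (\<Sum>i\<in>UNIV. h $ i *s D (axis i 1))"
      by (subst basis_expansion[of h, symmetric]) (simp only: D.sum D.scale)
    then show "D h $ j = (\<Sum>i\<in>UNIV. D (axis i 1) $ j * h $ i)" by (simp add: mult.commute)
  qed
  show "\<exists>a. ((\<lambda>z. F z $ j) has_derivative (\<lambda>h. \<Sum>i\<in>UNIV. a i * h $ i)) (at z)"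
    using d unfolding eq by (rule exI[where x = "\<lambda>i. D (axis i 1) $ j"])
qed

section \<open>The jet of a transversal embedding\<close>

lemma param_poly_fix: "param_poly B D f \<Longrightarrow> is_poly D (f t)"
  by (elim param_polyE, rule param_polyI[where I = "expo Basis D" and h = id])
    (auto simp: finite_expo intro: polyfn.const)

text \<open>Continuity is asked direction by direction, which suffices to keep one nonzero
  directional derivative nonzero nearby.\<close>

definition C1_fun :: "('a::real_normed_vector \<Rightarrow> real) \<Rightarrow> bool" where
  "C1_fun f \<longleftrightarrow> (\<exists>G. (\<forall>x. (f has_derivative G x) (at x)) \<and> (\<forall>h. continuous_on UNIV (\<lambda>x. G x h)))"

lemma C1_fun_const: "C1_fun (\<lambda>_. c)"
  unfolding C1_fun_def by (intro exI[of _ "\<lambda>_ _. 0"]) auto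

lemma C1_fun_inner: "C1_fun (\<lambda>x. x \<bullet> b)"
  unfolding C1_fun_def by (intro exI[of _ "\<lambda>_ h. h \<bullet> b"]) (auto intro!: derivative_eq_intros)

lemma C1_fun_add:
  assumes "C1_fun f" "C1_fun g" shows "C1_fun (\<lambda>x. f x + g x)"
proof -
  obtain F G where "\<And>x. (f has_derivative F x) (at x)" "\<And>h. continuous_on UNIV (\<lambda>x. F x h)"
    "\<And>x. (g has_derivative G x) (at x)" "\<And>h. continuous_on UNIV (\<lambda>x. G x h)"
    using assms unfolding C1_fun_def by blast
  then show ?thesis unfolding C1_fun_def
    by (intro exI[of _ "\<lambda>x h. F x h + G x h"]) (auto intro!: has_derivative_add continuous_on_add)
qed

lemma C1_fun_mult:
  assumes "C1_fun f" "C1_fun g" shows "C1_fun (\<lambda>x. f x * g x)"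
proof -
  obtain F G where FG: "\<And>x. (f has_derivative F x) (at x)" "\<And>h. continuous_on UNIV (\<lambda>x. F x h)"
    "\<And>x. (g has_derivative G x) (at x)" "\<And>h. continuous_on UNIV (\<lambda>x. G x h)"
    using assms unfolding C1_fun_def by blast
  then have "continuous_on UNIV f" "continuous_on UNIV g"
    by (meson continuous_at_imp_continuous_on has_derivative_continuous)+
  with FG show ?thesis unfolding C1_fun_def
    by (intro exI[of _ "\<lambda>x h. f x * G x h + F x h * g x"])
      (auto intro!: has_derivative_mult continuous_on_add continuous_on_mult)
qed

lemma C1_fun_sum: "(\<And>i. i \<in> I \<Longrightarrow> C1_fun (f i)) \<Longrightarrow> C1_fun (\<lambda>x. \<Sum>i\<in>I. f i x)"
  by (induction I rule: infinite_finite_induct) (auto intro: C1_fun_add C1_fun_const)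

lemma C1_fun_prod: "(\<And>i. i \<in> I \<Longrightarrow> C1_fun (f i)) \<Longrightarrow> C1_fun (\<lambda>x. \<Prod>i\<in>I. f i x)"
  by (induction I rule: infinite_finite_induct) (auto intro: C1_fun_mult C1_fun_const)

lemma C1_fun_power: "C1_fun f \<Longrightarrow> C1_fun (\<lambda>x. f x ^ n)"
  by (induction n) (auto intro: C1_fun_mult C1_fun_const)

lemma C1_fun_poly_fun: "C1_fun (poly_fun P)"
  unfolding poly_fun_def[abs_def] mpoly_eval_def monomial_eval_def
  by (intro C1_fun_sum C1_fun_mult C1_fun_const C1_fun_prod C1_fun_power C1_fun_inner)

text \<open>A nonzero differential is an open condition, so near \<open>p\<close> the hypersurface
  is the full zero set of \<open>P\<close>. \<open>exists_factor\<close> requires vanishing on all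
  nearby zeros.\<close>

lemma poly_hypersurface_near:
  assumes p: "p \<in> poly_hypersurface P"
  obtains \<delta> where "\<delta> > 0" "\<And>z. norm (z - p) < \<delta> \<Longrightarrow> poly_fun P z = 0 \<Longrightarrow> z \<in> poly_hypersurface P"
proof -
  obtain G where G: "\<And>x. (poly_fun P has_derivative G x) (at x)" "\<And>h. continuous_on UNIV (\<lambda>x. G x h)"
    using C1_fun_poly_fun[of P] unfolding C1_fun_def by blast
  have fd: "frechet_derivative (poly_fun P) (at x) = G x" for x
    using frechet_derivative_at[OF G(1)] by simp
  obtain v where v: "G p v \<noteq> 0" using p by (auto simp: poly_hypersurface_def fd)
  have "isCont (\<lambda>x. G x v) p" using G(2)[of v] by (simp add: continuous_on_eq_continuous_at)
  then have "\<forall>\<^sub>F z in nhds p. G z v \<noteq> 0"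
    using v by (simp add: continuous_at_imp_continuous_within isCont_def tendsto_imp_eventually_ne eventually_nhds_conv_at)
  then obtain \<delta> where "\<delta> > 0" "\<And>z. dist z p < \<delta> \<Longrightarrow> G z v \<noteq> 0"
    unfolding eventually_nhds_metric by blast
  then show ?thesis by (intro that[of \<delta>]) (auto simp: poly_hypersurface_def fd dist_norm fun_eq_iff)
qed

section \<open>The hyperquadric and transversality\<close>

lemma hyperquadric_fun_eq:
  "hyperquadric_fun S q = Im (q $ None) + (\<Sum>j\<in>UNIV. (if j \<in> S then 1 else -1) * (cmod (q $ Some j))\<^sup>2)"
proof -
  have "(\<Sum>j\<in>UNIV. (if j \<in> S then 1 else -1) * (cmod (q $ Some j))\<^sup>2)
      = (\<Sum>j\<in>S \<union> - S. (if j \<in> S then 1 else -1) * (cmod (q $ Some j))\<^sup>2)" by simp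
  also have "\<dots> = (\<Sum>j\<in>S. (cmod (q $ Some j))\<^sup>2) + (\<Sum>j\<in>-S. - (cmod (q $ Some j))\<^sup>2)"
    by (subst sum.union_disjoint) auto
  finally show ?thesis by (simp add: hyperquadric_fun_def sum_negf)
qed

lemma hyperquadric_fun_has_derivative:
  "(hyperquadric_fun S has_derivative (\<lambda>h. Im (h $ None)
     + (\<Sum>j\<in>UNIV. (if j \<in> S then 1 else -1) * (2 * (q $ Some j \<bullet> h $ Some j))))) (at q)"
  unfolding hyperquadric_fun_eq[abs_def] power2_norm_eq_inner
  by (rule derivative_eq_intros bounded_linear.has_derivative[OF bounded_linear_vec_nth] refl | simp)+
    (auto simp: inner_commute)

text \<open>If \<open>Q\<close> vanished on the range of \<open>D\<close>, both summands would lie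
  in the kernel of \<open>Q\<close>; this kernel is proper, as the imaginary direction of
  \<open>W\<close> shows.\<close>

lemma transversal_imp_derivative_nonzero:
  assumes "{a + b | a b. a \<in> hyperquadric_tangent_space S q \<and> b \<in> range D} = UNIV"
    and "(hyperquadric_fun S has_derivative Q) (at q)"
  shows "\<exists>v. Q (D v) \<noteq> 0"
proof (rule ccontr)
  assume 0: "\<not> ?thesis"
  interpret Q: bounded_linear Q using assms(2) by (rule has_derivative_bounded_linear)
  have Q: "frechet_derivative (hyperquadric_fun S) (at q) = Q"
    using frechet_derivative_at[OF assms(2)] by simp
  have "Q u = 0" for u
  proof -
    obtain a v where "u = a + D v" "a \<in> hyperquadric_tangent_space S q" using assms(1) by blast
    then show ?thesis using 0 by (simp add: Q.add hyperquadric_tangent_space_def Q)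
  qed
  moreover have "Q (axis None \<i>) = 1"
    using has_derivative_unique[OF assms(2) hyperquadric_fun_has_derivative] by (simp add: axis_def)
  ultimately show False by simp
qed

lemma vanishes_le: "vanishes k f \<Longrightarrow> (\<And>x. norm (g x) \<le> norm (f x)) \<Longrightarrow> vanishes k g"
  unfolding vanishes_def by (meson order_trans)

lemma isCont_vanishes_0:
  assumes "isCont f 0" shows "vanishes 0 f"
proof -
  obtain d where d: "d > 0" "\<And>x. dist x 0 < d \<Longrightarrow> dist (f x) (f 0) < 1"
    using assms unfolding continuous_at_eps_delta by (metis zero_less_one)
  show ?thesis
  proof (rule vanishesI[OF d(1), of _ "norm (f 0) + 1"])
    fix x :: 'a assume "norm x < d"
    then have "norm (f x - f 0) < 1" using d(2)[of x] by (simp add: dist_norm)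
    then show "norm (f x) \<le> (norm (f 0) + 1) * norm x ^ 0"
      using norm_triangle_sub[of "f x" "f 0"] by simp
  qed
qed

text \<open>A difference of squares factors, and the sum of the moduli is bounded near the origin
  since it is twice the modulus of \<open>f\<close> minus the small difference.\<close>

lemma vanishes_norm_power2_diff:
  fixes f g :: "'a::real_normed_vector \<Rightarrow> complex"
  assumes "vanishes k (\<lambda>x. f x - g x)" "vanishes 0 f"
  shows "vanishes k (\<lambda>x. (cmod (f x))\<^sup>2 - (cmod (g x))\<^sup>2)"
proof -
  have d: "vanishes k (\<lambda>x. cmod (f x) - cmod (g x))"
    by (rule vanishes_le[OF assms(1)]) (simp add: norm_triangle_ineq3)
  have f: "vanishes 0 (\<lambda>x. cmod (f x))" by (rule vanishes_le[OF assms(2)]) simp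
  have "vanishes 0 (\<lambda>x. cmod (f x) + cmod (f x) - (cmod (f x) - cmod (g x)))"
    by (intro vanishes_diff vanishes_add f vanishes_mono[OF d]) simp
  from vanishes_mult[OF d this] show ?thesis by (simp add: power2_eq_square algebra_simps)
qed

text \<open>The jet is read off from the embedding, except for the factor, which
  \<open>exists_factor\<close> supplies for \<open>P\<close>, \<open>hyperquadric_fun S\<close>
  composed with \<open>F\<close>, and the latter's polynomial approximation. The open set
  \<open>W\<close> admits embeddings of a mere piece of the hypersurface.\<close>

lemma embedding_imp_jet:
  fixes F :: "'n::finite cspace \<Rightarrow> 'm::finite cspace" and S :: "'m set"
  assumes P: "P \<in> real_polys k" and k: "1 \<le> k" and p: "p \<in> poly_hypersurface P"
    and W: "open W" "p \<in> W" and F: "holomorphic_map_on F U" "p \<in> U"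
    and sub: "F ` (poly_hypersurface P \<inter> W) \<subseteq> hyperquadric S"
    and trans: "{a + b | a b. a \<in> hyperquadric_tangent_space S (F p) \<and>
                  b \<in> range (frechet_derivative F (at p))} = UNIV"
  shows "\<exists>t :: ('n cspace, 'n, 'm) jet_coord \<Rightarrow> real.
    vanishes (Suc k) (\<lambda>x. poly_fun P (jet_point t + x) - jet_factor k t x * jet_quadric k t x)"
proof -
  define f where "f x = poly_fun P (p + x)" for x
  define r where "r x = hyperquadric_fun S (F (p + x))" for x
  obtain D where D: "(F has_derivative D) (at p)" using F unfolding holomorphic_map_on_def by blast
  have shift: "((\<lambda>x. p + x) has_derivative (\<lambda>h. h)) (at 0)" by (auto intro!: derivative_eq_intros)
  define Q where "Q h = Im (h $ None) + (\<Sum>j\<in>UNIV. (if j \<in> S then 1 else -1) * (2 * (F p $ Some j \<bullet> h $ Some j)))"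
    for h :: "'m cspace"
  have Q: "(hyperquadric_fun S has_derivative Q) (at (F p))"
    unfolding Q_def[abs_def] by (rule hyperquadric_fun_has_derivative)
  have "frechet_derivative F (at p) = D" using frechet_derivative_at[OF D] by simp
  then obtain v where v: "Q (D v) \<noteq> 0"
    using transversal_imp_derivative_nonzero[OF _ Q, of D] trans by auto
  have "((\<lambda>x. F (p + x)) has_derivative D) (at 0)"
    using has_derivative_compose[OF shift, of F D] D by simp
  then have rd: "(r has_derivative (\<lambda>h. Q (D h))) (at 0)"
    unfolding r_def[abs_def] using has_derivative_compose[of "\<lambda>x. F (p + x)" D 0 UNIV "hyperquadric_fun S" Q] Q by simp
  obtain G where G: "\<And>x. (poly_fun P has_derivative G x) (at x)"
    using C1_fun_poly_fun[of P] unfolding C1_fun_def by blast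
  have Gp: "G p \<noteq> (\<lambda>_. 0)"
    using p frechet_derivative_at[OF G, of p] by (simp add: poly_hypersurface_def)
  have fd: "(f has_derivative G p) (at 0)"
    unfolding f_def[abs_def] using has_derivative_compose[OF shift, of "poly_fun P" "G p"] G by simp
  have f0: "f 0 = 0" using p by (simp add: f_def poly_hypersurface_def)
  obtain a where a: "\<And>x. poly_fun P (p + x) = (\<Sum>\<beta>\<in>expo Basis k. a \<beta> * mon \<beta> x)"
    using poly_fun_translate[OF P] by blast
  have fp: "is_poly k f"
    unfolding f_def[abs_def] a by (intro param_poly_sum param_poly_cmult polyfn.const param_poly_mon)
  obtain \<delta>1 where \<delta>1: "\<delta>1 > 0" "\<And>z. norm (z - p) < \<delta>1 \<Longrightarrow> poly_fun P z = 0 \<Longrightarrow> z \<in> poly_hypersurface P"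
    using poly_hypersurface_near[OF p] by blast
  obtain \<delta>2 where \<delta>2: "\<delta>2 > 0" "ball p \<delta>2 \<subseteq> W" using W open_contains_ball by blast
  have zero: "r x = 0" if "norm x < min \<delta>1 \<delta>2" "f x = 0" for x
  proof -
    have "p + x \<in> poly_hypersurface P" using \<delta>1(2)[of "p + x"] that by (simp add: f_def)
    moreover have "p + x \<in> W" using \<delta>2(2) that by (auto simp: dist_norm)
    ultimately have "F (p + x) \<in> hyperquadric S" using sub by blast
    then show ?thesis by (simp add: r_def hyperquadric_def)
  qed
  have "\<forall>j. \<exists>c. vanishes (Suc k) (\<lambda>x. F (p + x) $ j - (\<Sum>\<gamma>\<in>expo UNIV k. c \<gamma> * cmon \<gamma> x))"
    using holomorphic_taylor[OF holomorphic_map_component[OF F(1)] F(2), of k] unfolding cpoly_def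
    by fastforce
  from choice[OF this] obtain c where
    c: "\<And>j. vanishes (Suc k) (\<lambda>x. F (p + x) $ j - (\<Sum>\<gamma>\<in>expo UNIV k. c j \<gamma> * cmon \<gamma> x))" by blast
  \<comment> \<open>The coefficients \<open>g\<close> of the factor are left open: the factor is
    found by dividing by the quadric of this very jet, and the quadric does not involve
    them.\<close>
  define t where "t g u = (case u of Point b \<Rightarrow> p \<bullet> b | Sign j \<Rightarrow> if j \<in> S then 1 else -1 | Factor \<beta> \<Rightarrow> g \<beta>
      | MapRe j \<gamma> \<Rightarrow> Re (c j \<gamma>) | MapIm j \<gamma> \<Rightarrow> Im (c j \<gamma>))"
    for g and u :: "('n cspace, 'n, 'm) jet_coord"
  have tF: "jet_map k (t g) j x = (\<Sum>\<gamma>\<in>expo UNIV k. c j \<gamma> * cmon \<gamma> x)" for g j x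
    by (simp add: jet_map_def t_def)
  define \<rho> where "\<rho> = jet_quadric k (t (\<lambda>_. 0))"
  have t\<rho>: "jet_quadric k (t g) = \<rho>" for g
    unfolding \<rho>_def by (rule ext) (simp add: jet_quadric_def tF, simp add: t_def)
  have \<rho>_poly: "is_poly (k + k) \<rho>"
    unfolding \<rho>_def by (rule param_poly_fix[OF param_poly_jet_quadric])
  have van: "vanishes (Suc k) (\<lambda>x. F (p + x) $ j - jet_map k (t (\<lambda>_. 0)) j x)" for j
    using c[of j] by (simp add: tF)
  have "isCont (\<lambda>x. F (p + x) $ j) 0" for j
    using \<open>((\<lambda>x. F (p + x)) has_derivative D) (at 0)\<close> by (intro continuous_intros) (rule has_derivative_continuous)
  then have bdd: "vanishes 0 (\<lambda>x. F (p + x) $ j)" for j by (rule isCont_vanishes_0)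
  have "vanishes (Suc k) (\<lambda>x. Im (F (p + x) $ None - jet_map k (t (\<lambda>_. 0)) None x)
      + (\<Sum>j\<in>UNIV. (if j \<in> S then 1 else -1) * ((cmod (F (p + x) $ Some j))\<^sup>2 - (cmod (jet_map k (t (\<lambda>_. 0)) (Some j) x))\<^sup>2)))"
    by (intro vanishes_add vanishes_sum vanishes_cmult vanishes_norm_power2_diff van bdd
        vanishes_le[OF van[of None]]) (simp only: real_norm_def abs_Im_le_cmod)
  then have rvan: "vanishes (Suc k) (\<lambda>x. r x - \<rho> x)"
    unfolding r_def \<rho>_def jet_quadric_def hyperquadric_fun_eq
    by (simp add: t_def right_diff_distrib sum_subtractf algebra_simps)
  obtain g where g: "is_poly (k - 1) g" "vanishes (Suc k) (\<lambda>x. f x - g x * \<rho> x)"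
  proof (rule exists_factor[where \<delta> = "min \<delta>1 \<delta>2", OF k fp f0 fd Gp rd v])
    show "min \<delta>1 \<delta>2 > 0" using \<delta>1(1) \<delta>2(1) by simp
  qed (use zero \<rho>_poly rvan in auto)
  obtain b where b: "\<And>x. g x = (\<Sum>\<beta>\<in>expo Basis (k - 1). b \<beta> * mon \<beta> x)"
    using g(1) by (rule is_polyE) blast
  have "jet_factor k (t b) = g" by (rule ext) (simp add: jet_factor_def t_def b)
  moreover have "jet_point (t b) = p" by (simp add: jet_point_def t_def euclidean_representation)
  ultimately show ?thesis
    using g(2) by (intro exI[of _ "t b"]) (simp add: t\<rho> f_def)
qed

text \<open>The exceptional set is the zero set of a single relation, satisfied by the coefficients
  of every \<open>P\<close> that comes from a jet, whatever its point and signature.\<close>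

lemma zariski_genericI:
  fixes \<Phi> :: "'n::finite cspace set \<Rightarrow> bool"
  assumes card: "card (jet_coords k :: ('n cspace, 'n, 'm::finite) jet_coord set) < card (expo (Basis :: 'n cspace set) k)"
    and bad: "\<And>P. P \<in> real_polys k \<Longrightarrow> \<not> \<Phi> (poly_hypersurface P) \<Longrightarrow>
      \<exists>t :: ('n cspace, 'n, 'm) jet_coord \<Rightarrow> real.
        vanishes (Suc k) (\<lambda>x. poly_fun P (jet_point t + x) - jet_factor k t x * jet_quadric k t x)"
  shows "zariski_generic_hypersurface k \<Phi>"
proof -
  let ?E = "expo Basis k :: ('n cspace \<Rightarrow>\<^sub>0 nat) set"
  obtain C :: "('n cspace \<Rightarrow>\<^sub>0 nat) \<Rightarrow> (('n cspace, 'n, 'm) jet_coord \<Rightarrow> real) \<Rightarrow> real" where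
    C: "\<And>\<alpha>. polyfn (jet_coords k) (C \<alpha>)"
    "\<And>P t \<alpha>. P \<in> real_polys k \<Longrightarrow>
       vanishes (Suc k) (\<lambda>x. poly_fun P (jet_point t + x) - jet_factor k t x * jet_quadric k t x) \<Longrightarrow>
       \<alpha> \<in> expo Basis k \<Longrightarrow> Poly_Mapping.lookup P \<alpha> = C \<alpha> t"
    by (rule coefficients_polynomial_in_jets[where 'n = 'n and 'm = 'm and k = k]) blast
  have fin: "finite ?E" "finite (jet_coords k :: ('n cspace, 'n, 'm) jet_coord set)"
    by (auto simp: jet_coords_def finite_expo)
  obtain Q y where Q: "\<And>t x. (\<And>\<alpha>. \<alpha> \<in> ?E \<Longrightarrow> x \<alpha> = C \<alpha> t) \<Longrightarrow> mpoly_eval Q x = 0"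
    "\<And>x. (\<And>\<alpha>. \<alpha> \<in> ?E \<Longrightarrow> x \<alpha> = y \<alpha>) \<Longrightarrow> mpoly_eval Q x \<noteq> 0"
    by (rule polynomial_map_not_dominant[where \<Phi> = C, OF fin card C(1)]) blast
  define Z where "Z = {P \<in> real_polys k. mpoly_eval Q (Poly_Mapping.lookup P) = 0}"
  \<comment> \<open>The point at which the relation fails, read as a polynomial: it shows that
    \<open>Z\<close> is proper.\<close>
  define P0 where "P0 = Abs_poly_mapping (\<lambda>\<alpha>. if \<alpha> \<in> ?E then y \<alpha> else 0)"
  have P0: "Poly_Mapping.lookup P0 = (\<lambda>\<alpha>. if \<alpha> \<in> ?E then y \<alpha> else 0)"
    unfolding P0_def by (rule lookup_Abs_finite[OF fin(1)])
  have "P0 \<in> real_polys k" by (auto simp: real_polys_iff in_keys_iff P0 split: if_splits)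
  moreover have "mpoly_eval Q (Poly_Mapping.lookup P0) \<noteq> 0" by (rule Q(2)) (simp add: P0)
  ultimately have "Z \<noteq> real_polys k" unfolding Z_def by blast
  moreover have "zariski_closed_in_polys k Z"
    unfolding zariski_closed_in_polys_def Z_def by (intro exI[of _ "{Q}"]) auto
  moreover have "\<Phi> (poly_hypersurface P)" if P: "P \<in> real_polys k - Z" for P
  proof (rule ccontr)
    assume "\<not> \<Phi> (poly_hypersurface P)"
    then obtain t :: "('n cspace, 'n, 'm) jet_coord \<Rightarrow> real" where
      "vanishes (Suc k) (\<lambda>x. poly_fun P (jet_point t + x) - jet_factor k t x * jet_quadric k t x)"
      using bad P by blast
    then have "mpoly_eval Q (Poly_Mapping.lookup P) = 0" using C(2) P by (intro Q(1)) auto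
    then show False using P by (simp add: Z_def)
  qed
  ultimately show ?thesis unfolding zariski_generic_hypersurface_def by blast
qed

section \<open>Counting\<close>

lemma binomial_complement: "(N + k choose k) = (N + k choose N)"
  using binomial_symmetric[of k "N + k"] by simp

text \<open>The ratio of the counts in \<open>N + 1\<close> and in \<open>N\<close> variables; it
  grows linearly in \<open>k\<close>.\<close>

lemma binomial_Suc_absorb: "Suc N * (Suc N + k choose k) = (Suc N + k) * (N + k choose k)"
proof -
  have "Suc N * (Suc N + k choose Suc N) = Suc (N + k) * (N + k choose N)"
    using Suc_times_binomial_eq[of "N + k" N] by (simp only: add_Suc mult.commute)
  then show ?thesis
    using binomial_complement[of "Suc N" k] binomial_complement[of N k] by (simp only: add_Suc)
qed

text \<open>Passing from \<open>2 * n\<close> to \<open>2 * n + 1\<close> variables multiplies the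
  count by \<open>(2 * n + 1 + k) / (2 * n + 1)\<close>, at least \<open>2 * m + 3\<close> by the
  bound on \<open>k\<close>, and \<open>2 * n\<close> is at least \<open>n + 1\<close>. Of the
  resulting \<open>2 * m + 3\<close> copies of the holomorphic count, \<open>2 * m + 2\<close> pay
  for the real and imaginary parts of the map and the last one for the point and the signs.\<close>

lemma jet_count:
  fixes n m k :: nat
  assumes n: "1 \<le> n" and k: "(2 * n + 1) * (2 * m + 2) \<le> k"
  shows "2 * (m + 1) * (n + 1 + k choose k) + 2 * (n + 1) + m < (2 * n + 1 + k choose k)"
proof -
  let ?A = "n + 1 + k choose k" and ?B = "2 * n + 1 + k choose k"
  have "(2 * n + 1) * ?B = (2 * n + 1 + k) * (2 * n + k choose k)"
    using binomial_Suc_absorb[of "2 * n" k] by simp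
  also have "\<dots> \<ge> ((2 * n + 1) * (2 * m + 3)) * ?A"
  proof (rule mult_mono)
    show "(2 * n + 1) * (2 * m + 3) \<le> 2 * n + 1 + k" using k by (simp add: algebra_simps)
    show "?A \<le> (2 * n + k choose k)" by (rule binomial_right_mono) (use n in simp)
  qed auto
  finally have "(2 * n + 1) * ((2 * m + 3) * ?A) \<le> (2 * n + 1) * ?B" by (simp only: mult.assoc)
  then have "(2 * m + 3) * ?A \<le> ?B" by (simp only: mult_le_cancel1)
  moreover have "2 * (n + 1) + m < ?A"
  proof -
    have "2 * (n + 1) + m \<le> (2 * n + 1) * (2 * m + 2)" by (simp add: algebra_simps)
    also have "\<dots> < (1 + k choose k)" using k by simp
    also have "\<dots> \<le> ?A" by (rule binomial_right_mono) simp
    finally show ?thesis .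
  qed
  ultimately show ?thesis by (simp add: algebra_simps)
qed

lemma card_jet_coords_less:
  assumes "(2 * CARD('n) + 1) * (2 * CARD('m) + 2) \<le> k"
  shows "card (jet_coords k :: ('n::finite cspace, 'n, 'm::finite) jet_coord set)
    < card (expo (Basis :: 'n cspace set) k)"
proof -
  let ?n = "CARD('n)" and ?m = "CARD('m)"
  let ?RE = "(\<lambda>(j, \<gamma>). MapRe j \<gamma>) ` (UNIV \<times> expo UNIV k) :: ('n cspace, 'n, 'm) jet_coord set"
  let ?IM = "(\<lambda>(j, \<gamma>). MapIm j \<gamma>) ` (UNIV \<times> expo UNIV k) :: ('n cspace, 'n, 'm) jet_coord set"
  let ?PT = "Point ` Basis :: ('n cspace, 'n, 'm) jet_coord set"
  let ?SG = "Sign ` UNIV :: ('n cspace, 'n, 'm) jet_coord set"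
  let ?FC = "Factor ` expo Basis (k - 1) :: ('n cspace, 'n, 'm) jet_coord set"
  have k: "k = Suc (k - 1)" using assms by (cases k) auto
  have dim: "card (Basis :: 'n cspace set) = 2 * ?n + 2" by simp
  have "card ?PT \<le> 2 * ?n + 2" using card_image_le[of "Basis :: 'n cspace set" Point]
    by (simp add: dim del: DIM_cart)
  moreover have "card ?SG \<le> ?m" by (rule card_image_le) simp
  moreover have "card ?FC \<le> (2 * ?n + 1 + k choose (k - 1))"
  proof -
    have "card ?FC \<le> card (expo (Basis :: 'n cspace set) (k - 1))"
      by (rule card_image_le) (simp add: finite_expo)
    moreover have "2 * ?n + 2 + (k - 1) = 2 * ?n + 1 + k" using k by linarith
    ultimately show ?thesis unfolding card_expo[OF finite_Basis] dim by simp
  qed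
  moreover have "card (UNIV \<times> expo UNIV k :: ('m option \<times> ('n option \<Rightarrow>\<^sub>0 nat)) set) = (?m + 1) * (?n + 1 + k choose k)"
    by (simp add: card_cartesian_product card_expo)
  then have "card ?RE \<le> (?m + 1) * (?n + 1 + k choose k)" "card ?IM \<le> (?m + 1) * (?n + 1 + k choose k)"
    using card_image_le[OF finite_cartesian_product[OF finite finite_expo[OF finite]]] by metis+
  moreover have "card (jet_coords k :: ('n cspace, 'n, 'm) jet_coord set) \<le> card ?PT + card ?SG + card ?FC + card ?RE + card ?IM"
    unfolding jet_coords_def using card_Un_le[of "?PT \<union> ?SG \<union> ?FC \<union> ?RE" ?IM]
      card_Un_le[of "?PT \<union> ?SG \<union> ?FC" ?RE] card_Un_le[of "?PT \<union> ?SG" ?FC] card_Un_le[of ?PT ?SG] by linarith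
  moreover have "2 * ((?m + 1) * (?n + 1 + k choose k)) + (2 * ?n + 2) + ?m < (2 * ?n + 1 + k choose k)"
    using jet_count[OF _ assms] by (simp add: Suc_leI mult.assoc)
  \<comment> \<open>Pascal's rule: the first summand is used up by the \<open>Factor\<close>
    coordinates, the second is left for the others and is what \<open>jet_count\<close>
    estimates.\<close>
  moreover have "card (expo (Basis :: 'n cspace set) k) = (2 * ?n + 1 + k choose (k - 1)) + (2 * ?n + 1 + k choose k)"
  proof -
    have "card (expo (Basis :: 'n cspace set) k) = (Suc (2 * ?n + 1 + k) choose Suc (k - 1))"
      using k by (simp add: card_expo dim del: DIM_cart)
    also have "\<dots> = (2 * ?n + 1 + k choose (k - 1)) + (2 * ?n + 1 + k choose Suc (k - 1))"
      by (rule binomial_Suc_Suc)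
    finally show ?thesis using k by simp
  qed
  moreover have "J < E" if "a \<le> q" "b \<le> m" "c \<le> u" "d \<le> X" "e \<le> X" "J \<le> a + b + c + d + e"
    "2 * X + q + m < v" "E = u + v" for J E a b c d e q m u v X :: nat
    using that by linarith
  ultimately show ?thesis by blast
qed

text \<open>A cubic bound is enough: for \<open>m \<ge> 2\<close>, \<open>p_bound m n\<close> is at
  least 3, so the binomial in \<open>\<nu>\<close> is at least \<open>3 + a choose a\<close>. With
  \<open>a \<ge> 6\<close> this is at least \<open>12 * (1 + a)\<close>, while \<open>12 * a\<close>
  equals \<open>6 * ((m + 1) * (m + 2))\<close>.\<close>

lemma \<nu>_lower_bound:
  assumes "1 \<le> n" "n \<le> m"
  shows "(2 * n + 1) * (2 * m + 2) \<le> \<nu> n m"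
proof (cases "m = 1")
  case True
  then have "n = 1" using assms by simp
  \<comment> \<open>In this case \<open>p_bound\<close> is only 2, and the bound is sharp: both
    sides equal 12.\<close>
  have "(5 choose 2 :: nat) = 10" by (simp add: eval_nat_numeral)
  then show ?thesis using True \<open>n = 1\<close> by (simp add: \<nu>_def p_bound_def)
next
  case False
  then have m: "m \<ge> 2" using assms by simp
  define a where "a = (m + 1) * (m + 2) div 2"
  have a2: "2 * a = (m + 1) * (m + 2)" unfolding a_def by simp
  have a6: "a \<ge> 6"
  proof -
    have "3 * 4 \<le> (m + 1) * (m + 2)" by (rule mult_le_mono) (use m in auto)
    then show ?thesis using a2 by linarith
  qed
  have p: "3 \<le> p_bound m n"
  proof (cases "n = 1")
    case True
    then show ?thesis using m by (simp add: p_bound_def)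
  next
    case False
    then have "2 * 3 \<le> n * (n + 1)" using assms by (intro mult_le_mono) auto
    then have "1 * 1 \<le> (n * (n + 1) div 2) * (m choose n)"
      using assms by (intro mult_le_mono) (auto simp: Suc_leI)
    then show ?thesis unfolding p_bound_def using False assms by linarith
  qed
  define b where "b = (3 + a choose a)"
  have "(1 + a choose a) = 1 + a" by simp
  then have c: "2 * (2 + a choose a) = (2 + a) * (1 + a)"
    using binomial_Suc_absorb[of 1 a] by (simp add: numeral_2_eq_2)
  have "3 * b = (3 + a) * (2 + a choose a)"
    using binomial_Suc_absorb[of 2 a] by (simp add: b_def numeral_3_eq_3)
  then have "2 * (3 * b) = (3 + a) * (2 * (2 + a choose a))" by (simp only: mult.left_commute)
  then have "6 * b = (3 + a) * ((2 + a) * (1 + a))" unfolding c by simp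
  moreover have "9 * (8 * (1 + a)) \<le> (3 + a) * ((2 + a) * (1 + a))"
    by (intro mult_le_mono) (use a6 in auto)
  ultimately have b: "12 * (1 + a) \<le> b" by linarith
  have "(2 * n + 1) * (2 * m + 2) \<le> (2 * m + 1) * (2 * m + 2)" using assms by (intro mult_le_mono) auto
  also have "\<dots> \<le> 6 * ((m + 1) * (m + 2))" by (simp add: algebra_simps)
  also have "\<dots> \<le> b" using b unfolding a2[symmetric] by simp
  also have "b \<le> (p_bound m n + a choose a)" unfolding b_def by (rule binomial_right_mono) (use p in simp)
  also have "\<dots> = (a + p_bound m n choose p_bound m n)"
    using binomial_complement[of "p_bound m n" a] binomial_complement[of a "p_bound m n"] by (simp add: add.commute)
  also have "\<dots> \<le> \<nu> n m" by (simp add: \<nu>_def a_def)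
  finally show ?thesis .
qed

theorem theorem5:
  fixes n m :: nat
  assumes "n = CARD('n::finite)" and "m = CARD('m::finite)"
  shows "(m \<ge> n \<longrightarrow>
            (\<forall>k\<ge>\<nu> n m. zariski_generic_hypersurface k
               (\<lambda>M :: 'n cspace set. not_contained_in M (M_tilde TYPE('m))))) \<and>
         (m > n \<longrightarrow>
            (\<forall>k\<ge>\<mu> n m. zariski_generic_hypersurface k
               (\<lambda>M :: 'n cspace set. \<not> transversally_embeddable TYPE('m) M)))"
proof -
  have "1 \<le> n" using assms(1) by (simp add: Suc_leI)
  have count: "card (jet_coords k :: ('n cspace, 'n, 'm) jet_coord set) < card (expo (Basis :: 'n cspace set) k)"
    and k1: "1 \<le> k" if "n \<le> m" "\<nu> n m \<le> k" for k
  proof -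
    have k: "(2 * CARD('n) + 1) * (2 * CARD('m) + 2) \<le> k"
      using \<nu>_lower_bound[OF \<open>1 \<le> n\<close> that(1)] that(2) assms by simp
    then show "card (jet_coords k :: ('n cspace, 'n, 'm) jet_coord set) < card (expo (Basis :: 'n cspace set) k)"
      by (rule card_jet_coords_less)
    show "1 \<le> k" using k by simp
  qed
  \<comment> \<open>Common to both statements: \<open>V\<close> cuts out the open piece of the
    hypersurface in the first and is \<open>UNIV\<close> in the second.\<close>
  have jet: "\<exists>t :: ('n cspace, 'n, 'm) jet_coord \<Rightarrow> real.
      vanishes (Suc k) (\<lambda>x. poly_fun P (jet_point t + x) - jet_factor k t x * jet_quadric k t x)"
    if "P \<in> real_polys k" "1 \<le> k" "open V" and emb: "transversal_embedding S (poly_hypersurface P \<inter> V) p U F"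
    for P :: "('n cspace \<Rightarrow>\<^sub>0 nat) \<Rightarrow>\<^sub>0 real" and k V p U and S :: "'m set" and F
  proof (rule embedding_imp_jet[of P k p "V \<inter> U" F U S])
    show "F ` (poly_hypersurface P \<inter> (V \<inter> U)) \<subseteq> hyperquadric S"
      using emb by (simp add: transversal_embedding_def Int_assoc)
  qed (use that in \<open>auto simp: transversal_embedding_def holomorphic_embedding_on_def\<close>)
  have "zariski_generic_hypersurface k (\<lambda>M :: 'n cspace set. not_contained_in M (M_tilde TYPE('m)))"
    if k: "n \<le> m" "\<nu> n m \<le> k" for k
  proof (rule zariski_genericI[OF count[OF k]])
    fix P :: "('n cspace \<Rightarrow>\<^sub>0 nat) \<Rightarrow>\<^sub>0 real"
    assume P: "P \<in> real_polys k" and "\<not> not_contained_in (poly_hypersurface P) (M_tilde TYPE('m))"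
    then obtain M' where "openin (top_of_set (poly_hypersurface P)) M'" "M' \<in> M_tilde TYPE('m)"
      unfolding not_contained_in_def by blast
    moreover obtain V where "open V" "M' = poly_hypersurface P \<inter> V"
      using calculation(1) openin_open by blast
    ultimately show "\<exists>t :: ('n cspace, 'n, 'm) jet_coord \<Rightarrow> real.
      vanishes (Suc k) (\<lambda>x. poly_fun P (jet_point t + x) - jet_factor k t x * jet_quadric k t x)"
      using jet[OF P k1[OF k]] unfolding M_tilde_def by blast
  qed
  moreover have "zariski_generic_hypersurface k (\<lambda>M :: 'n cspace set. \<not> transversally_embeddable TYPE('m) M)"
    if k: "n \<le> m" "\<nu> n m \<le> k" for k
  proof (rule zariski_genericI[OF count[OF k]])
    fix P :: "('n cspace \<Rightarrow>\<^sub>0 nat) \<Rightarrow>\<^sub>0 real"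
    assume P: "P \<in> real_polys k" and "\<not> \<not> transversally_embeddable TYPE('m) (poly_hypersurface P)"
    then show "\<exists>t :: ('n cspace, 'n, 'm) jet_coord \<Rightarrow> real.
      vanishes (Suc k) (\<lambda>x. poly_fun P (jet_point t + x) - jet_factor k t x * jet_quadric k t x)"
      using jet[OF P k1[OF k] open_UNIV] unfolding transversally_embeddable_def by auto
  qed
  ultimately show ?thesis by (simp add: \<mu>_def)
qed

end
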